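(* Let $\varepsilon>0$ and let $f(Z)=\sum_\alpha c_\alpha Z^\alpha$ be a matrix convex function whose power series converges absolutely and uniformly on $B_{\mathbb C}(0,1+\varepsilon)\subseteq\mathcal M(\mathbb R^d)$. Let $\mathcal H$ be the Hilbert space obtained from the span of the symbols $\alpha\otimes v$, where $\alpha$ ranges over all words of degree greater than or equal to $1$ and $v$ over $\mathcal K$, equipped with the inner product $$\langle\alpha\otimes v,\beta\otimes w\rangle=w^*c_{\beta^*\alpha}v .$$ Define the self-adjoint operators $T_i$ ($i=1,\dots,d$) on $\mathcal H$ by $T_i(\alpha\otimes v)=x_i\alpha\otimes v$, and let $Q_i:\mathcal K\to\mathcal H$ be the map taking $v\in\mathcal K$ to $x_i\otimes v$. Then the operators $T_i$ are contractions and, for some choice of $a_0$ and continuous linear function $L$, $$f(Z)=a_0+L(Z)+\Big(\sum_iQ_iZ_i^*\Big)^*\Big(I-\sum_iT_iZ_i\Big)^{-1}\Big(\sum_iQ_iZ_i\Big)$$ for $Z\in B_{\mathbb C}(0,1+\varepsilon)$.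
   Context: $\mathbb R^d$ is the real operator system of real diagonal $d\times d$ matrices, so $\mathcal M(\mathbb R^d)$ is the set of $d$-tuples $Z=(Z_1,\dots,Z_d)$ of complex matrices of equal size $n$ ($n$ arbitrary), with norm $\|Z\|=\max_i\|Z_i\|$, and $\mathcal S(\mathbb R^d)$ is the subset of tuples of Hermitian matrices, ordered componentwise. $B_{\mathbb C}(0,r)=\{Z\in\mathcal M(\mathbb R^d):\|Z\|<r\}$ (all sizes), and $B_{\mathbb R}(0,r)=B_{\mathbb C}(0,r)\cap\mathcal S(\mathbb R^d)$. The function $f$ takes values in matrices over a real operator system $R_2\subseteq\mathcal B(\mathcal K)$ on Hermitian arguments, where $\mathcal K$ is a Hilbert space (a real operator system is a real subspace of self-adjoint elements containing $1$). Sums run over all words $\alpha$ in noncommuting letters $x_1,\dots,x_d$; the degree of a word is its length; $c_\alpha\in\mathcal B(\mathcal K)$; $c_\alpha Z^\alpha$ means $c_\alpha\otimes Z^\alpha$. $\beta^*$ denotes the word $\beta$ reversed. Matrix convex means: $f\left(\frac{A+B}{2}\right)\le\frac{f(A)+f(B)}{2}$ for Hermitian tuples $A,B$ of the same size in the real domain $B_{\mathbb R}(0,1+\varepsilon)$. The Hilbert space $\mathcal H$ is understood after quotienting by null vectors and completing. $a_0\in\mathcal B(\mathcal K)$ stands for $a_0\otimes I$, and $L(Z)=\sum_i L_i\otimes Z_i$ for some $L_i\in\mathcal B(\mathcal K)$. Tensor products with the identity are suppressed: $T_iZ_i$ means $T_i\otimes Z_i$ and $Q_iZ_i$ means $Q_i\otimes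 Z_i$. *)

theory Defs
  imports
    "HOL-Analysis.Bounded_Linear_Function"
    "HOL-Analysis.Infinite_Sum"
    "HOL-Analysis.L2_Norm"
    "HOL-Library.Nonpos_Ints"
    "HOL-Library.Poly_Mapping"
    "Jordan_Normal_Form.Schur_Decomposition"
begin

section \<open>Complex Hilbert spaces and their bounded operators\<close>

text \<open>
  The sesquilinear inner product \<open>cinner\<close> is linear in the \<^emph>\<open>first\<close> argument; its real part
  is the real inner product, so that norm, metric and completeness are those of the underlying
  real Hilbert space.
\<close>

class complex_hilbert = real_inner + complete_space +
  fixes scaleC :: "complex \<Rightarrow> 'a \<Rightarrow> 'a"
    and cinner :: "'a \<Rightarrow> 'a \<Rightarrow> complex"
  assumes scaleC_add_right: "scaleC a (x + y) = scaleC a x + scaleC a y"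
    and scaleC_add_left: "scaleC (a + b) x = scaleC a x + scaleC b x"
    and scaleC_scaleC: "scaleC a (scaleC b x) = scaleC (a * b) x"
    and scaleC_of_real: "scaleC (complex_of_real r) x = r *\<^sub>R x"
    and cinner_add_left: "cinner (x + y) z = cinner x z + cinner y z"
    and cinner_scaleC_left: "cinner (scaleC a x) y = a * cinner x y"
    and cinner_commute: "cinner x y = cnj (cinner y x)"
    and Re_cinner: "Re (cinner x y) = x \<bullet> y"

instantiation complex :: complex_hilbert
begin
definition "scaleC_complex (a::complex) (x::complex) = a * x"
definition "cinner_complex (x::complex) (y::complex) = x * cnj y"
instance
  by standard
    (auto simp: scaleC_complex_def cinner_complex_def inner_complex_def algebra_simps
       scaleR_conv_of_real)
end

lemma norm_scaleC: "norm (scaleC a x) = cmod a * norm (x::'a::complex_hilbert)"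
proof -
  have im: "Im (cinner x x) = 0"
    using arg_cong[OF cinner_commute[of x x], of Im] by simp
  have "cinner (scaleC a x) (scaleC a x) = a * cnj a * cinner x x"
    using cinner_commute[of x "scaleC a x"] cinner_commute[of x x]
    by (simp add: cinner_scaleC_left)
  then have "Re (cinner (scaleC a x) (scaleC a x)) = (cmod a)\<^sup>2 * Re (cinner x x)"
    by (simp add: complex_norm_square[symmetric] im)
  then have "(norm (scaleC a x))\<^sup>2 = (cmod a * norm x)\<^sup>2"
    by (simp add: Re_cinner power2_norm_eq_inner power_mult_distrib)
  then show ?thesis
    by (simp add: power2_eq_iff_nonneg)
qed

lemma bounded_linear_scaleC: "bounded_linear (scaleC a :: 'a::complex_hilbert \<Rightarrow> 'a)"
  by (rule bounded_linear_intro[where K = "cmod a"])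
    (simp_all add: scaleC_add_right norm_scaleC scaleC_scaleC scaleC_of_real[symmetric] mult.commute)

text \<open>The space \<open>'a \<Rightarrow>\<^sub>L 'b\<close> consists of the bounded real-linear maps; the bounded operators
  between complex Hilbert spaces are its complex-linear elements.\<close>

definition clinear_ops :: "('a::complex_hilbert \<Rightarrow>\<^sub>L 'b::complex_hilbert) set" where
  "clinear_ops = {A. \<forall>a x. blinfun_apply A (scaleC a x) = scaleC a (blinfun_apply A x)}"

lift_definition scaleC_op ::
    "complex \<Rightarrow> ('a::real_normed_vector \<Rightarrow>\<^sub>L 'b::complex_hilbert) \<Rightarrow> ('a \<Rightarrow>\<^sub>L 'b)"
  is "\<lambda>a A x. scaleC a (A x)"
  by (rule bounded_linear_compose[OF bounded_linear_scaleC])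

definition adj_op ::
    "('a::complex_hilbert \<Rightarrow>\<^sub>L 'b::complex_hilbert) \<Rightarrow> ('b \<Rightarrow>\<^sub>L 'a)" where
  "adj_op A = (THE B. \<forall>x y. cinner (blinfun_apply A x) y = cinner x (blinfun_apply B y))"

definition selfadjoint_op :: "('a::complex_hilbert \<Rightarrow>\<^sub>L 'a) \<Rightarrow> bool" where
  "selfadjoint_op A \<longleftrightarrow>
     (\<forall>x y. cinner (blinfun_apply A x) y = cinner x (blinfun_apply A y))"

definition real_operator_system :: "('k::complex_hilbert \<Rightarrow>\<^sub>L 'k) set \<Rightarrow> bool" where
  "real_operator_system R \<longleftrightarrow>
     Real_Vector_Spaces.subspace R \<and> id_blinfun \<in> R \<and> R \<subseteq> {A \<in> clinear_ops. selfadjoint_op A}"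


section \<open>Operator matrices\<close>

text \<open>
  The Hilbert space \<open>\<K> \<otimes> \<complex>\<^sup>n\<close> is represented by vectors in \<open>carrier_vec n\<close> with entries in
  \<open>\<K>\<close>, and \<open>\<B>(\<K> \<otimes> \<complex>\<^sup>n)\<close> by \<open>n \<times> n\<close> matrices of bounded operators.
\<close>

definition vec_l2 :: "'a::real_normed_vector vec \<Rightarrow> real" where
  "vec_l2 u = L2_set (\<lambda>p. norm (u $ p)) {..<dim_vec u}"

definition vec_cinner :: "'a::complex_hilbert vec \<Rightarrow> 'a vec \<Rightarrow> complex" where
  "vec_cinner u v = (\<Sum>p<dim_vec v. cinner (u $ p) (v $ p))"

definition mat_norm :: "complex mat \<Rightarrow> real" where
  "mat_norm M = Sup {vec_l2 (M *\<^sub>v u) | u. u \<in> carrier_vec (dim_col M) \<and> vec_l2 u \<le> 1}"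

definition op_mat_apply ::
    "('a::real_normed_vector \<Rightarrow>\<^sub>L 'b::real_normed_vector) mat \<Rightarrow> 'a vec \<Rightarrow> 'b vec" where
  "op_mat_apply M u = vec (dim_row M) (\<lambda>p. \<Sum>q<dim_col M. blinfun_apply (M $$ (p, q)) (u $ q))"

definition op_mat_norm ::
    "('a::real_normed_vector \<Rightarrow>\<^sub>L 'b::real_normed_vector) mat \<Rightarrow> real" where
  "op_mat_norm M =
     Sup {vec_l2 (op_mat_apply M u) | u. u \<in> carrier_vec (dim_col M) \<and> vec_l2 u \<le> 1}"

definition op_mat_mult ::
    "('b::real_normed_vector \<Rightarrow>\<^sub>L 'c::real_normed_vector) mat
      \<Rightarrow> ('a::real_normed_vector \<Rightarrow>\<^sub>L 'b) mat \<Rightarrow> ('a \<Rightarrow>\<^sub>L 'c) mat" where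
  "op_mat_mult M N =
     mat (dim_row M) (dim_col N)
       (\<lambda>(p, r). \<Sum>q<dim_col M. (M $$ (p, q)) o\<^sub>L (N $$ (q, r)))"

definition op_mat_one :: "nat \<Rightarrow> ('a::real_normed_vector \<Rightarrow>\<^sub>L 'a) mat" where
  "op_mat_one n = mat n n (\<lambda>(p, q). if p = q then id_blinfun else 0)"

definition op_mat_adj ::
    "('a::complex_hilbert \<Rightarrow>\<^sub>L 'b::complex_hilbert) mat \<Rightarrow> ('b \<Rightarrow>\<^sub>L 'a) mat" where
  "op_mat_adj M = mat (dim_col M) (dim_row M) (\<lambda>(p, q). adj_op (M $$ (q, p)))"

definition op_mat_le ::
    "('a::complex_hilbert \<Rightarrow>\<^sub>L 'a) mat \<Rightarrow> ('a \<Rightarrow>\<^sub>L 'a) mat \<Rightarrow> bool" where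
  "op_mat_le M N \<longleftrightarrow>
     (\<forall>u\<in>carrier_vec (dim_col N). vec_cinner (op_mat_apply (N - M) u) u \<in> \<real>\<^sub>\<ge>\<^sub>0)"

definition op_mat_inverse ::
    "nat \<Rightarrow> ('a::real_normed_vector \<Rightarrow>\<^sub>L 'a) mat \<Rightarrow> ('a \<Rightarrow>\<^sub>L 'a) mat \<Rightarrow> bool" where
  "op_mat_inverse n M R \<longleftrightarrow> R \<in> carrier_mat n n \<and>
     op_mat_mult M R = op_mat_one n \<and> op_mat_mult R M = op_mat_one n"

definition op_tensor ::
    "('a::real_normed_vector \<Rightarrow>\<^sub>L 'b::complex_hilbert) \<Rightarrow> complex mat \<Rightarrow> ('a \<Rightarrow>\<^sub>L 'b) mat" where
  "op_tensor A M = map_mat (\<lambda>z. scaleC_op z A) M"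

text \<open>\<open>op_tensor_sum n J A M\<close> is \<open>\<Sum>j\<in>J. A j \<otimes> M j\<close> for a finite set \<open>J\<close> and \<open>n \<times> n\<close> matrices
  \<open>M j\<close>; it is written out entrywise because matrices form no additive monoid as a type.\<close>

definition op_tensor_sum ::
    "nat \<Rightarrow> 'j set \<Rightarrow> ('j \<Rightarrow> ('a::real_normed_vector \<Rightarrow>\<^sub>L 'b::complex_hilbert))
      \<Rightarrow> ('j \<Rightarrow> complex mat) \<Rightarrow> ('a \<Rightarrow>\<^sub>L 'b) mat" where
  "op_tensor_sum n J A M = mat n n (\<lambda>(p, q). \<Sum>j\<in>J. scaleC_op (M j $$ (p, q)) (A j))"

text \<open>The self-adjoint elements of \<open>M\<^sub>n(\<complex>) \<otimes> R\<close>: entries lie in \<open>R + iR\<close>.\<close>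

definition herm_mats_over ::
    "nat \<Rightarrow> ('k::complex_hilbert \<Rightarrow>\<^sub>L 'k) set \<Rightarrow> ('k \<Rightarrow>\<^sub>L 'k) mat set" where
  "herm_mats_over n R =
     {M \<in> carrier_mat n n. op_mat_adj M = M \<and>
        (\<forall>p<n. \<forall>q<n. \<exists>A\<in>R. \<exists>B\<in>R. M $$ (p, q) = A + scaleC_op \<i> B)}"


section \<open>Noncommutative balls, power series and matrix convexity\<close>

text \<open>The finite type \<open>'d\<close> indexes the \<open>d\<close> letters, and words are lists of letters.\<close>

definition tuple_norm :: "('d::finite \<Rightarrow> complex mat) \<Rightarrow> real" where
  "tuple_norm Z = Max (range (\<lambda>i. mat_norm (Z i)))"

definition complex_nc_ball :: "nat \<Rightarrow> real \<Rightarrow> ('d::finite \<Rightarrow> complex mat) set" where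
  "complex_nc_ball n r = {Z. 0 < n \<and> (\<forall>i. Z i \<in> carrier_mat n n) \<and> tuple_norm Z < r}"

definition real_nc_ball :: "nat \<Rightarrow> real \<Rightarrow> ('d::finite \<Rightarrow> complex mat) set" where
  "real_nc_ball n r = {Z \<in> complex_nc_ball n r. \<forall>i. mat_adjoint (Z i) = Z i}"

definition word_power :: "nat \<Rightarrow> ('d \<Rightarrow> complex mat) \<Rightarrow> 'd list \<Rightarrow> complex mat" where
  "word_power n Z \<alpha> = foldr (\<lambda>i M. Z i * M) \<alpha> (1\<^sub>m n)"

text \<open>\<open>f Z = \<Sum>\<alpha>. c \<alpha> \<otimes> Z\<^sup>\<alpha>\<close> on the complex ball of radius \<open>r\<close> (all sizes), with absolute
  convergence at every point and convergence of the net of finite partial sums that is uniform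
  over all points and all sizes.\<close>

definition nc_power_series_on ::
    "real \<Rightarrow> ('d::finite list \<Rightarrow> ('k::complex_hilbert \<Rightarrow>\<^sub>L 'k))
      \<Rightarrow> (('d \<Rightarrow> complex mat) \<Rightarrow> ('k \<Rightarrow>\<^sub>L 'k) mat) \<Rightarrow> bool" where
  "nc_power_series_on r c f \<longleftrightarrow>
     range c \<subseteq> clinear_ops \<and>
     (\<forall>n. \<forall>Z\<in>complex_nc_ball n r. f Z \<in> carrier_mat n n \<and>
        (\<lambda>\<alpha>. op_mat_norm (op_tensor (c \<alpha>) (word_power n Z \<alpha>))) summable_on UNIV) \<and>
     (\<forall>e>0. \<forall>\<^sub>F F in finite_subsets_at_top UNIV. \<forall>n. \<forall>Z\<in>complex_nc_ball n r.
        op_mat_norm (f Z - op_tensor_sum n F c (word_power n Z)) < e)"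

definition matrix_convex_on ::
    "real \<Rightarrow> (('d::finite \<Rightarrow> complex mat) \<Rightarrow> ('k::complex_hilbert \<Rightarrow>\<^sub>L 'k) mat) \<Rightarrow> bool" where
  "matrix_convex_on r f \<longleftrightarrow>
     (\<forall>n. \<forall>A\<in>real_nc_ball n r. \<forall>B\<in>real_nc_ball n r.
        op_mat_le (f (\<lambda>i. (1/2) \<cdot>\<^sub>m (A i + B i))) (map_mat ((*\<^sub>R) (1/2)) (f A + f B)))"


section \<open>The Hilbert space spanned by the symbols \<open>\<alpha> \<otimes> v\<close>\<close>

text \<open>The symbol \<open>\<alpha> \<otimes> v\<close> is \<open>Poly_Mapping.single \<alpha> v\<close>; only nonempty words are used.\<close>

definition word_span :: "('d list \<Rightarrow>\<^sub>0 'k::complex_hilbert) set" where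
  "word_span = {p. [] \<notin> Poly_Mapping.keys p}"

text \<open>The sesquilinear extension of
  \<open>\<langle>\<alpha> \<otimes> v, \<beta> \<otimes> w\<rangle> = w\<^sup>* c\<^bsub>\<beta>\<^sup>*\<alpha>\<^esub> v\<close>, where \<open>\<beta>\<^sup>*\<close> is the reversed word.\<close>

definition word_form ::
    "('d list \<Rightarrow> ('k::complex_hilbert \<Rightarrow>\<^sub>L 'k))
      \<Rightarrow> ('d list \<Rightarrow>\<^sub>0 'k) \<Rightarrow> ('d list \<Rightarrow>\<^sub>0 'k) \<Rightarrow> complex" where
  "word_form c p q =
     (\<Sum>\<alpha>\<in>Poly_Mapping.keys p. \<Sum>\<beta>\<in>Poly_Mapping.keys q.
        cinner (blinfun_apply (c (rev \<beta> @ \<alpha>)) (Poly_Mapping.lookup p \<alpha>)) (Poly_Mapping.lookup q \<beta>))"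

definition word_form_semi_inner ::
    "('d list \<Rightarrow> ('k::complex_hilbert \<Rightarrow>\<^sub>L 'k)) \<Rightarrow> bool" where
  "word_form_semi_inner c \<longleftrightarrow>
     (\<forall>p\<in>word_span. \<forall>q\<in>word_span. word_form c p q = cnj (word_form c q p)) \<and>
     (\<forall>p\<in>word_span. word_form c p p \<in> \<real>\<^sub>\<ge>\<^sub>0)"

text \<open>
  \<open>word_completion c \<iota>\<close>: the Hilbert space \<open>'h\<close> is the Hausdorff completion of the span of the
  symbols, and \<open>\<iota>\<close> is the canonical map. Since \<open>\<iota>\<close> preserves the form, its kernel consists
  exactly of the null vectors; since \<open>'h\<close> is complete and the image is dense, \<open>'h\<close> is the
  completion of the quotient by them. A completion exists precisely when
  \<open>word_form_semi_inner c\<close> holds. It depends on \<open>c\<close>, hence it cannot be a defined type.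
\<close>

definition word_completion ::
    "('d list \<Rightarrow> ('k::complex_hilbert \<Rightarrow>\<^sub>L 'k))
      \<Rightarrow> (('d list \<Rightarrow>\<^sub>0 'k) \<Rightarrow> 'h::complex_hilbert) \<Rightarrow> bool" where
  "word_completion c \<iota> \<longleftrightarrow>
     (\<forall>p\<in>word_span. \<forall>q\<in>word_span. \<iota> (p + q) = \<iota> p + \<iota> q) \<and>
     (\<forall>a. \<forall>p\<in>word_span. \<iota> (Poly_Mapping.map (scaleC a) p) = scaleC a (\<iota> p)) \<and>
     (\<forall>p\<in>word_span. \<forall>q\<in>word_span. cinner (\<iota> p) (\<iota> q) = word_form c p q) \<and>
     closure (\<iota> ` word_span) = UNIV"

end

theory Submission
  imports Defs "HOL-Analysis.Complex_Analysis_Basics" "HOL-Analysis.Lipschitz"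
begin

text \<open>
  The whole theorem rests on two facts about the form
  \<open>\<langle>\<alpha> \<otimes> v, \<beta> \<otimes> w\<rangle> = \<langle>c (rev \<beta> @ \<alpha>) v, w\<rangle>\<close> on nonempty words: it is positive, because \<open>f\<close> is matrix
  convex, and the operators \<open>\<Sum>\<^sub>i T\<^sub>i \<otimes> Z\<^sub>i\<close> that it produces are strict contractions on the ball, because the
  power series converges there. The formula for \<open>f\<close> is then the Neumann series, compared with the
  power series degree by degree.

  Positivity (\<open>word_form_nonneg\<close>). Let the letters act by the symmetric adjacency matrices of the
  tree of words, in which \<open>s\<close> and \<open>s @ [i]\<close> are joined by an edge of letter \<open>i\<close>. A shortest walk
  from \<open>\<beta>\<close> to \<open>\<alpha>\<close> through the root reads precisely the word \<open>rev \<beta> @ \<alpha>\<close>. Changing the sign of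
  the edges at the root gives a second tuple whose midpoint with the first has no edges at the root, so the
  convexity defect of \<open>f\<close> at these two tuples is a sum over walks through the root. After both tuples
  are multiplied by \<open>d\<close> and the test vector is rescaled, only the shortest walks survive as \<open>d\<close> tends
  to \<open>0\<close>, and what remains is the form. Summability of the norms of the coefficients, which is convergence at
  the tuple of \<open>1 \<times> 1\<close> identities, controls the remainder.

  Contractions (\<open>word_orbit_contraction\<close>). For a Hermitian tuple \<open>Z\<close> the operator
  \<open>S = \<Sum>\<^sub>i T\<^sub>i \<otimes> Z\<^sub>i\<close> is symmetric, so the sequence \<open>\<parallel>S\<^sup>k u\<parallel>\<close> is logarithmically convex along
  powers of two; if the moments \<open>\<langle>S\<^sup>k u, u\<rangle>\<close> are bounded then \<open>\<parallel>S u\<parallel> \<le> \<parallel>u\<parallel>\<close>. The moments are sums of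
  terms \<open>\<langle>c (rev \<beta> @ w @ \<alpha>) v, v'\<rangle>\<close> weighted by entries of \<open>Z\<^sup>w\<close>, and the power series bounds them if \<open>Z\<^sup>w\<close> can
  be replaced by the power of \<open>Z\<close> along \<open>rev \<beta> @ w @ \<alpha>\<close>, which is possible when all \<open>Z\<^sub>i\<close> are invertible. An
  arbitrary tuple of the ball is a corner of a Hermitian invertible tuple of nearly the same norm
  (\<open>herm_dilation\<close>). All this takes place on words, before the operators \<open>T\<^sub>i\<close> exist; \<open>1 \<times> 1\<close>
  matrices then yield the bound by which \<open>T\<^sub>i\<close> extends from words to the Hilbert space. Since the ball is open, a
  contraction at all of its points is a strict contraction at each of them, and \<open>I - S\<close> is invertible.

  The formula (\<open>transfer_function\<close>). With the adjoint \<open>Q\<^sub>i\<^sup>*\<close> one has \<open>Q\<^sub>i\<^sup>* T\<^sup>w Q\<^sub>j = c (i # w @ [j])\<close>, so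
  the term of degree \<open>k\<close> of the Neumann series gives the part of \<open>f\<close> of degree \<open>k + 2\<close>; the
  words of length \<open>0\<close> and \<open>1\<close> give \<open>a\<^sub>0\<close> and \<open>L\<close>.
\<close>

section \<open>Hilbert spaces and their operators\<close>

lemma cinner_add_right: "cinner x (y + z) = cinner x y + cinner x (z::'a::complex_hilbert)"
  by (metis cinner_add_left cinner_commute complex_cnj_add)

lemma cinner_scaleC_right: "cinner x (scaleC a y) = cnj a * cinner x (y::'a::complex_hilbert)"
  by (metis cinner_commute cinner_scaleC_left complex_cnj_mult)

lemma cinner_zero_left [simp]: "cinner 0 x = 0" for x :: "'a::complex_hilbert"
  using cinner_add_left[of 0 0 x] by simp

lemma cinner_zero_right [simp]: "cinner x 0 = 0" for x :: "'a::complex_hilbert"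
  using cinner_add_right[of x 0 0] by simp

lemma cinner_sum_left: "cinner (sum f A) x = (\<Sum>i\<in>A. cinner (f i) (x::'a::complex_hilbert))"
  by (induction A rule: infinite_finite_induct) (auto simp: cinner_add_left)

lemma cinner_sum_right: "cinner x (sum f A) = (\<Sum>i\<in>A. cinner (x::'a::complex_hilbert) (f i))"
  by (induction A rule: infinite_finite_induct) (auto simp: cinner_add_right)

lemma scaleC_zero_left [simp]: "scaleC 0 x = 0" for x :: "'a::complex_hilbert"
  using scaleC_of_real[of 0 x] by simp

lemma scaleC_one [simp]: "scaleC 1 x = x" for x :: "'a::complex_hilbert"
  using scaleC_of_real[of 1 x] by simp

lemma scaleC_zero_right [simp]: "scaleC a 0 = (0 :: 'a::complex_hilbert)"
  using norm_scaleC[of a 0] by (metis mult_zero_right norm_eq_zero norm_zero)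

lemma scaleC_sum_left: "scaleC (sum f A) x = (\<Sum>i\<in>A. scaleC (f i) (x::'a::complex_hilbert))"
  by (induction A rule: infinite_finite_induct) (auto simp: scaleC_add_left)

lemma scaleC_sum_right: "scaleC a (sum f A) = (\<Sum>i\<in>A. scaleC a (f i :: 'a::complex_hilbert))"
  by (induction A rule: infinite_finite_induct) (auto simp: scaleC_add_right)

lemma scaleC_minus1: "scaleC (-1) x = - x" for x :: "'a::complex_hilbert"
  using scaleC_of_real[of "-1" x] by simp

lemma cinner_self: "cinner x x = complex_of_real ((norm x)\<^sup>2)" for x :: "'a::complex_hilbert"
proof -
  have "Im (cinner x x) = 0"
    using arg_cong[OF cinner_commute[of x x], of Im] by simp
  then show ?thesis
    by (simp add: complex_eq_iff Re_cinner power2_norm_eq_inner)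
qed

lemma cmod_cinner_le: "cmod (cinner x y) \<le> norm x * norm (y::'a::complex_hilbert)"
proof -
  define a where "a = (if cinner x y = 0 then 1 else cnj (cinner x y) / cmod (cinner x y))"
  have a: "cmod a = 1" by (auto simp: a_def norm_divide)
  have "a * cinner x y = complex_of_real (cmod (cinner x y))"
    by (simp add: a_def mult.commute[of "cnj _"] power2_eq_square flip: complex_norm_square)
  then have "cmod (cinner x y) = Re (cinner (scaleC a x) y)"
    by (simp add: cinner_scaleC_left)
  also have "\<dots> \<le> norm (scaleC a x) * norm y"
    by (simp add: Re_cinner norm_cauchy_schwarz)
  finally show ?thesis by (simp add: norm_scaleC a)
qed

lemma bounded_linear_cinner_left: "bounded_linear (\<lambda>x. cinner x (y::'a::complex_hilbert))"
proof (rule bounded_linear_intro[where K = "norm y"])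
  show "cinner (r *\<^sub>R x) y = r *\<^sub>R cinner x y" for r x
    by (simp add: scaleR_conv_of_real flip: scaleC_of_real)
       (simp add: cinner_scaleC_left)
qed (auto simp: cinner_add_left cmod_cinner_le)

lemma bounded_linear_cinner_right: "bounded_linear (\<lambda>y. cinner (x::'a::complex_hilbert) y)"
proof (rule bounded_linear_intro[where K = "norm x"])
  show "cinner x (r *\<^sub>R y) = r *\<^sub>R cinner x y" for r y
    by (simp add: scaleR_conv_of_real flip: scaleC_of_real)
       (simp add: cinner_scaleC_right)
next
  show "cmod (cinner x y) \<le> norm y * norm x" for y
    using cmod_cinner_le[of x y] by (simp add: mult.commute)
qed (auto simp: cinner_add_right)

lemma cinner_eqI:
  assumes "\<And>z. cinner x z = cinner y z"
  shows "x = (y::'a::complex_hilbert)"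
proof -
  have "cinner (x - y) (x - y) = 0"
    using linear_diff[OF bounded_linear.linear[OF bounded_linear_cinner_left[of "x - y"]]] assms
    by simp
  then show ?thesis by (simp add: cinner_self)
qed

lemma cinner_eqI_right:
  assumes "\<And>z. cinner z x = cinner z y"
  shows "x = (y::'a::complex_hilbert)"
  by (rule cinner_eqI) (metis assms cinner_commute)

lemma scaleC_op_apply [simp]: "blinfun_apply (scaleC_op a A) x = scaleC a (blinfun_apply A x)"
  by transfer simp

lemma norm_scaleC_op: "norm (scaleC_op a A) = cmod a * norm A"
proof (cases "a = 0")
  case True
  then show ?thesis
    using blinfun_eqI[of "scaleC_op a A" 0] by simp
next
  case False
  have le: "norm (scaleC_op b B) \<le> cmod b * norm B" for b and B :: "'a \<Rightarrow>\<^sub>L 'b"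
    by (rule norm_blinfun_bound)
      (auto simp: norm_scaleC norm_blinfun mult.assoc intro!: mult_left_mono)
  have "A = scaleC_op (inverse a) (scaleC_op a A)"
    using False by (intro blinfun_eqI) (simp add: scaleC_scaleC)
  then have "norm A \<le> cmod (inverse a) * norm (scaleC_op a A)"
    using le by metis
  then have "cmod a * norm A \<le> norm (scaleC_op a A)"
    using False by (simp add: norm_inverse norm_divide field_simps)
  with le[of a A] show ?thesis by linarith
qed

lemma scaleC_op_zero_left [simp]: "scaleC_op 0 A = 0"
  by (rule blinfun_eqI) simp

lemma scaleC_op_one [simp]: "scaleC_op 1 A = A"
  by (rule blinfun_eqI) simp

lemma clinear_opsD: "A \<in> clinear_ops \<Longrightarrow> blinfun_apply A (scaleC a x) = scaleC a (blinfun_apply A x)"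
  by (simp add: clinear_ops_def)

text \<open>Adjoints are only needed for operators whose adjoint is known explicitly, so that uniqueness
  is enough.\<close>

lemma adj_op_eqI:
  assumes "\<And>x y. cinner (blinfun_apply A x) y = cinner x (blinfun_apply B y)"
  shows "adj_op A = B"
  unfolding adj_op_def
proof (rule the_equality)
  show "\<forall>x y. cinner (blinfun_apply A x) y = cinner x (blinfun_apply B y)"
    using assms by blast
next
  fix C
  assume C: "\<forall>x y. cinner (blinfun_apply A x) y = cinner x (blinfun_apply C y)"
  show "C = B"
    by (rule blinfun_eqI, rule cinner_eqI_right) (metis C assms)
qed


section \<open>Norms of matrices\<close>

lemma L2_set_sq: "(L2_set f A)\<^sup>2 = (\<Sum>i\<in>A. (f i)\<^sup>2)"
  by (simp add: L2_set_def sum_nonneg)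

lemma norm_vec_index_le_one:
  fixes u :: "'a::real_normed_vector vec"
  assumes "vec_l2 u \<le> 1" "q < dim_vec u"
  shows "norm (u $ q) \<le> 1"
proof -
  have "norm (u $ q) \<le> vec_l2 u"
    unfolding vec_l2_def using assms(2) by (intro member_le_L2_set) auto
  with assms(1) show ?thesis by linarith
qed

text \<open>A vector supported in one coordinate detects one entry. The norm being a supremum of reals, the
  crude bound by the sum of all entries is needed first, to know that the supremum is one.\<close>

lemma norm_entry_le_op_mat_norm:
  fixes M :: "('a::real_normed_vector \<Rightarrow>\<^sub>L 'b::real_normed_vector) mat"
  assumes "M \<in> carrier_mat m n" "p < m" "q < n"
  shows "norm (M $$ (p, q)) \<le> op_mat_norm M"
proof -
  let ?S = "{vec_l2 (op_mat_apply M u) | u. u \<in> carrier_vec (dim_col M) \<and> vec_l2 u \<le> 1}"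
  have dims: "dim_row M = m" "dim_col M = n" using assms by auto
  have bdd: "bdd_above ?S"
  proof (rule bdd_aboveI)
    fix y assume "y \<in> ?S"
    then obtain u where u: "u \<in> carrier_vec n" "vec_l2 u \<le> 1" and y: "y = vec_l2 (op_mat_apply M u)"
      using dims by auto
    have "y \<le> (\<Sum>p<m. norm (op_mat_apply M u $ p))"
      unfolding y vec_l2_def by (rule order_trans[OF L2_set_le_sum]) (auto simp: op_mat_apply_def dims)
    also have "\<dots> \<le> (\<Sum>p<m. \<Sum>q<n. norm (M $$ (p, q)))"
    proof (intro sum_mono)
      fix p assume "p \<in> {..<m}"
      then have "norm (op_mat_apply M u $ p) \<le> (\<Sum>q<n. norm (blinfun_apply (M $$ (p, q)) (u $ q)))"
        by (simp add: op_mat_apply_def dims norm_sum)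
      also have "\<dots> \<le> (\<Sum>q<n. norm (M $$ (p, q)))"
      proof (intro sum_mono)
        fix q assume "q \<in> {..<n}"
        then have "norm (u $ q) \<le> 1"
          using u by (intro norm_vec_index_le_one) auto
        then show "norm (blinfun_apply (M $$ (p, q)) (u $ q)) \<le> norm (M $$ (p, q))"
          by (meson mult_left_le norm_blinfun norm_ge_zero order_trans)
      qed
      finally show "norm (op_mat_apply M u $ p) \<le> (\<Sum>q<n. norm (M $$ (p, q)))" .
    qed
    finally show "y \<le> (\<Sum>p<m. \<Sum>q<n. norm (M $$ (p, q)))" .
  qed
  have unit: "norm (blinfun_apply (M $$ (p, q)) x) \<le> op_mat_norm M" if "norm x \<le> 1" for x
  proof -
    define u where "u = vec n (\<lambda>r. if r = q then x else 0)"
    have "vec_l2 u = norm x"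
    proof -
      have "(\<Sum>r<n. (norm (u $ r))\<^sup>2) = (\<Sum>r<n. if r = q then (norm x)\<^sup>2 else 0)"
        by (intro sum.cong) (auto simp: u_def)
      then show ?thesis
        using assms(3) by (simp add: vec_l2_def L2_set_def u_def)
    qed
    then have mem: "vec_l2 (op_mat_apply M u) \<in> ?S"
      using that by (intro CollectI exI[of _ u]) (auto simp: u_def dims)
    have "op_mat_apply M u $ p = (\<Sum>r<n. blinfun_apply (M $$ (p, r)) (if r = q then x else 0))"
      using assms(2) by (simp add: op_mat_apply_def dims u_def)
    also have "\<dots> = (\<Sum>r<n. if r = q then blinfun_apply (M $$ (p, q)) x else 0)"
      by (intro sum.cong) auto
    also have "\<dots> = blinfun_apply (M $$ (p, q)) x"
      using assms(3) by simp
    finally have "norm (blinfun_apply (M $$ (p, q)) x) = norm (op_mat_apply M u $ p)"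
      by simp
    also have "\<dots> \<le> vec_l2 (op_mat_apply M u)"
      unfolding vec_l2_def using assms(2) by (intro member_le_L2_set) (auto simp: op_mat_apply_def dims)
    also have "\<dots> \<le> op_mat_norm M"
      unfolding op_mat_norm_def by (rule cSup_upper[OF mem bdd])
    finally show ?thesis .
  qed
  have nonneg: "0 \<le> op_mat_norm M"
    using unit[of 0] by simp
  show ?thesis
  proof (rule norm_blinfun_bound[OF nonneg])
    fix x
    show "norm (blinfun_apply (M $$ (p, q)) x) \<le> op_mat_norm M * norm x"
    proof (cases "x = 0")
      case False
      have "norm (blinfun_apply (M $$ (p, q)) (x /\<^sub>R norm x)) \<le> op_mat_norm M"
        using False by (intro unit) simp
      then show ?thesis
        using False by (simp add: blinfun.scaleR_right field_simps)
    qed simp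
  qed
qed

lemma vec_l2_mult_mat_vec_le_sum:
  fixes M :: "complex mat"
  assumes "M \<in> carrier_mat m n" "u \<in> carrier_vec n"
  shows "vec_l2 (M *\<^sub>v u) \<le> (\<Sum>p<m. \<Sum>q<n. cmod (M $$ (p, q))) * vec_l2 u"
proof -
  have "vec_l2 (M *\<^sub>v u) \<le> (\<Sum>p<m. cmod ((M *\<^sub>v u) $ p))"
    unfolding vec_l2_def using assms by (intro order_trans[OF L2_set_le_sum]) auto
  also have "\<dots> \<le> (\<Sum>p<m. \<Sum>q<n. cmod (M $$ (p, q)) * vec_l2 u)"
  proof (rule sum_mono)
    fix p assume p: "p \<in> {..<m}"
    have "(M *\<^sub>v u) $ p = (\<Sum>q<n. M $$ (p, q) * u $ q)"
      using assms p by (simp add: scalar_prod_def atLeast0LessThan)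
    also have "cmod \<dots> \<le> (\<Sum>q<n. cmod (M $$ (p, q)) * vec_l2 u)"
    proof (rule sum_norm_le)
      fix q assume "q \<in> {..<n}"
      then have "cmod (u $ q) \<le> vec_l2 u"
        unfolding vec_l2_def using assms by (intro member_le_L2_set) auto
      then show "cmod (M $$ (p, q) * u $ q) \<le> cmod (M $$ (p, q)) * vec_l2 u"
        by (simp add: norm_mult mult_left_mono)
    qed
    finally show "cmod ((M *\<^sub>v u) $ p) \<le> (\<Sum>q<n. cmod (M $$ (p, q)) * vec_l2 u)" .
  qed
  finally show ?thesis by (simp add: sum_distrib_right)
qed

lemma vec_l2_nonneg [simp]: "0 \<le> vec_l2 u"
  by (simp add: vec_l2_def)

lemma mat_norm_le:
  fixes M :: "complex mat"
  assumes "M \<in> carrier_mat m n" "0 \<le> K"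
    and "\<And>u. u \<in> carrier_vec n \<Longrightarrow> vec_l2 (M *\<^sub>v u) \<le> K * vec_l2 u"
  shows "mat_norm M \<le> K"
  unfolding mat_norm_def
proof (rule cSup_least)
  have "vec_l2 (0\<^sub>v n :: complex vec) \<le> 1"
    by (simp add: vec_l2_def L2_set_def)
  then show "{vec_l2 (M *\<^sub>v u) |u. u \<in> carrier_vec (dim_col M) \<and> vec_l2 u \<le> 1} \<noteq> {}"
    using assms(1) zero_carrier_vec[of n] by blast
next
  fix y assume "y \<in> {vec_l2 (M *\<^sub>v u) |u. u \<in> carrier_vec (dim_col M) \<and> vec_l2 u \<le> 1}"
  then obtain u where u: "u \<in> carrier_vec n" "vec_l2 u \<le> 1" "y = vec_l2 (M *\<^sub>v u)"
    using assms(1) by auto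
  show "y \<le> K"
    using assms(3)[OF u(1)] mult_left_mono[OF u(2) assms(2)] u(3) by simp
qed

lemma vec_l2_smult: "vec_l2 (a \<cdot>\<^sub>v u) = cmod a * vec_l2 (u :: complex vec)"
  by (simp add: vec_l2_def L2_set_right_distrib) (rule L2_set_cong, auto simp: norm_mult)

lemma vec_l2_le_mat_norm_unit:
  fixes M :: "complex mat"
  assumes "M \<in> carrier_mat m n" "u \<in> carrier_vec n" "vec_l2 u \<le> 1"
  shows "vec_l2 (M *\<^sub>v u) \<le> mat_norm M"
  unfolding mat_norm_def
proof (rule cSup_upper)
  show "vec_l2 (M *\<^sub>v u) \<in> {vec_l2 (M *\<^sub>v u) | u. u \<in> carrier_vec (dim_col M) \<and> vec_l2 u \<le> 1}"
    using assms by auto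
  show "bdd_above {vec_l2 (M *\<^sub>v u) | u. u \<in> carrier_vec (dim_col M) \<and> vec_l2 u \<le> 1}"
  proof (rule bdd_aboveI)
    fix y assume "y \<in> {vec_l2 (M *\<^sub>v u) | u. u \<in> carrier_vec (dim_col M) \<and> vec_l2 u \<le> 1}"
    then obtain u where u: "u \<in> carrier_vec n" "vec_l2 u \<le> 1" "y = vec_l2 (M *\<^sub>v u)"
      using assms(1) by auto
    have "y \<le> (\<Sum>p<m. \<Sum>q<n. cmod (M $$ (p, q))) * vec_l2 u"
      using vec_l2_mult_mat_vec_le_sum[OF assms(1) u(1)] u(3) by simp
    also have "\<dots> \<le> (\<Sum>p<m. \<Sum>q<n. cmod (M $$ (p, q))) * 1"
      by (intro mult_left_mono u sum_nonneg) auto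
    finally show "y \<le> (\<Sum>p<m. \<Sum>q<n. cmod (M $$ (p, q))) * 1" .
  qed
qed

lemma vec_l2_le_mat_norm:
  fixes M :: "complex mat"
  assumes "M \<in> carrier_mat m n" "u \<in> carrier_vec n"
  shows "vec_l2 (M *\<^sub>v u) \<le> mat_norm M * vec_l2 u"
proof (cases "vec_l2 u = 0")
  case True
  then show ?thesis
    using vec_l2_mult_mat_vec_le_sum[OF assms] by simp
next
  case False
  define a where "a = vec_l2 u"
  have a: "a > 0" using False vec_l2_nonneg[of u] by (simp add: a_def less_le)
  define w where "w = complex_of_real (1 / a) \<cdot>\<^sub>v u"
  have w: "w \<in> carrier_vec n" "vec_l2 w = 1"
    using assms(2) a by (auto simp: w_def vec_l2_smult norm_divide) (auto simp: a_def)
  have "M *\<^sub>v w = complex_of_real (1 / a) \<cdot>\<^sub>v (M *\<^sub>v u)"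
    unfolding w_def using assms by (simp add: mult_mat_vec)
  then have "vec_l2 (M *\<^sub>v w) = vec_l2 (M *\<^sub>v u) / a"
    using a by (simp add: vec_l2_smult norm_divide)
  moreover have "vec_l2 (M *\<^sub>v w) \<le> mat_norm M"
    using w by (intro vec_l2_le_mat_norm_unit[OF assms(1)]) auto
  ultimately show ?thesis
    using a mult_left_mono[of "vec_l2 (M *\<^sub>v w)" "mat_norm M" a]
    by (simp add: field_simps flip: a_def)
qed

lemma mat_norm_le_sum:
  fixes M :: "complex mat"
  assumes "M \<in> carrier_mat m n"
  shows "mat_norm M \<le> (\<Sum>p<m. \<Sum>q<n. cmod (M $$ (p, q)))"
  by (rule mat_norm_le[OF assms]) (auto simp: sum_nonneg intro: vec_l2_mult_mat_vec_le_sum[OF assms])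

lemma mat_norm_nonneg:
  fixes M :: "complex mat"
  assumes "M \<in> carrier_mat m n"
  shows "0 \<le> mat_norm M"
proof -
  have "vec_l2 (0\<^sub>v n :: complex Matrix.vec) \<le> 1"
    by (simp add: vec_l2_def L2_set_def)
  then have "vec_l2 (M *\<^sub>v 0\<^sub>v n) \<le> mat_norm M"
    by (intro vec_l2_le_mat_norm_unit[OF assms]) auto
  then show ?thesis
    using vec_l2_nonneg order_trans by blast
qed

lemma complex_nc_ball_iff:
  "Z \<in> complex_nc_ball n r \<longleftrightarrow> 0 < n \<and> (\<forall>i. Z i \<in> carrier_mat n n \<and> mat_norm (Z i) < r)"
  by (auto simp: complex_nc_ball_def tuple_norm_def)

lemma mat_adjoint_index:
  fixes M :: "complex mat"
  assumes "M \<in> carrier_mat m n"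
  shows "mat_adjoint M \<in> carrier_mat n m"
    and "p < n \<Longrightarrow> q < m \<Longrightarrow> mat_adjoint M $$ (p, q) = cnj (M $$ (q, p))"
  using assms by (auto simp: mat_adjoint_def mat_of_rows_index cols_def intro!: carrier_matI)

lemma mat_adjoint_eq_iff:
  fixes M :: "complex mat"
  assumes "M \<in> carrier_mat n n"
  shows "mat_adjoint M = M \<longleftrightarrow> (\<forall>p<n. \<forall>q<n. M $$ (p, q) = cnj (M $$ (q, p)))"
  using mat_adjoint_index[OF assms] assms
  by (metis (no_types, lifting) carrier_matD eq_matI)

lemma word_power_carrier [simp]:
  assumes "\<And>i. Z i \<in> carrier_mat n n"
  shows "word_power n Z w \<in> carrier_mat n n"
  using assms by (induction w) (auto simp: word_power_def intro!: mult_carrier_mat)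

lemma word_power_Nil [simp]: "word_power n Z [] = 1\<^sub>m n"
  and word_power_Cons: "word_power n Z (i # w) = Z i * word_power n Z w"
  by (simp_all add: word_power_def)

lemma word_power_append:
  assumes "\<And>i. Z i \<in> carrier_mat n n"
  shows "word_power n Z (v @ w) = word_power n Z v * word_power n Z w"
proof (induction v)
  case Nil
  show ?case using word_power_carrier[of Z n w, OF assms] by simp
next
  case (Cons i v)
  show ?case
    using Cons.IH
      assoc_mult_mat[OF assms[of i] word_power_carrier[of Z n v, OF assms]
        word_power_carrier[of Z n w, OF assms]]
    by (simp add: word_power_Cons)
qed

lemma index_mult_mat_sum:
  assumes "A \<in> carrier_mat m k" "B \<in> carrier_mat k n" "p < m" "q < n"
  shows "(A * B) $$ (p, q) = (\<Sum>r<k. A $$ (p, r) * B $$ (r, q))"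
  using assms by (simp add: scalar_prod_def atLeast0LessThan)


section \<open>Coefficients of the power series\<close>

text \<open>Entries are dominated by the operator matrix norm, so absolute and uniform convergence of
  series of operator matrices pass to the series of scalar multiples of the coefficients in each entry.\<close>

lemma entry_summable:
  assumes "nc_power_series_on r c f" "Z \<in> complex_nc_ball n r" "p < n" "q < n"
  shows "(\<lambda>w. cmod (word_power n Z w $$ (p, q)) * norm (c w)) summable_on UNIV"
proof -
  have Z: "\<And>i. Z i \<in> carrier_mat n n" using assms(2) by (simp add: complex_nc_ball_iff)
  note W = word_power_carrier[of Z n, OF Z]
  have "(\<lambda>w. op_mat_norm (op_tensor (c w) (word_power n Z w))) summable_on UNIV"
    using assms(1,2) unfolding nc_power_series_on_def by blast
  then show ?thesis
  proof (rule summable_on_comparison_test)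
    fix w
    have "op_tensor (c w) (word_power n Z w) \<in> carrier_mat n n"
      using W[of w] by (simp add: op_tensor_def)
    then have "norm (op_tensor (c w) (word_power n Z w) $$ (p, q))
        \<le> op_mat_norm (op_tensor (c w) (word_power n Z w))"
      using assms(3,4) by (rule norm_entry_le_op_mat_norm)
    then show "cmod (word_power n Z w $$ (p, q)) * norm (c w)
        \<le> op_mat_norm (op_tensor (c w) (word_power n Z w))"
      using W[of w] assms(3,4) by (simp add: op_tensor_def norm_scaleC_op)
  qed auto
qed

lemma entry_has_sum:
  assumes "nc_power_series_on r c f" "Z \<in> complex_nc_ball n r" "p < n" "q < n"
  shows "((\<lambda>w. scaleC_op (word_power n Z w $$ (p, q)) (c w)) has_sum f Z $$ (p, q)) UNIV"
  unfolding has_sum_def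
proof (rule tendstoI)
  fix e :: real assume "e > 0"
  then have "\<forall>\<^sub>F F in finite_subsets_at_top UNIV. \<forall>n. \<forall>Z\<in>complex_nc_ball n r.
        op_mat_norm (f Z - op_tensor_sum n F c (word_power n Z)) < e"
    using assms(1) unfolding nc_power_series_on_def by blast
  then show "\<forall>\<^sub>F F in finite_subsets_at_top UNIV.
      dist (\<Sum>w\<in>F. scaleC_op (word_power n Z w $$ (p, q)) (c w)) (f Z $$ (p, q)) < e"
  proof (rule eventually_mono)
    fix F
    assume F: "\<forall>n. \<forall>Z\<in>complex_nc_ball n r. op_mat_norm (f Z - op_tensor_sum n F c (word_power n Z)) < e"
    let ?M = "f Z - op_tensor_sum n F c (word_power n Z)"
    have "f Z \<in> carrier_mat n n"
      using assms(1,2) unfolding nc_power_series_on_def by blast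
    then have M: "?M \<in> carrier_mat n n"
      and Mpq: "?M $$ (p, q) = f Z $$ (p, q) - (\<Sum>w\<in>F. scaleC_op (word_power n Z w $$ (p, q)) (c w))"
      using assms(3,4) by (auto simp: op_tensor_sum_def)
    have "norm (?M $$ (p, q)) \<le> op_mat_norm ?M"
      by (rule norm_entry_le_op_mat_norm[OF M assms(3,4)])
    also have "\<dots> < e" using F assms(2) by blast
    finally show "dist (\<Sum>w\<in>F. scaleC_op (word_power n Z w $$ (p, q)) (c w)) (f Z $$ (p, q)) < e"
      by (simp add: Mpq dist_norm norm_minus_commute)
  qed
qed

text \<open>The tuple of \<open>1 \<times> 1\<close> identities lies in the ball, and all its powers are \<open>1\<close>.\<close>

lemma coefficients_summable:
  assumes "nc_power_series_on r c f" "1 < r"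
  shows "(\<lambda>w. norm (c w)) summable_on UNIV"
proof -
  define Z where "Z = (\<lambda>i :: 'a. 1\<^sub>m 1 :: complex mat)"
  have "mat_norm (1\<^sub>m 1 :: complex mat) \<le> 1"
    using mat_norm_le_sum[of "1\<^sub>m 1" 1 1] by simp
  then have Z: "Z \<in> complex_nc_ball 1 r"
    using assms(2) by (simp add: complex_nc_ball_iff Z_def)
  have "word_power 1 Z w = 1\<^sub>m 1" for w
    by (induction w) (simp_all add: word_power_Cons, simp add: Z_def)
  then show ?thesis
    using entry_summable[OF assms(1) Z, of 0 0] by simp
qed


section \<open>Walks on the tree of words\<close>

text \<open>The entry \<open>(s, t)\<close> of the product of the kernels \<open>g i\<close> along a word: a sum over the walks in
  \<open>W\<close> from \<open>s\<close> to \<open>t\<close> whose successive steps carry the letters of the word.\<close>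

fun walk_sum :: "'s set \<Rightarrow> ('i \<Rightarrow> 's \<Rightarrow> 's \<Rightarrow> complex) \<Rightarrow> 'i list \<Rightarrow> 's \<Rightarrow> 's \<Rightarrow> complex" where
  "walk_sum W g [] s t = (if s = t then 1 else 0)"
| "walk_sum W g (i # w) s t = (\<Sum>x\<in>W. g i s x * walk_sum W g w x t)"

lemma sum_nth_distinct:
  assumes "distinct xs"
  shows "(\<Sum>r<length xs. h (xs ! r)) = (\<Sum>x\<in>set xs. h x)"
  by (rule sum.reindex_bij_betw[OF bij_betw_nth]) (use assms in auto)

lemma word_power_eq_walk_sum:
  assumes "distinct ws" "n = length ws"
    and "\<And>i. Z i = mat n n (\<lambda>(p, q). g i (ws ! p) (ws ! q))"
    and "p < n" "q < n"
  shows "word_power n Z w $$ (p, q) = walk_sum (set ws) g w (ws ! p) (ws ! q)"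
  using assms(4)
proof (induction w arbitrary: p)
  case Nil
  then show ?case
    using assms by (auto simp: nth_eq_iff_index_eq)
next
  case (Cons i w)
  have Z: "\<And>i. Z i \<in> carrier_mat n n" by (simp add: assms(3))
  have "word_power n Z (i # w) $$ (p, q) = (\<Sum>r<n. Z i $$ (p, r) * word_power n Z w $$ (r, q))"
    unfolding word_power_Cons
    by (rule index_mult_mat_sum[OF Z word_power_carrier[of Z n, OF Z] Cons.prems assms(5)])
  also have "\<dots> = (\<Sum>r<length ws. g i (ws ! p) (ws ! r) * walk_sum (set ws) g w (ws ! r) (ws ! q))"
  proof (rule sum.cong)
    fix r assume "r \<in> {..<length ws}"
    then have r: "r < n" by (simp add: assms(2))
    show "Z i $$ (p, r) * word_power n Z w $$ (r, q)
        = g i (ws ! p) (ws ! r) * walk_sum (set ws) g w (ws ! r) (ws ! q)"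
      using r Cons.prems by (simp only: Cons.IH[OF r]) (simp add: assms(3))
  qed (simp add: assms(2))
  also have "\<dots> = walk_sum (set ws) g (i # w) (ws ! p) (ws ! q)"
    by (simp add: sum_nth_distinct[OF assms(1),
          of "\<lambda>x. g i (ws ! p) x * walk_sum (set ws) g w x (ws ! q)"])
  finally show ?case .
qed

lemma walk_sum_scale:
  "walk_sum W (\<lambda>i s t. a * g i s t) w s t = a ^ length w * walk_sum W g w s t"
  by (induction w arbitrary: s) (auto simp: sum_distrib_left algebra_simps)

lemma walk_sum_conjugate:
  assumes "\<And>s. sg s * sg s = (1::complex)"
  shows "walk_sum W (\<lambda>i s t. sg s * sg t * g i s t) w s t = sg s * sg t * walk_sum W g w s t"
proof (induction w arbitrary: s)
  case (Cons i w)
  have "sg s * sg x * g i s x * (sg x * sg t * y) = (sg x * sg x) * (sg s * sg t * (g i s x * y))" for x y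
    by (simp only: mult_ac)
  then show ?case
    by (simp only: walk_sum.simps Cons.IH assms sum_distrib_left mult_1)
qed (use assms in auto)

lemma cmod_walk_sum_le:
  assumes "\<And>i s t. cmod (g i s t) \<le> 1"
  shows "cmod (walk_sum W g w s t) \<le> real (card W) ^ length w"
proof (induction w arbitrary: s)
  case (Cons i w)
  have "cmod (walk_sum W g (i # w) s t) \<le> (\<Sum>x\<in>W. 1 * real (card W) ^ length w)"
    unfolding walk_sum.simps
    by (rule sum_norm_le, unfold norm_mult, intro mult_mono assms Cons.IH) auto
  then show ?case by simp
qed simp

text \<open>The infinite tree of words, rooted at the empty word, and the same tree without the edges at
  the root.\<close>

definition tree_edge :: "'i \<Rightarrow> 'i list \<Rightarrow> 'i list \<Rightarrow> complex" where
  "tree_edge i s t = (if t = s @ [i] \<or> s = t @ [i] then 1 else 0)"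

definition inner_edge :: "'i \<Rightarrow> 'i list \<Rightarrow> 'i list \<Rightarrow> complex" where
  "inner_edge i s t = (if s = [] \<or> t = [] then 0 else tree_edge i s t)"

lemma tree_edge_sum:
  assumes "finite W"
  shows "(\<Sum>x\<in>W. tree_edge i s x * h x) =
    (if s @ [i] \<in> W then h (s @ [i]) else 0) +
    (if s \<noteq> [] \<and> last s = i \<and> butlast s \<in> W then h (butlast s) else 0)"
proof -
  have "tree_edge i s x * h x =
      (if x = s @ [i] then h x else 0) +
      (if x = butlast s then if s \<noteq> [] \<and> last s = i then h x else 0 else 0)" for x
    by (cases s rule: rev_cases) (auto simp: tree_edge_def)
  then show ?thesis
    using assms by (auto simp: sum.distrib)
qed

text \<open>A step changes the length of a word by one, so a walk from \<open>s\<close> to \<open>t\<close> that is no longer than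
  \<open>length t - length s\<close> must add a letter at every step.\<close>

lemma walk_sum_descend:
  fixes t :: "'i::finite list"
  assumes "length t \<le> m" "length w + length s \<le> length t"
  shows "walk_sum {x. length x \<le> m} tree_edge w s t = (if s @ w = t then 1 else 0)"
  using assms(2)
proof (induction w arbitrary: s)
  case (Cons i w)
  have fin: "finite {x :: 'i list. length x \<le> m}"
    using finite_lists_length_le[of "UNIV :: 'i set" m] by simp
  have up: "walk_sum {x. length x \<le> m} tree_edge w (butlast s) t = 0" if "s \<noteq> []"
  proof -
    have "length (butlast s @ w) < length t"
      using that Cons.prems by (cases s rule: rev_cases) auto
    then have "butlast s @ w \<noteq> t" by blast
    then show ?thesis
      using Cons.IH[of "butlast s"] Cons.prems by (simp add: diff_le_self)
  qed
  show ?case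
    using Cons.prems assms(1) Cons.IH[of "s @ [i]"] up
    by (auto simp: tree_edge_sum[OF fin])
qed simp

lemma walk_sum_inner_root:
  assumes "t \<noteq> []"
  shows "walk_sum W inner_edge w [] t = 0"
  using assms by (cases w) (auto simp: inner_edge_def)

text \<open>A walk from \<open>s\<close> to \<open>t\<close> that passes through the root has length at least
  \<open>length s + length t\<close>, and there is exactly one of that length: it removes the letters of \<open>s\<close>
  and then adds those of \<open>t\<close>, so it reads the word \<open>rev s @ t\<close>.\<close>

lemma walk_sum_through_root:
  fixes t :: "'i::finite list"
  assumes "t \<noteq> []" "length t \<le> m" "length s \<le> m" "length w \<le> length s + length t"
  shows "walk_sum {x. length x \<le> m} tree_edge w s t - walk_sum {x. length x \<le> m} inner_edge w s t
    = (if w = rev s @ t then 1 else 0)"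
  using assms(3,4)
proof (induction w arbitrary: s)
  case Nil
  then show ?case using assms(1) by auto
next
  case (Cons i w)
  let ?W = "{x :: 'i list. length x \<le> m}"
  let ?D = "\<lambda>x. walk_sum ?W tree_edge w x t - walk_sum ?W inner_edge w x t"
  have fin: "finite ?W"
    using finite_lists_length_le[of "UNIV :: 'i set" m] by simp
  show ?case
  proof (cases "s = []")
    case True
    then show ?thesis
      using walk_sum_descend[OF assms(2), of "i # w" "[]"] walk_sum_inner_root[OF assms(1), of ?W "i # w"] Cons.prems
      by (simp del: walk_sum.simps)
  next
    case False
    have "walk_sum ?W tree_edge (i # w) s t - walk_sum ?W inner_edge (i # w) s t
        = (\<Sum>x\<in>?W. tree_edge i s x * walk_sum ?W tree_edge w x t - inner_edge i s x * walk_sum ?W inner_edge w x t)"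
      by (simp add: sum_subtractf)
    also have "\<dots> = (\<Sum>x\<in>?W. tree_edge i s x * ?D x)"
    proof (rule sum.cong[OF refl])
      fix x
      show "tree_edge i s x * walk_sum ?W tree_edge w x t - inner_edge i s x * walk_sum ?W inner_edge w x t
          = tree_edge i s x * ?D x"
        using False walk_sum_inner_root[OF assms(1), of ?W w]
        by (cases "x = []") (simp_all add: inner_edge_def algebra_simps)
    qed
    also have "\<dots> = (if s @ [i] \<in> ?W then ?D (s @ [i]) else 0) + (if last s = i then ?D (butlast s) else 0)"
      using False Cons.prems by (simp add: tree_edge_sum[OF fin] diff_le_self le_diff_conv)
    also have "(if s @ [i] \<in> ?W then ?D (s @ [i]) else 0) = 0"
    proof -
      have "length w < length (rev (s @ [i]) @ t)" using Cons.prems by simp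
      then have "w \<noteq> rev (s @ [i]) @ t" by blast
      then show ?thesis
        using Cons.IH[of "s @ [i]"] Cons.prems by simp
    qed
    also have "(if last s = i then ?D (butlast s) else 0) = (if i # w = rev s @ t then 1 else 0)"
      using Cons.IH[of "butlast s"] Cons.prems False by (cases s rule: rev_cases) auto
    finally show ?thesis by simp
  qed
qed


section \<open>Positivity of the form on words\<close>

lemma word_form_superset:
  assumes "finite F" "finite G" "Poly_Mapping.keys p \<subseteq> F" "Poly_Mapping.keys q \<subseteq> G"
  shows "word_form c p q = (\<Sum>\<alpha>\<in>F. \<Sum>\<beta>\<in>G.
    cinner (blinfun_apply (c (rev \<beta> @ \<alpha>)) (Poly_Mapping.lookup p \<alpha>)) (Poly_Mapping.lookup q \<beta>))"
proof -
  have "word_form c p q = (\<Sum>\<alpha>\<in>Poly_Mapping.keys p. \<Sum>\<beta>\<in>G.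
    cinner (blinfun_apply (c (rev \<beta> @ \<alpha>)) (Poly_Mapping.lookup p \<alpha>)) (Poly_Mapping.lookup q \<beta>))"
    unfolding word_form_def
    by (intro sum.cong refl sum.mono_neutral_left assms) (auto simp: in_keys_iff)
  also have "\<dots> = (\<Sum>\<alpha>\<in>F. \<Sum>\<beta>\<in>G.
    cinner (blinfun_apply (c (rev \<beta> @ \<alpha>)) (Poly_Mapping.lookup p \<alpha>)) (Poly_Mapping.lookup q \<beta>))"
    by (intro sum.mono_neutral_left assms) (auto simp: in_keys_iff blinfun.zero_right)
  finally show ?thesis .
qed

lemma real_ball_of_small_kernel:
  fixes g :: "'d::finite \<Rightarrow> nat \<Rightarrow> nat \<Rightarrow> complex"
  assumes "0 < n" "\<And>i p q. g i p q = cnj (g i q p)" "\<And>i p q. cmod (g i p q) \<le> d"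
    and "real n * real n * d < r"
  shows "(\<lambda>i. mat n n (\<lambda>(p, q). g i p q)) \<in> real_nc_ball n r"
proof -
  have "mat_norm (mat n n (\<lambda>(p, q). g i p q)) < r" for i
  proof -
    have "mat_norm (mat n n (\<lambda>(p, q). g i p q)) \<le> (\<Sum>p<n. \<Sum>q<n. cmod (g i p q))"
      using mat_norm_le_sum[of "mat n n (\<lambda>(p, q). g i p q)" n n] by simp
    also have "\<dots> \<le> (\<Sum>p<n. \<Sum>q<n. d)"
      by (intro sum_mono assms)
    finally show ?thesis using assms(4) by simp
  qed
  moreover have "mat_adjoint (mat n n (\<lambda>(p, q). g i p q)) = mat n n (\<lambda>(p, q). g i p q)" for i
    by (subst mat_adjoint_eq_iff[of _ n]) (auto intro: assms(2))
  ultimately show ?thesis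
    using assms(1) by (simp add: real_nc_ball_def complex_nc_ball_iff)
qed

lemma has_sum_subtract:
  fixes g :: "'i \<Rightarrow> 'v::real_normed_vector"
  assumes "(g has_sum a) S" "(h has_sum b) S"
  shows "((\<lambda>x. g x - h x) has_sum (a - b)) S"
  using has_sum_add[OF assms(1) has_sum_bounded_linear[OF bounded_linear_minus[OF bounded_linear_ident] assms(2)]]
  by simp

lemma entry_form_has_sum:
  assumes "nc_power_series_on r c f" "Z \<in> complex_nc_ball n r" "p < n" "q < n"
  shows "((\<lambda>w. word_power n Z w $$ (p, q) * cinner (blinfun_apply (c w) x) y)
    has_sum cinner (blinfun_apply (f Z $$ (p, q)) x) y) UNIV"
proof -
  have "bounded_linear (\<lambda>M. cinner (blinfun_apply M x) y)"
    by (intro bounded_linear_compose[OF bounded_linear_cinner_left] blinfun.bounded_linear_left)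
  from has_sum_bounded_linear[OF this entry_has_sum[OF assms]] show ?thesis
    by (simp add: cinner_scaleC_left)
qed

text \<open>Every word longer than \<open>l\<close> carries at least one factor \<open>N * d\<close> more than the leading word
  \<open>w0\<close>, so all of them together contribute \<open>O(d)\<close>. Here \<open>N\<close> will be the number of vertices of the
  tree, which bounds the growth of the number of walks.\<close>

lemma has_sum_leading_term:
  fixes h :: "'d list \<Rightarrow> complex"
  assumes "((\<lambda>w. h w) has_sum s) UNIV"
    and "\<And>w. length w \<le> l \<Longrightarrow> h w = (if w = w0 then t else 0)" "length w0 = l"
    and "\<And>w. l < length w \<Longrightarrow> cmod (h w) \<le> K * (N * d) ^ (length w - l) * b w"
    and "b summable_on UNIV" "\<And>w. 0 \<le> b w" "0 \<le> K" "0 \<le> N" "0 \<le> d" "N * d \<le> 1"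
  shows "cmod (s - t) \<le> K * N * infsum b UNIV * d"
proof -
  have "((\<lambda>w. if w = w0 then t else 0) has_sum t) {w0}"
    using has_sum_finite[of "{w0}" "\<lambda>w. if w = w0 then t else 0"] by simp
  then have "((\<lambda>w. if w = w0 then t else 0) has_sum t) UNIV"
    by (rule has_sum_cong_neutral[THEN iffD1, rotated -1]) auto
  then have diff: "((\<lambda>w. h w - (if w = w0 then t else 0)) has_sum (s - t)) UNIV"
    by (intro has_sum_subtract assms(1))
  have "((\<lambda>w. K * N * d * b w) has_sum (K * N * d * infsum b UNIV)) UNIV"
    by (intro has_sum_cmult_right has_sum_infsum assms)
  then have "cmod (s - t) \<le> K * N * d * infsum b UNIV"
  proof (rule norm_infsum_le[OF diff])
    fix w
    show "cmod (h w - (if w = w0 then t else 0)) \<le> K * N * d * b w"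
    proof (cases "length w \<le> l")
      case True
      then show ?thesis using assms by simp
    next
      case False
      then have "w \<noteq> w0" using assms(3) by auto
      have "(N * d) ^ (length w - l) \<le> (N * d) ^ 1"
        using False assms by (intro power_decreasing) auto
      then have "K * (N * d) ^ (length w - l) * b w \<le> K * (N * d) ^ 1 * b w"
        using assms by (intro mult_right_mono mult_left_mono) auto
      then show ?thesis
        using False \<open>w \<noteq> w0\<close> assms(4)[of w] by (simp add: mult.assoc)
    qed
  qed
  then show ?thesis by (simp add: mult_ac)
qed

text \<open>The form is the leading coefficient, for small \<open>d\<close>, of a convexity defect. Let the letters act
  on the tree of words of length at most \<open>m\<close> as \<open>d\<close> times the adjacency matrices of their edges
  (the tuple \<open>A\<close>), and let \<open>B\<close> arise from \<open>A\<close> by changing the sign of the edges at the root, so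
  that the midpoint \<open>X\<close> has no edges at the root. Away from the root \<open>A\<close> and \<open>B\<close> have the same
  powers, since they are conjugate by a change of sign at the root. Hence
  \<open>(f A + f B) / 2 - f X\<close> counts the walks through the root. The test vector with entries
  \<open>v \<alpha> / d ^ length \<alpha>\<close> compensates exactly the weight of the shortest of these walks, and these read
  the words \<open>rev \<beta> @ \<alpha>\<close>.\<close>

lemma word_form_nonneg:
  fixes c :: "'d::finite list \<Rightarrow> ('k::complex_hilbert \<Rightarrow>\<^sub>L 'k)"
  assumes ser: "nc_power_series_on r c f" and r: "1 < r" and conv: "matrix_convex_on r f"
    and p: "p \<in> word_span"
  shows "word_form c p p \<in> \<real>\<^sub>\<ge>\<^sub>0"
proof -
  define v where "v = Poly_Mapping.lookup p"
  have v_Nil: "v [] = 0"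
    using p by (auto simp: v_def word_span_def in_keys_iff)
  define m where "m = Max (insert 0 (length ` Poly_Mapping.keys p))"
  let ?W = "{x :: 'd list. length x \<le> m}"
  have fin: "finite ?W"
    using finite_lists_length_le[of "UNIV :: 'd set" m] by simp
  have keys: "Poly_Mapping.keys p \<subseteq> ?W"
    by (auto simp: m_def intro!: Max_ge)
  obtain ws where ws: "set ws = ?W" "distinct ws"
    using finite_distinct_list[OF fin] by blast
  define n where "n = length ws"
  have n_card: "n = card ?W"
    using distinct_card[OF ws(2)] by (simp add: n_def ws(1))
  have "[] \<in> set ws" by (simp add: ws(1))
  then have n: "0 < n" by (auto simp: n_def)
  have mem: "ws ! k \<in> ?W" if "k < n" for k
    using that ws(1) nth_mem unfolding n_def by blast
  \<comment> \<open>The diagonal sign matrix that conjugates \<open>A\<close> into \<open>B\<close>.\<close>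
  define sg where "sg = (\<lambda>s :: 'd list. if s = [] then -1 else 1 :: complex)"
  define A where "A = (\<lambda>d i. mat n n (\<lambda>(p, q). complex_of_real d * tree_edge i (ws ! p) (ws ! q)))"
  define B where "B = (\<lambda>d i. mat n n (\<lambda>(p, q). sg (ws ! p) * sg (ws ! q) *
      (complex_of_real d * tree_edge i (ws ! p) (ws ! q))))"
  define X where "X = (\<lambda>d i. mat n n (\<lambda>(p, q). complex_of_real d * inner_edge i (ws ! p) (ws ! q)))"
  define y where "y = (\<lambda>d q. (1 / d ^ length (ws ! q)) *\<^sub>R v (ws ! q))"
  define D where "D = (\<lambda>d. map_mat ((*\<^sub>R) (1/2)) (f (A d) + f (B d)) - f (X d))"
  define h where "h = (\<lambda>d p q. cinner (blinfun_apply (D d $$ (p, q)) (y d q)) (y d p))"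
  define t where "t = (\<lambda>p q. cinner (blinfun_apply (c (rev (ws ! p) @ ws ! q)) (v (ws ! q))) (v (ws ! p)))"
  define C where "C = (\<lambda>p q. 2 * real n ^ (length (ws ! p) + length (ws ! q)) *
      norm (v (ws ! q)) * norm (v (ws ! p)) * real n * infsum (\<lambda>w. norm (c w)) UNIV)"
  note summ = coefficients_summable[OF ser r]
  have C: "0 \<le> C p q" for p q
    unfolding C_def by (intro mult_nonneg_nonneg infsum_nonneg) auto

  have balls: "A d \<in> real_nc_ball n r" "B d \<in> real_nc_ball n r" "X d \<in> real_nc_ball n r"
    if d: "0 < d" "real n * real n * d < 1" for d
    unfolding A_def B_def X_def
    by (rule real_ball_of_small_kernel[where d = d and r = r, OF n];
        use d r in \<open>auto simp: tree_edge_def inner_edge_def sg_def\<close>)+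
  have carr: "f Z \<in> carrier_mat n n" if "Z \<in> real_nc_ball n r" for Z
    using that ser unfolding nc_power_series_on_def real_nc_ball_def by blast

  have close: "cmod (h d p q - t p q) \<le> C p q * d"
    if d: "0 < d" "real n * real n * d < 1" and pq: "p < n" "q < n" for d p q
  proof (cases "ws ! p = [] \<or> ws ! q = []")
    case True
    then have "h d p q - t p q = 0"
      using v_Nil by (auto simp: h_def t_def y_def blinfun.zero_right)
    then show ?thesis
      using C[of p q] d by simp
  next
    case False
    define l where "l = length (ws ! p) + length (ws ! q)"
    let ?a = "v (ws ! q)" and ?b = "v (ws ! p)"
    define Tr where "Tr = (\<lambda>w. walk_sum ?W tree_edge w (ws ! p) (ws ! q))"
    define In where "In = (\<lambda>w. walk_sum ?W inner_edge w (ws ! p) (ws ! q))"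
    let ?h = "\<lambda>w. complex_of_real (d ^ length w / (d ^ length (ws ! p) * d ^ length (ws ! q))) *
        (Tr w - In w) * cinner (blinfun_apply (c w) ?a) ?b"
    have nd: "real n * d \<le> 1"
    proof -
      have "1 * (real n * d) \<le> real n * (real n * d)"
        using n d by (intro mult_right_mono) auto
      then show ?thesis using d by simp
    qed
    have pow:
      "word_power n (A d) w $$ (p, q) = complex_of_real d ^ length w * Tr w"
      "word_power n (B d) w $$ (p, q) = complex_of_real d ^ length w * Tr w"
      "word_power n (X d) w $$ (p, q) = complex_of_real d ^ length w * In w" for w
    proof -
      have "word_power n (A d) w $$ (p, q) = walk_sum (set ws) (\<lambda>i s t. d * tree_edge i s t) w (ws ! p) (ws ! q)"
        by (rule word_power_eq_walk_sum) (use ws pq in \<open>auto simp: A_def n_def\<close>)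
      then show "word_power n (A d) w $$ (p, q) = complex_of_real d ^ length w * Tr w"
        by (simp add: walk_sum_scale ws(1) Tr_def)
      have "word_power n (X d) w $$ (p, q) = walk_sum (set ws) (\<lambda>i s t. d * inner_edge i s t) w (ws ! p) (ws ! q)"
        by (rule word_power_eq_walk_sum) (use ws pq in \<open>auto simp: X_def n_def\<close>)
      then show "word_power n (X d) w $$ (p, q) = complex_of_real d ^ length w * In w"
        by (simp add: walk_sum_scale ws(1) In_def)
      have "word_power n (B d) w $$ (p, q)
          = walk_sum (set ws) (\<lambda>i s t. sg s * sg t * (d * tree_edge i s t)) w (ws ! p) (ws ! q)"
        by (rule word_power_eq_walk_sum) (use ws pq in \<open>auto simp: B_def n_def\<close>)
      also have "\<dots> = sg (ws ! p) * sg (ws ! q) * walk_sum (set ws) (\<lambda>i s t. d * tree_edge i s t) w (ws ! p) (ws ! q)"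
        by (rule walk_sum_conjugate) (simp add: sg_def)
      finally show "word_power n (B d) w $$ (p, q) = complex_of_real d ^ length w * Tr w"
        using False by (simp add: walk_sum_scale ws(1) Tr_def sg_def)
    qed
    have hs: "((\<lambda>w. word_power n Z w $$ (p, q) * cinner (blinfun_apply (c w) (y d q)) (y d p))
        has_sum cinner (blinfun_apply (f Z $$ (p, q)) (y d q)) (y d p)) UNIV"
      if "Z \<in> real_nc_ball n r" for Z
      using that pq by (intro entry_form_has_sum[OF ser]) (auto simp: real_nc_ball_def)
    let ?m = "\<lambda>Z. cinner (blinfun_apply (f Z $$ (p, q)) (y d q)) (y d p)"
    have "h d p q = 1/2 * (?m (A d) + ?m (B d)) - ?m (X d)"
    proof -
      have "D d $$ (p, q) = (1/2) *\<^sub>R (f (A d) $$ (p, q) + f (B d) $$ (p, q)) - f (X d) $$ (p, q)"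
        using carr[OF balls(1)[OF d]] carr[OF balls(2)[OF d]] carr[OF balls(3)[OF d]] pq
        by (simp add: D_def)
      then show ?thesis
        unfolding h_def
        by (simp add: blinfun.add_left blinfun.diff_left blinfun.scaleR_left
            linear_diff[OF bounded_linear.linear[OF bounded_linear_cinner_left]]
            linear_scale[OF bounded_linear.linear[OF bounded_linear_cinner_left]]
            cinner_add_left scaleR_conv_of_real del: scaleR_add_right)
    qed
    moreover have "((\<lambda>w. 1/2 * (word_power n (A d) w $$ (p, q) * cinner (blinfun_apply (c w) (y d q)) (y d p)
          + word_power n (B d) w $$ (p, q) * cinner (blinfun_apply (c w) (y d q)) (y d p))
          - word_power n (X d) w $$ (p, q) * cinner (blinfun_apply (c w) (y d q)) (y d p))
        has_sum (1/2 * (?m (A d) + ?m (B d)) - ?m (X d))) UNIV"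
      by (intro has_sum_subtract has_sum_cmult_right has_sum_add hs balls[OF d])
    moreover have "1/2 * (word_power n (A d) w $$ (p, q) * cinner (blinfun_apply (c w) (y d q)) (y d p)
          + word_power n (B d) w $$ (p, q) * cinner (blinfun_apply (c w) (y d q)) (y d p))
          - word_power n (X d) w $$ (p, q) * cinner (blinfun_apply (c w) (y d q)) (y d p) = ?h w" for w
    proof -
      have "cinner (blinfun_apply (c w) (y d q)) (y d p)
          = complex_of_real (1 / (d ^ length (ws ! p) * d ^ length (ws ! q))) * cinner (blinfun_apply (c w) ?a) ?b"
        unfolding y_def
        by (simp only: blinfun.scaleR_right linear_scale[OF bounded_linear.linear[OF bounded_linear_cinner_left]]
            linear_scale[OF bounded_linear.linear[OF bounded_linear_cinner_right]])
          (simp add: scaleR_conv_of_real)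
      then show ?thesis
        by (simp add: pow algebra_simps add_divide_distrib[symmetric])
    qed
    ultimately have sum: "(?h has_sum h d p q) UNIV"
      by simp
    have "cmod (h d p q - t p q)
        \<le> (2 * real n ^ l * norm ?a * norm ?b) * real n * infsum (\<lambda>w. norm (c w)) UNIV * d"
    proof (rule has_sum_leading_term[OF sum, where l = l and ?w0.0 = "rev (ws ! p) @ ws ! q"])
      fix w :: "'d list" assume w: "length w \<le> l"
      have "Tr w - In w = (if w = rev (ws ! p) @ ws ! q then 1 else 0)"
        unfolding Tr_def In_def
        by (rule walk_sum_through_root) (use False mem pq w in \<open>auto simp: l_def\<close>)
      then show "?h w = (if w = rev (ws ! p) @ ws ! q then t p q else 0)"
        using d by (simp add: t_def power_add)
    next
      fix w :: "'d list" assume w: "l < length w"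
      have "cmod (Tr w) \<le> real n ^ length w" "cmod (In w) \<le> real n ^ length w"
        unfolding Tr_def In_def n_card
        by (rule cmod_walk_sum_le, simp add: tree_edge_def inner_edge_def)+
      then have TI: "cmod (Tr w - In w) \<le> 2 * real n ^ length w"
        using norm_triangle_ineq4[of "Tr w" "In w"] by linarith
      have "cmod (cinner (blinfun_apply (c w) ?a) ?b) \<le> norm (blinfun_apply (c w) ?a) * norm ?b"
        by (rule cmod_cinner_le)
      also have "\<dots> \<le> (norm (c w) * norm ?a) * norm ?b"
        by (intro mult_right_mono norm_blinfun) auto
      finally have ci: "cmod (cinner (blinfun_apply (c w) ?a) ?b) \<le> norm (c w) * norm ?a * norm ?b" .
      have dl: "d ^ length w / (d ^ length (ws ! p) * d ^ length (ws ! q)) = d ^ (length w - l)"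
        using w d by (simp add: l_def power_diff power_add)
      have nl: "real n ^ length w = real n ^ l * real n ^ (length w - l)"
        using w by (simp flip: power_add)
      have "cmod (?h w) = d ^ (length w - l) * cmod (Tr w - In w) * cmod (cinner (blinfun_apply (c w) ?a) ?b)"
        using d by (simp only: dl norm_mult norm_of_real) simp
      also have "\<dots> \<le> d ^ (length w - l) * (2 * real n ^ length w) * (norm (c w) * norm ?a * norm ?b)"
        using d by (intro mult_mono TI ci mult_left_mono) auto
      also have "\<dots> = 2 * real n ^ l * norm ?a * norm ?b * (real n * d) ^ (length w - l) * norm (c w)"
        by (simp only: nl power_mult_distrib mult_ac)
      finally show "cmod (?h w) \<le> 2 * real n ^ l * norm ?a * norm ?b * (real n * d) ^ (length w - l) * norm (c w)" .
    qed (use summ nd d in \<open>auto simp: l_def\<close>)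
    then show ?thesis by (simp add: C_def l_def)
  qed

  have pos: "(\<Sum>p<n. \<Sum>q<n. h d p q) \<in> \<real>\<^sub>\<ge>\<^sub>0"
    if d: "0 < d" "real n * real n * d < 1" for d
  proof -
    have mid: "(\<lambda>i. (1/2) \<cdot>\<^sub>m (A d i + B d i)) = X d"
      by (rule ext, rule eq_matI)
        (auto simp: A_def B_def X_def sg_def inner_edge_def tree_edge_def)
    have "op_mat_le (f (X d)) (map_mat ((*\<^sub>R) (1/2)) (f (A d) + f (B d)))"
      using conv balls(1)[OF d] balls(2)[OF d] unfolding matrix_convex_on_def mid[symmetric] by blast
    moreover have dimD: "D d \<in> carrier_mat n n"
      using carr[OF balls(1)[OF d]] carr[OF balls(2)[OF d]] carr[OF balls(3)[OF d]]
      by (auto simp: D_def intro!: carrier_matI)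
    moreover have "dim_col (map_mat ((*\<^sub>R) (1/2)) (f (A d) + f (B d))) = n"
      using carr[OF balls(2)[OF d]] by simp
    ultimately have "vec_cinner (op_mat_apply (D d) (vec n (y d))) (vec n (y d)) \<in> \<real>\<^sub>\<ge>\<^sub>0"
      unfolding op_mat_le_def D_def by (metis vec_carrier)
    also have "vec_cinner (op_mat_apply (D d) (vec n (y d))) (vec n (y d)) = (\<Sum>p<n. \<Sum>q<n. h d p q)"
      using dimD by (simp add: vec_cinner_def op_mat_apply_def h_def cinner_sum_left)
    finally show ?thesis .
  qed

  have small: "\<forall>\<^sub>F d in at_right 0. 0 < d \<and> real n * real n * d < 1"
    unfolding eventually_at_right_field using n
    by (intro exI[of _ "1 / (real n * real n)"]) (auto simp: field_simps)
  have "((\<lambda>d. \<Sum>p<n. \<Sum>q<n. h d p q) \<longlongrightarrow> (\<Sum>p<n. \<Sum>q<n. t p q)) (at_right 0)"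
  proof (intro tendsto_sum)
    fix p q assume pq: "p \<in> {..<n}" "q \<in> {..<n}"
    have "((\<lambda>d. C p q * d) \<longlongrightarrow> C p q * 0) (at_right 0)"
      by (intro tendsto_intros)
    then have lim: "((\<lambda>d. C p q * d) \<longlongrightarrow> 0) (at_right 0)"
      by simp
    have "((\<lambda>d. h d p q - t p q) \<longlongrightarrow> 0) (at_right 0)"
      by (rule Lim_null_comparison[OF eventually_mono[OF small] lim]) (use close pq in auto)
    then show "((\<lambda>d. h d p q) \<longlongrightarrow> t p q) (at_right 0)"
      by (rule LIM_zero_cancel)
  qed
  moreover have "\<forall>\<^sub>F d in at_right 0. (\<Sum>p<n. \<Sum>q<n. h d p q) \<in> \<real>\<^sub>\<ge>\<^sub>0"
    by (rule eventually_mono[OF small]) (use pos in auto)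
  ultimately have "(\<Sum>p<n. \<Sum>q<n. t p q) \<in> \<real>\<^sub>\<ge>\<^sub>0"
    using Lim_in_closed_set[OF closed_nonneg_Reals_complex] by (metis trivial_limit_at_right_real)
  also have "(\<Sum>p<n. \<Sum>q<n. t p q) = (\<Sum>q<n. \<Sum>p<n. t p q)"
    by (rule sum.swap)
  also have "\<dots> = (\<Sum>\<alpha>\<in>?W. \<Sum>\<beta>\<in>?W. cinner (blinfun_apply (c (rev \<beta> @ \<alpha>)) (v \<alpha>)) (v \<beta>))"
    unfolding t_def n_def
    by (simp add: sum_nth_distinct[OF ws(2), of "\<lambda>\<beta>. cinner (blinfun_apply (c (rev \<beta> @ _)) (v _)) (v \<beta>)"]
        sum_nth_distinct[OF ws(2), of "\<lambda>\<alpha>. \<Sum>\<beta>\<in>set ws. cinner (blinfun_apply (c (rev \<beta> @ \<alpha>)) (v \<alpha>)) (v \<beta>)"] ws(1)[symmetric])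
  also have "\<dots> = word_form c p p"
    unfolding v_def by (rule word_form_superset[OF fin fin keys keys, symmetric])
  finally show ?thesis .
qed

lemma word_form_add:
  "word_form c (p + p') q = word_form c p q + word_form c p' q"
  "word_form c q (p + p') = word_form c q p + word_form c q p'"
proof -
  let ?F = "Poly_Mapping.keys p \<union> Poly_Mapping.keys p' \<union> Poly_Mapping.keys q"
  have F: "finite ?F" by simp
  have keys: "Poly_Mapping.keys (p + p') \<subseteq> ?F" "Poly_Mapping.keys p \<subseteq> ?F"
    "Poly_Mapping.keys p' \<subseteq> ?F" "Poly_Mapping.keys q \<subseteq> ?F"
    using keys_add[of p p'] by auto
  show "word_form c (p + p') q = word_form c p q + word_form c p' q"
    unfolding word_form_superset[OF F F keys(1) keys(4)] word_form_superset[OF F F keys(2) keys(4)]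
      word_form_superset[OF F F keys(3) keys(4)]
    by (simp add: lookup_add blinfun.add_right cinner_add_left sum.distrib)
  show "word_form c q (p + p') = word_form c q p + word_form c q p'"
    unfolding word_form_superset[OF F F keys(4) keys(1)] word_form_superset[OF F F keys(4) keys(2)]
      word_form_superset[OF F F keys(4) keys(3)]
    by (simp add: lookup_add cinner_add_right sum.distrib)
qed

lemma word_form_scaleC:
  assumes "range c \<subseteq> clinear_ops"
  shows "word_form c (Poly_Mapping.map (scaleC a) p) q = a * word_form c p q"
    and "word_form c q (Poly_Mapping.map (scaleC a) p) = cnj a * word_form c q p"
proof -
  have keys: "Poly_Mapping.keys (Poly_Mapping.map (scaleC a) p) \<subseteq> Poly_Mapping.keys p"
    by (auto simp: in_keys_iff map.rep_eq when_def)
  have lk: "Poly_Mapping.lookup (Poly_Mapping.map (scaleC a) p) \<alpha> = scaleC a (Poly_Mapping.lookup p \<alpha>)" for \<alpha>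
    by (simp add: map.rep_eq when_def)
  have c: "blinfun_apply (c w) (scaleC a x) = scaleC a (blinfun_apply (c w) x)" for w x
    using assms by (intro clinear_opsD) auto
  show "word_form c (Poly_Mapping.map (scaleC a) p) q = a * word_form c p q"
    unfolding word_form_superset[OF finite_keys finite_keys keys order_refl]
    by (simp add: word_form_def lk c cinner_scaleC_left sum_distrib_left)
  show "word_form c q (Poly_Mapping.map (scaleC a) p) = cnj a * word_form c q p"
    unfolding word_form_superset[OF finite_keys finite_keys order_refl keys]
    by (simp add: word_form_def lk cinner_scaleC_right sum_distrib_left)
qed

text \<open>A complex sesquilinear form with real values on the diagonal is Hermitian, by polarization.\<close>

theorem word_form_semi_inner_of_matrix_convex:
  fixes c :: "'d::finite list \<Rightarrow> ('k::complex_hilbert \<Rightarrow>\<^sub>L 'k)"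
  assumes "nc_power_series_on r c f" "1 < r" "matrix_convex_on r f"
  shows "word_form_semi_inner c"
  unfolding word_form_semi_inner_def
proof (intro conjI ballI)
  have c: "range c \<subseteq> clinear_ops"
    using assms(1) by (simp add: nc_power_series_on_def)
  show pos: "word_form c p p \<in> \<real>\<^sub>\<ge>\<^sub>0" if "p \<in> word_span" for p
    using word_form_nonneg[OF assms that] .
  have add: "p + q \<in> word_span" if "p \<in> word_span" "q \<in> word_span" for p q :: "'d list \<Rightarrow>\<^sub>0 'k"
    using that by (simp add: word_span_def in_keys_iff lookup_add)
  have map: "Poly_Mapping.map (scaleC a) q \<in> word_span" if "q \<in> word_span" for a and q :: "'d list \<Rightarrow>\<^sub>0 'k"
    using that by (simp add: word_span_def in_keys_iff map.rep_eq when_def)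
  fix p q :: "'d list \<Rightarrow>\<^sub>0 'k" assume p: "p \<in> word_span" and q: "q \<in> word_span"
  have real: "Im (word_form c s s) = 0" if "s \<in> word_span" for s
    using pos[OF that] by (simp add: complex_nonneg_Reals_iff)
  have "Im (word_form c (p + q) (p + q)) = 0"
    by (intro real add p q)
  then have 1: "Im (word_form c p q + word_form c q p) = 0"
    using real[OF p] real[OF q] by (simp add: word_form_add)
  have "Im (word_form c (p + Poly_Mapping.map (scaleC \<i>) q) (p + Poly_Mapping.map (scaleC \<i>) q)) = 0"
    by (intro real add map p q)
  then have 2: "Re (word_form c q p) - Re (word_form c p q) = 0"
    using real[OF p] real[OF q] by (simp add: word_form_add word_form_scaleC[OF c])
  show "word_form c p q = cnj (word_form c q p)"
    using 1 2 by (simp add: complex_eq_iff)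
qed


section \<open>Hermitian invertible dilations\<close>

lemma L2_set_mult_le_mat_norm:
  fixes M :: "complex mat"
  assumes "M \<in> carrier_mat n n"
  shows "L2_set (\<lambda>p. cmod (\<Sum>q<n. M $$ (p, q) * x q)) {..<n} \<le> mat_norm M * L2_set (\<lambda>q. cmod (x q)) {..<n}"
proof -
  have "L2_set (\<lambda>p. cmod (\<Sum>q<n. M $$ (p, q) * x q)) {..<n} = vec_l2 (M *\<^sub>v Matrix.vec n x)"
    unfolding vec_l2_def using assms
    by (intro L2_set_cong) (auto simp: scalar_prod_def atLeast0LessThan)
  also have "\<dots> \<le> mat_norm M * vec_l2 (Matrix.vec n x)"
    by (rule vec_l2_le_mat_norm[OF assms]) simp
  also have "vec_l2 (Matrix.vec n x) = L2_set (\<lambda>q. cmod (x q)) {..<n}"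
    unfolding vec_l2_def by (intro L2_set_cong) auto
  finally show ?thesis .
qed

lemma mat_norm_leI:
  fixes M :: "complex mat"
  assumes "M \<in> carrier_mat n n" "0 \<le> K"
    and "\<And>x. L2_set (\<lambda>p. cmod (\<Sum>q<n. M $$ (p, q) * x q)) {..<n} \<le> K * L2_set (\<lambda>q. cmod (x q)) {..<n}"
  shows "mat_norm M \<le> K"
proof (rule mat_norm_le[OF assms(1,2)])
  fix u :: "complex Matrix.vec" assume u: "u \<in> carrier_vec n"
  have "vec_l2 (M *\<^sub>v u) = L2_set (\<lambda>p. cmod (\<Sum>q<n. M $$ (p, q) * vec_index u q)) {..<n}"
    unfolding vec_l2_def using assms(1) u
    by (intro L2_set_cong) (auto simp: scalar_prod_def atLeast0LessThan)
  then show "vec_l2 (M *\<^sub>v u) \<le> K * vec_l2 u"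
    using assms(3)[of "vec_index u"] u by (simp add: vec_l2_def)
qed

text \<open>With \<open>y = M\<^sup>* x\<close> one has \<open>\<parallel>y\<parallel>\<^sup>2 = \<langle>x, M y\<rangle> \<le> \<parallel>x\<parallel> \<parallel>M\<parallel> \<parallel>y\<parallel>\<close>.\<close>

lemma L2_set_adjoint_le:
  fixes M :: "complex mat"
  assumes M: "M \<in> carrier_mat n n"
  shows "L2_set (\<lambda>p. cmod (\<Sum>q<n. cnj (M $$ (q, p)) * x q)) {..<n} \<le> mat_norm M * L2_set (\<lambda>q. cmod (x q)) {..<n}"
proof -
  define y where "y = (\<lambda>p. \<Sum>q<n. cnj (M $$ (q, p)) * x q)"
  define Ny where "Ny = L2_set (\<lambda>p. cmod (y p)) {..<n}"
  define Nx where "Nx = L2_set (\<lambda>p. cmod (x p)) {..<n}"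
  let ?My = "\<lambda>q. \<Sum>p<n. M $$ (q, p) * y p"
  have "complex_of_real (Ny\<^sup>2) = (\<Sum>p<n. y p * cnj (y p))"
    by (simp only: Ny_def L2_set_sq of_real_sum complex_norm_square)
  also have "\<dots> = (\<Sum>p<n. \<Sum>q<n. x q * cnj (M $$ (q, p) * y p))"
    by (subst (1) y_def) (simp add: sum_distrib_right sum_distrib_left mult_ac)
  also have "\<dots> = (\<Sum>q<n. x q * cnj (?My q))"
    by (subst sum.swap) (simp add: sum_distrib_left)
  finally have "Ny\<^sup>2 = cmod (\<Sum>q<n. x q * cnj (?My q))"
    by (metis abs_power2 norm_of_real)
  also have "\<dots> \<le> (\<Sum>q<n. \<bar>cmod (x q)\<bar> * \<bar>cmod (?My q)\<bar>)"
    by (rule sum_norm_le) (simp add: norm_mult del: cnj_sum)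
  also have "\<dots> \<le> Nx * L2_set (\<lambda>q. cmod (?My q)) {..<n}"
    unfolding Nx_def by (rule L2_set_mult_ineq)
  also have "\<dots> \<le> Nx * (mat_norm M * Ny)"
    unfolding Ny_def Nx_def by (intro mult_left_mono L2_set_mult_le_mat_norm M) auto
  finally have *: "Ny * Ny \<le> mat_norm M * Nx * Ny"
    by (simp add: power2_eq_square mult_ac)
  have "Ny \<le> mat_norm M * Nx"
  proof (cases "Ny = 0")
    case True
    then show ?thesis using mat_norm_nonneg[OF M] by (simp add: Nx_def)
  next
    case False
    then have "Ny > 0" by (simp add: Ny_def less_le)
    with * show ?thesis by simp
  qed
  then show ?thesis by (simp add: Ny_def Nx_def y_def)
qed

lemma sum_double:
  fixes h :: "nat \<Rightarrow> 'a::comm_monoid_add"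
  shows "(\<Sum>p<n + n. h p) = (\<Sum>p<n. h p) + (\<Sum>p<n. h (n + p))"
proof -
  have "(\<Sum>p<n + n. h p) = sum h {0..<n} + sum h {n..<n + n}"
    by (simp add: atLeast0LessThan[symmetric] sum.atLeastLessThan_concat)
  also have "sum h {n..<n + n} = (\<Sum>p<n. h (n + p))"
    using sum.shift_bounds_nat_ivl[of h 0 n n] by (simp add: atLeast0LessThan add.commute)
  finally show ?thesis by (simp add: atLeast0LessThan)
qed

text \<open>The matrix \<open>[[\<eta>, M], [M\<^sup>*, -\<eta>]]\<close>: the corner \<open>M\<close> makes it a Hermitian dilation, and the
  opposite signs on the diagonal make its square at least \<open>\<eta>\<^sup>2\<close>, so that it is invertible.\<close>

definition herm_dilation :: "nat \<Rightarrow> real \<Rightarrow> complex mat \<Rightarrow> complex mat" where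
  "herm_dilation n \<eta> M = mat (n + n) (n + n) (\<lambda>(p, q).
     if p < n then if q < n then if p = q then \<eta> else 0 else M $$ (p, q - n)
     else if q < n then cnj (M $$ (q, p - n)) else if p = q then - \<eta> else 0)"

lemma herm_dilation_carrier [simp]: "herm_dilation n \<eta> M \<in> carrier_mat (n + n) (n + n)"
    "dim_row (herm_dilation n \<eta> M) = n + n" "dim_col (herm_dilation n \<eta> M) = n + n"
  by (simp_all add: herm_dilation_def)

lemma herm_dilation_sum:
  shows "p < n \<Longrightarrow> (\<Sum>q<n + n. herm_dilation n \<eta> M $$ (p, q) * x q)
      = \<eta> * x p + (\<Sum>q<n. M $$ (p, q) * x (n + q))"
    and "p < n \<Longrightarrow> (\<Sum>q<n + n. herm_dilation n \<eta> M $$ (n + p, q) * x q)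
      = (\<Sum>q<n. cnj (M $$ (q, p)) * x q) - \<eta> * x (n + p)"
proof -
  assume p: "p < n"
  have "(\<Sum>q<n. herm_dilation n \<eta> M $$ (p, q) * x q) = (\<Sum>q<n. if q = p then \<eta> * x q else 0)"
    using p by (intro sum.cong) (auto simp: herm_dilation_def)
  moreover have "(\<Sum>q<n. herm_dilation n \<eta> M $$ (p, n + q) * x (n + q)) = (\<Sum>q<n. M $$ (p, q) * x (n + q))"
    using p by (intro sum.cong) (auto simp: herm_dilation_def)
  ultimately show "(\<Sum>q<n + n. herm_dilation n \<eta> M $$ (p, q) * x q)
      = \<eta> * x p + (\<Sum>q<n. M $$ (p, q) * x (n + q))"
    using p by (simp add: sum_double)
next
  assume p: "p < n"
  have "(\<Sum>q<n. herm_dilation n \<eta> M $$ (n + p, n + q) * x (n + q)) = (\<Sum>q<n. if q = p then - \<eta> * x (n + q) else 0)"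
    using p by (intro sum.cong) (auto simp: herm_dilation_def)
  moreover have "(\<Sum>q<n. herm_dilation n \<eta> M $$ (n + p, q) * x q) = (\<Sum>q<n. cnj (M $$ (q, p)) * x q)"
    using p by (intro sum.cong) (auto simp: herm_dilation_def)
  ultimately show "(\<Sum>q<n + n. herm_dilation n \<eta> M $$ (n + p, q) * x q)
      = (\<Sum>q<n. cnj (M $$ (q, p)) * x q) - \<eta> * x (n + p)"
    using p by (simp add: sum_double)
qed

lemma herm_dilation_hermitian: "mat_adjoint (herm_dilation n \<eta> M) = herm_dilation n \<eta> M"
  by (subst mat_adjoint_eq_iff[of _ "n + n"]) (auto simp: herm_dilation_def)

text \<open>The diagonal part is \<open>\<eta>\<close> times an isometry, and the off-diagonal part acts as \<open>M\<close> and
  \<open>M\<^sup>*\<close> between orthogonal summands.\<close>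

lemma mat_norm_herm_dilation_le:
  assumes M: "M \<in> carrier_mat n n" and "0 \<le> \<eta>"
  shows "mat_norm (herm_dilation n \<eta> M) \<le> mat_norm M + \<eta>"
proof (rule mat_norm_leI[OF herm_dilation_carrier(1)])
  let ?z = "mat_norm M"
  have z: "0 \<le> ?z" by (rule mat_norm_nonneg[OF M])
  then show "0 \<le> ?z + \<eta>" using assms by simp
  fix x :: "nat \<Rightarrow> complex"
  define d where "d = (\<lambda>p. if p < n then \<eta> * x p else - \<eta> * x p)"
  define o' where "o' = (\<lambda>p. if p < n then \<Sum>q<n. M $$ (p, q) * x (n + q) else \<Sum>q<n. cnj (M $$ (q, p - n)) * x q)"
  let ?N = "L2_set (\<lambda>q. cmod (x q)) {..<n + n}"
  have split: "(\<Sum>q<n + n. herm_dilation n \<eta> M $$ (p, q) * x q) = d p + o' p" if "p < n + n" for p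
  proof (cases "p < n")
    case True
    then show ?thesis by (simp add: herm_dilation_sum d_def o'_def)
  next
    case False
    then have "p = n + (p - n)" "p - n < n" using that by auto
    then show ?thesis
      using herm_dilation_sum(2)[of "p - n" n \<eta> M x] False by (simp add: d_def o'_def)
  qed
  have "(L2_set (\<lambda>p. cmod (o' p)) {..<n + n})\<^sup>2
      = (L2_set (\<lambda>p. cmod (\<Sum>q<n. M $$ (p, q) * x (n + q))) {..<n})\<^sup>2
        + (L2_set (\<lambda>p. cmod (\<Sum>q<n. cnj (M $$ (q, p)) * x q)) {..<n})\<^sup>2"
    by (simp add: L2_set_sq sum_double o'_def)
  also have "\<dots> \<le> (?z * L2_set (\<lambda>q. cmod (x (n + q))) {..<n})\<^sup>2 + (?z * L2_set (\<lambda>q. cmod (x q)) {..<n})\<^sup>2"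
    by (intro add_mono power_mono L2_set_mult_le_mat_norm[OF M] L2_set_adjoint_le[OF M]) auto
  also have "\<dots> = (?z * ?N)\<^sup>2"
    by (simp add: power_mult_distrib L2_set_sq sum_double algebra_simps)
  finally have o': "L2_set (\<lambda>p. cmod (o' p)) {..<n + n} \<le> ?z * ?N"
    by (rule power2_le_imp_le) (use z in \<open>auto intro!: mult_nonneg_nonneg\<close>)
  have d: "L2_set (\<lambda>p. cmod (d p)) {..<n + n} = \<eta> * ?N"
    using assms(2) by (simp add: L2_set_right_distrib) (intro L2_set_cong, auto simp: d_def norm_mult)
  have "L2_set (\<lambda>p. cmod (\<Sum>q<n + n. herm_dilation n \<eta> M $$ (p, q) * x q)) {..<n + n}
      \<le> L2_set (\<lambda>p. cmod (d p) + cmod (o' p)) {..<n + n}"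
    by (rule L2_set_mono) (auto simp: split norm_triangle_ineq)
  also have "\<dots> \<le> L2_set (\<lambda>p. cmod (d p)) {..<n + n} + L2_set (\<lambda>p. cmod (o' p)) {..<n + n}"
    by (rule L2_set_triangle_ineq)
  also have "\<dots> \<le> (?z + \<eta>) * ?N"
    using o' d by (simp add: algebra_simps)
  finally show "L2_set (\<lambda>p. cmod (\<Sum>q<n + n. herm_dilation n \<eta> M $$ (p, q) * x q)) {..<n + n}
      \<le> (?z + \<eta>) * ?N" .
qed

text \<open>If \<open>(x, y)\<close> is in the kernel, then pairing the two rows with \<open>x\<close> and \<open>y\<close> and
  eliminating the common term \<open>\<langle>M y, x\<rangle>\<close> leaves \<open>\<eta> (\<parallel>x\<parallel>\<^sup>2 + \<parallel>y\<parallel>\<^sup>2) = 0\<close>.\<close>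

lemma det_herm_dilation:
  assumes "0 < \<eta>"
  shows "Determinant.det (herm_dilation n \<eta> M) \<noteq> 0"
proof
  assume "Determinant.det (herm_dilation n \<eta> M) = 0"
  then obtain u where u: "u \<in> carrier_vec (n + n)" "u \<noteq> 0\<^sub>v (n + n)"
    and "herm_dilation n \<eta> M *\<^sub>v u = 0\<^sub>v (n + n)"
    using det_0_iff_vec_prod_zero_field[OF herm_dilation_carrier(1)] by blast
  define x where "x = vec_index u"
  have zero: "(\<Sum>q<n + n. herm_dilation n \<eta> M $$ (p, q) * x q) = 0" if "p < n + n" for p
  proof -
    have "(\<Sum>q<n + n. herm_dilation n \<eta> M $$ (p, q) * x q) = vec_index (herm_dilation n \<eta> M *\<^sub>v u) p"
      using that u(1) by (auto simp: scalar_prod_def atLeast0LessThan x_def)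
    then show ?thesis using \<open>herm_dilation n \<eta> M *\<^sub>v u = 0\<^sub>v (n + n)\<close> that by simp
  qed
  have top: "\<eta> * x p + (\<Sum>q<n. M $$ (p, q) * x (n + q)) = 0" if "p < n" for p
    using zero[of p] that by (simp add: herm_dilation_sum)
  have bot: "(\<Sum>q<n. cnj (M $$ (q, p)) * x q) = \<eta> * x (n + p)" if "p < n" for p
    using zero[of "n + p"] that by (simp add: herm_dilation_sum)
  have "0 = (\<Sum>p<n. cnj (x p) * (\<eta> * x p + (\<Sum>q<n. M $$ (p, q) * x (n + q))))"
    by (simp add: top)
  also have "\<dots> = (\<Sum>p<n. \<eta> * (cnj (x p) * x p)) + (\<Sum>p<n. \<Sum>q<n. x (n + q) * cnj (cnj (M $$ (p, q)) * x p))"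
    by (simp add: algebra_simps sum.distrib sum_distrib_left)
  also have "(\<Sum>p<n. \<Sum>q<n. x (n + q) * cnj (cnj (M $$ (p, q)) * x p))
      = (\<Sum>q<n. x (n + q) * cnj (\<Sum>p<n. cnj (M $$ (p, q)) * x p))"
    by (subst sum.swap) (simp add: sum_distrib_left)
  also have "\<dots> = (\<Sum>q<n. \<eta> * (cnj (x (n + q)) * x (n + q)))"
    by (intro sum.cong) (simp_all add: bot del: cnj_sum)
  also have "(\<Sum>p<n. \<eta> * (cnj (x p) * x p)) + (\<Sum>q<n. \<eta> * (cnj (x (n + q)) * x (n + q)))
      = (\<Sum>p<n + n. \<eta> * (cnj (x p) * x p))"
    by (simp add: sum_double)
  also have "\<dots> = complex_of_real (\<eta> * (\<Sum>p<n + n. (cmod (x p))\<^sup>2))"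
    by (simp only: of_real_mult of_real_sum complex_norm_square sum_distrib_left mult_ac)
  finally have "\<eta> * (\<Sum>p<n + n. (cmod (x p))\<^sup>2) = 0"
    by (metis of_real_eq_0_iff)
  then have "\<forall>p\<in>{..<n + n}. (cmod (x p))\<^sup>2 = 0"
    using assms by (subst (asm) mult_eq_0_iff, subst (asm) sum_nonneg_eq_0_iff) auto
  then have "u = 0\<^sub>v (n + n)"
    using u(1) by (intro eq_vecI) (auto simp: x_def)
  with u(2) show False by simp
qed

lemma inverse_of_det_nonzero:
  fixes M :: "complex mat"
  assumes "M \<in> carrier_mat n n" "Determinant.det M \<noteq> 0"
  obtains N where "N \<in> carrier_mat n n" "N * M = 1\<^sub>m n" "M * N = 1\<^sub>m n"
  using det_non_zero_imp_unit[OF assms, where b = "()"] that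
  by (auto simp: Units_def ring_mat_def)


section \<open>Moments of words\<close>

definition words_of_length :: "nat \<Rightarrow> 'd list set" where
  "words_of_length k = {w. length w = k}"

lemma finite_words_of_length [simp]: "finite (words_of_length k :: 'd::finite list set)"
  using finite_lists_length_eq[of "UNIV :: 'd set" k] by (simp add: words_of_length_def)

lemma words_of_length_0 [simp]: "words_of_length 0 = {[]}"
  by (auto simp: words_of_length_def)

lemma sum_words_add:
  "(\<Sum>w\<in>words_of_length (k + l). h w) = (\<Sum>u\<in>words_of_length k. \<Sum>w\<in>words_of_length l. h (u @ w))"
proof -
  have "(\<Sum>u\<in>words_of_length k. \<Sum>w\<in>words_of_length l. h (u @ w))
      = (\<Sum>(u, w)\<in>words_of_length k \<times> words_of_length l. h (u @ w))"
    by (rule sum.cartesian_product)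
  also have "\<dots> = (\<Sum>w\<in>words_of_length (k + l). h w)"
    by (rule sum.reindex_bij_witness[where j = "\<lambda>(u, w). u @ w" and i = "\<lambda>w. (take k w, drop k w)"])
      (auto simp: words_of_length_def)
  finally show ?thesis ..
qed

lemma sum_words_1: "(\<Sum>w\<in>words_of_length 1. h w) = (\<Sum>i\<in>UNIV. h [i])"
  by (rule sum.reindex_bij_witness[where i = "\<lambda>i. [i]" and j = hd])
    (auto simp: words_of_length_def length_Suc_conv)

text \<open>Repeated squaring turns the hypothesis into \<open>b 1 ^ 2 ^ j \<le> b 0 ^ (2 ^ j - 1) * b (2 ^ j)\<close>;
  a ratio \<open>b 1 / b 0 > 1\<close> would then make \<open>b\<close> unbounded.\<close>

lemma log_convex_bounded_imp_le:
  fixes b :: "nat \<Rightarrow> real"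
  assumes nn: "\<And>k. 0 \<le> b k" and lc: "\<And>k. (b k)\<^sup>2 \<le> b 0 * b (2 * k)" and bd: "\<And>k. b k \<le> M"
  shows "b 1 \<le> b 0"
proof (rule ccontr)
  assume "\<not> b 1 \<le> b 0"
  then have lt: "b 0 < b 1" by simp
  have b0: "0 < b 0"
  proof (rule ccontr)
    assume "\<not> 0 < b 0"
    then have "b 0 = 0" using nn[of 0] by simp
    then have "(b 1)\<^sup>2 \<le> 0" using lc[of 1] by simp
    then show False using lt nn[of 0] by simp
  qed
  have it: "b 1 ^ 2 ^ j * b 0 \<le> b 0 ^ 2 ^ j * b (2 ^ j)" for j
  proof (induction j)
    case (Suc j)
    have "(b 1 ^ 2 ^ j * b 0)\<^sup>2 \<le> (b 0 ^ 2 ^ j * b (2 ^ j))\<^sup>2"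
      using Suc nn by (intro power_mono) auto
    also have "\<dots> = b 0 ^ 2 ^ Suc j * (b (2 ^ j))\<^sup>2"
      by (simp add: power_mult_distrib power_mult[symmetric] mult.commute)
    also have "\<dots> \<le> b 0 ^ 2 ^ Suc j * (b 0 * b (2 ^ Suc j))"
      using lc[of "2 ^ j"] nn by (intro mult_left_mono) auto
    finally have "b 0 * (b 1 ^ 2 ^ Suc j * b 0) \<le> b 0 * (b 0 ^ 2 ^ Suc j * b (2 ^ Suc j))"
      by (simp add: power2_eq_square power_add[symmetric] mult_2 algebra_simps)
    then show ?case using b0 by simp
  qed simp
  define x where "x = b 1 / b 0"
  have x: "1 < x" using lt b0 by (simp add: x_def)
  have "x ^ j \<le> M / b 0" for j
  proof -
    have "x ^ j \<le> x ^ 2 ^ j"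
      using x by (intro power_increasing) (auto simp: less_imp_le[OF less_exp])
    also have "x ^ 2 ^ j \<le> b (2 ^ j) / b 0"
      using it[of j] b0 by (simp add: x_def power_divide field_simps)
    also have "\<dots> \<le> M / b 0" using bd b0 by (simp add: divide_right_mono)
    finally show ?thesis .
  qed
  moreover obtain j where "M / b 0 < x ^ j"
    using real_arch_pow[OF x] by blast
  ultimately show False by (meson not_le)
qed

text \<open>The coordinate \<open>p\<close> of \<open>(\<Sum>\<^sub>i T\<^sub>i \<otimes> Z\<^sub>i)\<^sup>k u\<close>, where \<open>u\<close> has the coordinates
  \<open>\<Sum>\<^sub>\<alpha> \<alpha> \<otimes> v p \<alpha>\<close>, written without the \<open>T\<^sub>i\<close>: prepending \<open>w\<close> to the words is applying \<open>T\<^sup>w\<close>. The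
  sum of \<open>word_moment\<close> over the words of length \<open>k\<close> is the inner product of this vector with \<open>u\<close>.\<close>

definition word_orbit ::
    "('d list \<Rightarrow> 'k \<Rightarrow> 'h::complex_hilbert) \<Rightarrow> nat \<Rightarrow> ('d \<Rightarrow> complex mat) \<Rightarrow> 'd list set
      \<Rightarrow> (nat \<Rightarrow> 'd list \<Rightarrow> 'k) \<Rightarrow> nat \<Rightarrow> nat \<Rightarrow> 'h" where
  "word_orbit e n Z F v k p = (\<Sum>w\<in>words_of_length k. \<Sum>q<n. \<Sum>\<alpha>\<in>F.
     scaleC (word_power n Z w $$ (p, q)) (e (w @ \<alpha>) (v q \<alpha>)))"

definition word_moment ::
    "('d list \<Rightarrow> ('k::complex_hilbert \<Rightarrow>\<^sub>L 'k)) \<Rightarrow> nat \<Rightarrow> ('d \<Rightarrow> complex mat) \<Rightarrow> 'd list set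
      \<Rightarrow> (nat \<Rightarrow> 'd list \<Rightarrow> 'k) \<Rightarrow> 'd list \<Rightarrow> complex" where
  "word_moment c n Z F v w = (\<Sum>q<n. \<Sum>\<alpha>\<in>F. \<Sum>p<n. \<Sum>\<beta>\<in>F.
     word_power n Z w $$ (p, q) * cinner (blinfun_apply (c (rev \<beta> @ w @ \<alpha>)) (v q \<alpha>)) (v p \<beta>))"

lemma word_power_rev_hermitian:
  assumes Z: "\<And>i. Z i \<in> carrier_mat n n" and herm: "\<And>i. mat_adjoint (Z i) = Z i"
    and "p < n" "q < n"
  shows "word_power n Z (rev w) $$ (q, p) = cnj (word_power n Z w $$ (p, q))"
  using assms(3)
proof (induction w arbitrary: p)
  case Nil
  then show ?case using assms(4) by auto
next
  case (Cons i w)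
  note W = word_power_carrier[of Z n, OF Z]
  have Zi: "word_power n Z [i] = Z i"
    using Z[of i] by (simp add: word_power_Cons)
  have "word_power n Z (rev (i # w)) $$ (q, p) = (\<Sum>r<n. word_power n Z (rev w) $$ (q, r) * Z i $$ (r, p))"
    using word_power_append[of Z n "rev w" "[i]", OF Z]
      index_mult_mat_sum[OF W Z assms(4) Cons.prems, of "rev w" i] by (simp add: Zi)
  also have "\<dots> = (\<Sum>r<n. cnj (Z i $$ (p, r) * word_power n Z w $$ (r, q)))"
  proof (rule sum.cong[OF refl])
    fix r assume "r \<in> {..<n}"
    then have r: "r < n" by simp
    have "Z i $$ (r, p) = cnj (Z i $$ (p, r))"
      using mat_adjoint_eq_iff[OF Z[of i]] herm[of i] r Cons.prems by blast
    then show "word_power n Z (rev w) $$ (q, r) * Z i $$ (r, p)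
        = cnj (Z i $$ (p, r) * word_power n Z w $$ (r, q))"
      by (simp add: Cons.IH[OF r] mult.commute)
  qed
  also have "\<dots> = cnj (word_power n Z (i # w) $$ (p, q))"
    unfolding word_power_Cons index_mult_mat_sum[OF Z W Cons.prems assms(4)] by simp
  finally show ?case .
qed

text \<open>This is the self-adjointness of \<open>\<Sum>\<^sub>i T\<^sub>i Z\<^sub>i\<close>, expressed before the operators \<open>T\<^sub>i\<close> are known
  to exist: the pairing of two vectors of an orbit depends only on the sum of their positions.\<close>

lemma word_orbit_inner:
  fixes c :: "'d::finite list \<Rightarrow> ('k::complex_hilbert \<Rightarrow>\<^sub>L 'k)"
    and e :: "'d list \<Rightarrow> 'k \<Rightarrow> 'h::complex_hilbert"
  assumes gram: "\<And>\<alpha> \<beta> v w. \<alpha> \<noteq> [] \<Longrightarrow> \<beta> \<noteq> [] \<Longrightarrow>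
      cinner (e \<alpha> v) (e \<beta> w) = cinner (blinfun_apply (c (rev \<beta> @ \<alpha>)) v) w"
    and Z: "\<And>i. Z i \<in> carrier_mat n n" and herm: "\<And>i. mat_adjoint (Z i) = Z i"
    and F: "[] \<notin> F"
  shows "(\<Sum>p<n. cinner (word_orbit e n Z F v k p) (word_orbit e n Z F v l p))
    = (\<Sum>w\<in>words_of_length (l + k). word_moment c n Z F v w)"
proof -
  let ?W = "word_power n Z"
  note W = word_power_carrier[of Z n, OF Z]
  let ?C = "\<lambda>w' w q \<alpha> q' \<beta>. cinner (blinfun_apply (c (rev \<beta> @ (rev w' @ w) @ \<alpha>)) (v q \<alpha>)) (v q' \<beta>)"
  have "(\<Sum>p<n. cinner (word_orbit e n Z F v k p) (word_orbit e n Z F v l p))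
     = (\<Sum>p<n. \<Sum>w'\<in>words_of_length l. \<Sum>w\<in>words_of_length k. \<Sum>q<n. \<Sum>\<alpha>\<in>F. \<Sum>q'<n. \<Sum>\<beta>\<in>F.
          ?W w $$ (p, q) * cnj (?W w' $$ (p, q')) * ?C w' w q \<alpha> q' \<beta>)"
  proof (rule sum.cong[OF refl])
    fix p
    have "cinner (word_orbit e n Z F v k p) (word_orbit e n Z F v l p)
      = (\<Sum>w\<in>words_of_length k. \<Sum>q<n. \<Sum>\<alpha>\<in>F. \<Sum>w'\<in>words_of_length l. \<Sum>q'<n. \<Sum>\<beta>\<in>F.
          ?W w $$ (p, q) * (cnj (?W w' $$ (p, q')) * cinner (e (w @ \<alpha>) (v q \<alpha>)) (e (w' @ \<beta>) (v q' \<beta>))))"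
      by (simp only: word_orbit_def cinner_sum_left cinner_scaleC_left)
        (simp only: cinner_sum_right cinner_scaleC_right sum_distrib_left)
    also have "\<dots> = (\<Sum>w\<in>words_of_length k. \<Sum>q<n. \<Sum>\<alpha>\<in>F. \<Sum>w'\<in>words_of_length l. \<Sum>q'<n. \<Sum>\<beta>\<in>F.
          ?W w $$ (p, q) * cnj (?W w' $$ (p, q')) * ?C w' w q \<alpha> q' \<beta>)"
    proof (intro sum.cong refl)
      fix w q \<alpha> w' q' \<beta> assume "\<alpha> \<in> F" "\<beta> \<in> F"
      then have "w @ \<alpha> \<noteq> []" "w' @ \<beta> \<noteq> []" using F by auto
      from gram[OF this]
      show "?W w $$ (p, q) * (cnj (?W w' $$ (p, q')) * cinner (e (w @ \<alpha>) (v q \<alpha>)) (e (w' @ \<beta>) (v q' \<beta>)))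
        = ?W w $$ (p, q) * cnj (?W w' $$ (p, q')) * ?C w' w q \<alpha> q' \<beta>"
        by simp
    qed
    also have "\<dots> = (\<Sum>w'\<in>words_of_length l. \<Sum>w\<in>words_of_length k. \<Sum>q<n. \<Sum>\<alpha>\<in>F. \<Sum>q'<n. \<Sum>\<beta>\<in>F.
          ?W w $$ (p, q) * cnj (?W w' $$ (p, q')) * ?C w' w q \<alpha> q' \<beta>)"
      by (rule sym, (rule trans[OF sum.swap], rule sum.cong[OF refl]), (rule trans[OF sum.swap],
            rule sum.cong[OF refl]), (rule trans[OF sum.swap], rule sum.cong[OF refl]), rule refl)
    finally show "cinner (word_orbit e n Z F v k p) (word_orbit e n Z F v l p)
      = (\<Sum>w'\<in>words_of_length l. \<Sum>w\<in>words_of_length k. \<Sum>q<n. \<Sum>\<alpha>\<in>F. \<Sum>q'<n. \<Sum>\<beta>\<in>F.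
          ?W w $$ (p, q) * cnj (?W w' $$ (p, q')) * ?C w' w q \<alpha> q' \<beta>)" .
  qed
  also have "\<dots> = (\<Sum>w'\<in>words_of_length l. \<Sum>w\<in>words_of_length k. \<Sum>q<n. \<Sum>\<alpha>\<in>F. \<Sum>q'<n. \<Sum>\<beta>\<in>F.
      (\<Sum>p<n. ?W w $$ (p, q) * cnj (?W w' $$ (p, q'))) * ?C w' w q \<alpha> q' \<beta>)"
    by ((rule trans[OF sum.swap], rule sum.cong[OF refl])+, simp only: sum_distrib_right)
  also have "\<dots> = (\<Sum>w'\<in>words_of_length l. \<Sum>w\<in>words_of_length k. word_moment c n Z F v (rev w' @ w))"
    unfolding word_moment_def
  proof (intro sum.cong refl)
    fix w w' :: "'d list" and q q' \<alpha> \<beta> assume q: "q \<in> {..<n}" "q' \<in> {..<n}"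
    have "(\<Sum>p<n. ?W w $$ (p, q) * cnj (?W w' $$ (p, q'))) = (\<Sum>p<n. ?W (rev w') $$ (q', p) * ?W w $$ (p, q))"
      using word_power_rev_hermitian[of Z n, OF Z herm] q by (intro sum.cong) auto
    also have "\<dots> = ?W (rev w' @ w) $$ (q', q)"
      using q index_mult_mat_sum[OF W W, of q' q "rev w'" w] word_power_append[of Z n "rev w'" w, OF Z] by simp
    finally show "(\<Sum>p<n. ?W w $$ (p, q) * cnj (?W w' $$ (p, q'))) * ?C w' w q \<alpha> q' \<beta>
      = ?W (rev w' @ w) $$ (q', q) * ?C w' w q \<alpha> q' \<beta>" by simp
  qed
  also have "\<dots> = (\<Sum>u\<in>words_of_length l. \<Sum>w\<in>words_of_length k. word_moment c n Z F v (u @ w))"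
    by (rule sum.reindex_bij_witness[where i = rev and j = rev]) (auto simp: words_of_length_def)
  also have "\<dots> = (\<Sum>w\<in>words_of_length (l + k). word_moment c n Z F v w)"
    by (rule sum_words_add[symmetric])
  finally show ?thesis .
qed


section \<open>The contraction estimate\<close>

lemma det_word_power:
  assumes Z: "\<And>i. Z i \<in> carrier_mat n n" and "\<And>i. Determinant.det (Z i) \<noteq> 0"
  shows "Determinant.det (word_power n Z w :: complex mat) \<noteq> 0"
proof (induction w)
  case (Cons i w)
  then show ?case
    using det_mult[OF Z word_power_carrier[of Z n, OF Z], of i w] assms(2)
    by (simp add: word_power_Cons)
qed simp

text \<open>The power series controls \<open>c\<close> on the words \<open>rev \<beta> @ w @ \<alpha>\<close> in terms of the powers of \<open>Z\<close>
  along the same words. If the \<open>Z i\<close> are invertible, the outer factors can be removed from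
  these powers.\<close>

lemma flanked_sum_bounded:
  fixes c :: "'d::finite list \<Rightarrow> ('k::complex_hilbert \<Rightarrow>\<^sub>L 'k)"
  assumes ser: "nc_power_series_on r c f" and ball: "Z \<in> complex_nc_ball n r"
    and det: "\<And>i. Determinant.det (Z i) \<noteq> 0" and pq: "p < n" "q < n"
  obtains B where "\<And>k. (\<Sum>w\<in>words_of_length k. cmod (word_power n Z w $$ (p, q)) * norm (c (u @ w @ t))) \<le> B"
proof -
  have Z: "\<And>i. Z i \<in> carrier_mat n n" using ball by (simp add: complex_nc_ball_iff)
  let ?W = "word_power n Z"
  note W = word_power_carrier[of Z n, OF Z]
  obtain L where L: "L \<in> carrier_mat n n" "L * ?W u = 1\<^sub>m n"
    using inverse_of_det_nonzero[OF W det_word_power[of Z n, OF Z det]] by metis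
  obtain R where R: "R \<in> carrier_mat n n" "?W t * R = 1\<^sub>m n"
    using inverse_of_det_nonzero[OF W det_word_power[of Z n, OF Z det]] by metis
  let ?g = "\<lambda>r s x. cmod (?W x $$ (r, s)) * norm (c x)"
  define B where "B = (\<Sum>s<n. \<Sum>r<n. cmod (L $$ (p, r)) * cmod (R $$ (s, q)) * infsum (?g r s) UNIV)"
  have entry: "cmod (?W w $$ (p, q))
      \<le> (\<Sum>s<n. \<Sum>r<n. cmod (L $$ (p, r)) * cmod (R $$ (s, q)) * cmod (?W (u @ w @ t) $$ (r, s)))" for w
  proof -
    have "L * ?W (u @ w @ t) = (L * ?W u) * (?W w * ?W t)"
      using L(1) W assoc_mult_mat[of L n n "?W u" n "?W w * ?W t" n] mult_carrier_mat[OF W W, of w t]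
      by (simp add: word_power_append[of Z n, OF Z])
    then have "L * ?W (u @ w @ t) = ?W w * ?W t"
      by (simp only: L(2) left_mult_one_mat[OF mult_carrier_mat[OF W W]])
    then have "L * ?W (u @ w @ t) * R = ?W w * (?W t * R)"
      using assoc_mult_mat[OF W W R(1), of w t] by simp
    then have "?W w = L * ?W (u @ w @ t) * R"
      using W[of w] by (simp add: R(2))
    then have "?W w $$ (p, q) = (\<Sum>s<n. (\<Sum>r<n. L $$ (p, r) * ?W (u @ w @ t) $$ (r, s)) * R $$ (s, q))"
      using index_mult_mat_sum[OF mult_carrier_mat[OF L(1) W] R(1) pq, of "u @ w @ t"]
        index_mult_mat_sum[OF L(1) W pq(1), of _ "u @ w @ t"]
      by simp
    then have "cmod (?W w $$ (p, q)) \<le> (\<Sum>s<n. cmod (\<Sum>r<n. L $$ (p, r) * ?W (u @ w @ t) $$ (r, s)) * cmod (R $$ (s, q)))"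
      by (simp add: sum_norm_le norm_mult)
    also have "\<dots> \<le> (\<Sum>s<n. (\<Sum>r<n. cmod (L $$ (p, r) * ?W (u @ w @ t) $$ (r, s))) * cmod (R $$ (s, q)))"
      by (intro sum_mono mult_right_mono norm_sum) auto
    also have "\<dots> = (\<Sum>s<n. \<Sum>r<n. cmod (L $$ (p, r)) * cmod (R $$ (s, q)) * cmod (?W (u @ w @ t) $$ (r, s)))"
      by (simp add: sum_distrib_right sum_distrib_left norm_mult mult_ac)
    finally show ?thesis .
  qed
  have "(\<Sum>w\<in>words_of_length k. cmod (?W w $$ (p, q)) * norm (c (u @ w @ t))) \<le> B" for k
  proof -
    have "(\<Sum>w\<in>words_of_length k. cmod (?W w $$ (p, q)) * norm (c (u @ w @ t)))
      \<le> (\<Sum>w\<in>words_of_length k. (\<Sum>s<n. \<Sum>r<n. cmod (L $$ (p, r)) * cmod (R $$ (s, q)) * cmod (?W (u @ w @ t) $$ (r, s)))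
          * norm (c (u @ w @ t)))"
      by (intro sum_mono mult_right_mono entry) auto
    also have "\<dots> = (\<Sum>w\<in>words_of_length k. \<Sum>s<n. \<Sum>r<n. cmod (L $$ (p, r)) * cmod (R $$ (s, q)) * ?g r s (u @ w @ t))"
      by (simp only: sum_distrib_right mult.assoc)
    also have "\<dots> = (\<Sum>s<n. \<Sum>r<n. cmod (L $$ (p, r)) * cmod (R $$ (s, q)) * (\<Sum>w\<in>words_of_length k. ?g r s (u @ w @ t)))"
      by ((rule trans[OF sum.swap], rule sum.cong[OF refl])+, simp only: sum_distrib_left)
    also have "\<dots> \<le> B"
      unfolding B_def
    proof (intro sum_mono mult_left_mono)
      fix r' s assume rs: "s \<in> {..<n}" "r' \<in> {..<n}"
      have "(\<Sum>w\<in>words_of_length k. ?g r' s (u @ w @ t)) = (\<Sum>x\<in>(\<lambda>w. u @ w @ t) ` words_of_length k. ?g r' s x)"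
        by (subst sum.reindex) (auto simp: inj_on_def)
      also have "\<dots> \<le> infsum (?g r' s) UNIV"
        using rs by (intro finite_sum_le_infsum entry_summable[OF ser ball]) auto
      finally show "(\<Sum>w\<in>words_of_length k. ?g r' s (u @ w @ t)) \<le> infsum (?g r' s) UNIV" .
    qed auto
    finally show ?thesis .
  qed
  then show ?thesis by (rule that)
qed

lemma word_moment_bounded:
  fixes c :: "'d::finite list \<Rightarrow> ('k::complex_hilbert \<Rightarrow>\<^sub>L 'k)"
  assumes ser: "nc_power_series_on r c f" and ball: "Z \<in> complex_nc_ball n r"
    and det: "\<And>i. Determinant.det (Z i) \<noteq> 0"
  obtains B where "\<And>k. cmod (\<Sum>w\<in>words_of_length k. word_moment c n Z F v w) \<le> B"
proof -
  let ?W = "word_power n Z"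
  have ex: "\<exists>B. \<forall>k. (\<Sum>w\<in>words_of_length k. cmod (?W w $$ (p, q)) * norm (c (rev \<beta> @ w @ \<alpha>))) \<le> B"
    if "p < n" "q < n" for p q \<alpha> \<beta>
    by (rule flanked_sum_bounded[OF ser ball det that, of "rev \<beta>" \<alpha>]) blast
  define B where "B = (\<lambda>p q \<alpha> \<beta>. SOME B. \<forall>k.
      (\<Sum>w\<in>words_of_length k. cmod (?W w $$ (p, q)) * norm (c (rev \<beta> @ w @ \<alpha>))) \<le> B)"
  have B: "\<And>p q \<alpha> \<beta> k. p < n \<Longrightarrow> q < n \<Longrightarrow>
      (\<Sum>w\<in>words_of_length k. cmod (?W w $$ (p, q)) * norm (c (rev \<beta> @ w @ \<alpha>))) \<le> B p q \<alpha> \<beta>"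
    unfolding B_def by (rule someI_ex[OF ex, THEN spec])
  have "cmod (\<Sum>w\<in>words_of_length k. word_moment c n Z F v w)
      \<le> (\<Sum>q<n. \<Sum>\<alpha>\<in>F. \<Sum>p<n. \<Sum>\<beta>\<in>F. norm (v q \<alpha>) * norm (v p \<beta>) * B p q \<alpha> \<beta>)" for k
  proof -
    have "(\<Sum>w\<in>words_of_length k. word_moment c n Z F v w)
      = (\<Sum>q<n. \<Sum>\<alpha>\<in>F. \<Sum>p<n. \<Sum>\<beta>\<in>F. \<Sum>w\<in>words_of_length k.
         ?W w $$ (p, q) * cinner (blinfun_apply (c (rev \<beta> @ w @ \<alpha>)) (v q \<alpha>)) (v p \<beta>))"
      unfolding word_moment_def
      by ((rule trans[OF sum.swap], rule sum.cong[OF refl])+, rule refl)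
    also have "cmod \<dots> \<le> (\<Sum>q<n. \<Sum>\<alpha>\<in>F. \<Sum>p<n. \<Sum>\<beta>\<in>F. norm (v q \<alpha>) * norm (v p \<beta>) * B p q \<alpha> \<beta>)"
    proof (intro sum_norm_le)
      fix q \<alpha> p \<beta> assume pq: "q \<in> {..<n}" "p \<in> {..<n}"
      have "cmod (\<Sum>w\<in>words_of_length k. ?W w $$ (p, q) * cinner (blinfun_apply (c (rev \<beta> @ w @ \<alpha>)) (v q \<alpha>)) (v p \<beta>))
        \<le> (\<Sum>w\<in>words_of_length k. norm (v q \<alpha>) * norm (v p \<beta>) * (cmod (?W w $$ (p, q)) * norm (c (rev \<beta> @ w @ \<alpha>))))"
      proof (rule sum_norm_le)
        fix w
        have "cmod (cinner (blinfun_apply (c (rev \<beta> @ w @ \<alpha>)) (v q \<alpha>)) (v p \<beta>))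
            \<le> norm (blinfun_apply (c (rev \<beta> @ w @ \<alpha>)) (v q \<alpha>)) * norm (v p \<beta>)"
          by (rule cmod_cinner_le)
        also have "\<dots> \<le> norm (c (rev \<beta> @ w @ \<alpha>)) * norm (v q \<alpha>) * norm (v p \<beta>)"
          by (intro mult_right_mono norm_blinfun) auto
        finally have "cmod (?W w $$ (p, q)) * cmod (cinner (blinfun_apply (c (rev \<beta> @ w @ \<alpha>)) (v q \<alpha>)) (v p \<beta>))
            \<le> cmod (?W w $$ (p, q)) * (norm (c (rev \<beta> @ w @ \<alpha>)) * norm (v q \<alpha>) * norm (v p \<beta>))"
          by (rule mult_left_mono) auto
        then show "cmod (?W w $$ (p, q) * cinner (blinfun_apply (c (rev \<beta> @ w @ \<alpha>)) (v q \<alpha>)) (v p \<beta>))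
            \<le> norm (v q \<alpha>) * norm (v p \<beta>) * (cmod (?W w $$ (p, q)) * norm (c (rev \<beta> @ w @ \<alpha>)))"
          by (simp add: norm_mult mult_ac)
      qed
      also have "\<dots> \<le> norm (v q \<alpha>) * norm (v p \<beta>) * B p q \<alpha> \<beta>"
        unfolding sum_distrib_left[symmetric] using pq by (intro mult_left_mono B) auto
      finally show "cmod (\<Sum>w\<in>words_of_length k. ?W w $$ (p, q) * cinner (blinfun_apply (c (rev \<beta> @ w @ \<alpha>)) (v q \<alpha>)) (v p \<beta>))
        \<le> norm (v q \<alpha>) * norm (v p \<beta>) * B p q \<alpha> \<beta>" .
    qed
    finally show ?thesis .
  qed
  then show ?thesis by (rule that)
qed

lemma word_orbit_0:
  assumes "p < n"
  shows "word_orbit e n Z F v 0 p = (\<Sum>\<alpha>\<in>F. e \<alpha> (v p \<alpha>))"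
proof -
  have "word_orbit e n Z F v 0 p = (\<Sum>q<n. if q = p then \<Sum>\<alpha>\<in>F. e \<alpha> (v q \<alpha>) else 0)"
  proof -
    have "word_orbit e n Z F v 0 p = (\<Sum>q<n. \<Sum>\<alpha>\<in>F. scaleC (if p = q then 1 else 0) (e \<alpha> (v q \<alpha>)))"
      using assms by (simp add: word_orbit_def)
    also have "\<dots> = (\<Sum>q<n. if q = p then \<Sum>\<alpha>\<in>F. e \<alpha> (v q \<alpha>) else 0)"
      by (intro sum.cong) auto
    finally show ?thesis .
  qed
  then show ?thesis using assms by simp
qed

lemma word_orbit_1:
  assumes Z: "\<And>i. Z i \<in> carrier_mat n n"
  shows "word_orbit e n Z F v 1 p
    = (\<Sum>i\<in>UNIV. \<Sum>q<n. \<Sum>\<alpha>\<in>F. scaleC (Z i $$ (p, q)) (e (i # \<alpha>) (v q \<alpha>)))"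
proof -
  have "word_power n Z [i] = Z i" for i
    using Z[of i] by (simp add: word_power_Cons)
  then show ?thesis
    unfolding word_orbit_def sum_words_1 by simp
qed

text \<open>By \<open>word_orbit_inner\<close> the squared norms along the orbit are the even moments, and
  Cauchy-Schwarz applied to positions \<open>2 * k\<close> and \<open>0\<close> is the logarithmic convexity.\<close>

lemma word_orbit_contraction_hermitian:
  fixes c :: "'d::finite list \<Rightarrow> ('k::complex_hilbert \<Rightarrow>\<^sub>L 'k)"
    and e :: "'d list \<Rightarrow> 'k \<Rightarrow> 'h::complex_hilbert"
  assumes ser: "nc_power_series_on r c f"
    and gram: "\<And>\<alpha> \<beta> v w. \<alpha> \<noteq> [] \<Longrightarrow> \<beta> \<noteq> [] \<Longrightarrow>
      cinner (e \<alpha> v) (e \<beta> w) = cinner (blinfun_apply (c (rev \<beta> @ \<alpha>)) v) w"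
    and ball: "Z \<in> complex_nc_ball n r" and herm: "\<And>i. mat_adjoint (Z i) = Z i"
    and det: "\<And>i. Determinant.det (Z i) \<noteq> 0" and F: "[] \<notin> F"
  shows "L2_set (\<lambda>p. norm (word_orbit e n Z F v 1 p)) {..<n}
    \<le> L2_set (\<lambda>p. norm (word_orbit e n Z F v 0 p)) {..<n}"
proof -
  have Z: "\<And>i. Z i \<in> carrier_mat n n" using ball by (simp add: complex_nc_ball_iff)
  let ?U = "word_orbit e n Z F v"
  define b where "b = (\<lambda>k. L2_set (\<lambda>p. norm (?U k p)) {..<n})"
  let ?m = "\<lambda>k. \<Sum>w\<in>words_of_length k. word_moment c n Z F v w"
  obtain B where B: "\<And>k. cmod (?m k) \<le> B"
    using word_moment_bounded[OF ser ball det] by metis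
  note inner = word_orbit_inner[where e = e and c = c and Z = Z and n = n and F = F, OF gram Z herm F]
  have sq: "(b k)\<^sup>2 = cmod (?m (2 * k))" for k
  proof -
    have "complex_of_real ((b k)\<^sup>2) = (\<Sum>p<n. cinner (?U k p) (?U k p))"
      by (simp add: b_def L2_set_sq cinner_self)
    also have "\<dots> = ?m (2 * k)"
      by (simp add: inner mult_2)
    finally show ?thesis by (metis abs_power2 norm_of_real)
  qed
  have "b 1 \<le> b 0"
  proof (rule log_convex_bounded_imp_le[where M = "1 + B"])
    show "0 \<le> b k" for k by (simp add: b_def)
    show "(b k)\<^sup>2 \<le> b 0 * b (2 * k)" for k
    proof -
      have "(b k)\<^sup>2 = cmod (\<Sum>p<n. cinner (?U (2 * k) p) (?U 0 p))"
        using inner[of v "2 * k" 0] by (simp add: sq)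
      also have "\<dots> \<le> (\<Sum>p<n. \<bar>norm (?U (2 * k) p)\<bar> * \<bar>norm (?U 0 p)\<bar>)"
        by (rule sum_norm_le) (simp add: cmod_cinner_le)
      also have "\<dots> \<le> b (2 * k) * b 0"
        unfolding b_def by (rule L2_set_mult_ineq)
      finally show ?thesis by (simp add: mult.commute)
    qed
    show "b k \<le> 1 + B" for k
    proof (cases "b k \<le> 1")
      case True
      moreover have "0 \<le> B" using B[of 0] norm_ge_zero order_trans by blast
      ultimately show ?thesis by simp
    next
      case False
      then have "b k \<le> (b k)\<^sup>2" by (simp add: power2_eq_square)
      then show ?thesis using B[of "2 * k"] by (simp add: sq)
    qed
  qed
  then show ?thesis by (simp add: b_def)
qed

text \<open>An arbitrary tuple in the ball is a corner of Hermitian invertible dilations that are still in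
  the ball. Compressing to the corner can only decrease the left-hand side.\<close>

lemma word_orbit_contraction:
  fixes c :: "'d::finite list \<Rightarrow> ('k::complex_hilbert \<Rightarrow>\<^sub>L 'k)"
    and e :: "'d list \<Rightarrow> 'k \<Rightarrow> 'h::complex_hilbert"
  assumes ser: "nc_power_series_on r c f"
    and gram: "\<And>\<alpha> \<beta> v w. \<alpha> \<noteq> [] \<Longrightarrow> \<beta> \<noteq> [] \<Longrightarrow>
      cinner (e \<alpha> v) (e \<beta> w) = cinner (blinfun_apply (c (rev \<beta> @ \<alpha>)) v) w"
    and e0: "\<And>\<alpha>. \<alpha> \<noteq> [] \<Longrightarrow> e \<alpha> 0 = 0"
    and ball: "Z \<in> complex_nc_ball n r" and F: "[] \<notin> F"
  shows "L2_set (\<lambda>p. norm (\<Sum>i\<in>UNIV. \<Sum>q<n. \<Sum>\<alpha>\<in>F. scaleC (Z i $$ (p, q)) (e (i # \<alpha>) (v q \<alpha>)))) {..<n}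
    \<le> L2_set (\<lambda>p. norm (\<Sum>\<alpha>\<in>F. e \<alpha> (v p \<alpha>))) {..<n}"
proof -
  have Z: "\<And>i. Z i \<in> carrier_mat n n" and n: "0 < n"
    using ball by (simp_all add: complex_nc_ball_iff)
  define s where "s = tuple_norm Z"
  have s: "s < r" using ball by (simp add: complex_nc_ball_def s_def)
  have le_s: "mat_norm (Z i) \<le> s" for i
    unfolding s_def tuple_norm_def by (rule Max_ge) auto
  define \<eta> where "\<eta> = (r - s) / 2"
  have \<eta>: "0 < \<eta>" "s + \<eta> < r" using s by (auto simp: \<eta>_def field_simps)
  define Y where "Y = (\<lambda>i. herm_dilation n \<eta> (Z i))"
  \<comment> \<open>The vector sits in the second summand, so that the corner \<open>Z i\<close> maps it into the first.\<close>
  define V where "V = (\<lambda>q \<alpha>. if q < n then 0 else v (q - n) \<alpha>)"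
  have Yc: "Y i \<in> carrier_mat (n + n) (n + n)" for i by (simp add: Y_def)
  have "mat_norm (Y i) < r" for i
    using mat_norm_herm_dilation_le[OF Z, of \<eta> i] \<eta> le_s[of i] by (simp add: Y_def)
  then have Y: "Y \<in> complex_nc_ball (n + n) r"
    using n Yc by (simp add: complex_nc_ball_iff)
  let ?A = "\<lambda>p. \<Sum>i\<in>UNIV. \<Sum>q<n. \<Sum>\<alpha>\<in>F. scaleC (Z i $$ (p, q)) (e (i # \<alpha>) (v q \<alpha>))"
  let ?C = "\<lambda>p. \<Sum>\<alpha>\<in>F. e \<alpha> (v p \<alpha>)"
  have one: "word_orbit e (n + n) Y F V 1 p = ?A p" if p: "p < n" for p
  proof -
    have "(\<Sum>q<n + n. \<Sum>\<alpha>\<in>F. scaleC (Y i $$ (p, q)) (e (i # \<alpha>) (V q \<alpha>)))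
        = (\<Sum>q<n. \<Sum>\<alpha>\<in>F. scaleC (Z i $$ (p, q)) (e (i # \<alpha>) (v q \<alpha>)))" for i
    proof -
      have "(\<Sum>q<n. \<Sum>\<alpha>\<in>F. scaleC (Y i $$ (p, q)) (e (i # \<alpha>) (V q \<alpha>))) = 0"
        using e0 by (intro sum.neutral) (auto simp: V_def)
      moreover have "(\<Sum>q<n. \<Sum>\<alpha>\<in>F. scaleC (Y i $$ (p, n + q)) (e (i # \<alpha>) (V (n + q) \<alpha>)))
        = (\<Sum>q<n. \<Sum>\<alpha>\<in>F. scaleC (Z i $$ (p, q)) (e (i # \<alpha>) (v q \<alpha>)))"
        using p by (intro sum.cong) (auto simp: V_def Y_def herm_dilation_def)
      ultimately show ?thesis by (simp add: sum_double)
    qed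
    then show ?thesis by (simp only: word_orbit_1[OF Yc])
  qed
  have zero: "word_orbit e (n + n) Y F V 0 p = (if p < n then 0 else ?C (p - n))" if "p < n + n" for p
  proof -
    have "e \<alpha> 0 = 0" if "\<alpha> \<in> F" for \<alpha>
      using that F e0 by metis
    then show ?thesis
      using that by (simp add: word_orbit_0 V_def)
  qed
  have "(L2_set (\<lambda>p. norm (?A p)) {..<n})\<^sup>2
      \<le> (L2_set (\<lambda>p. norm (word_orbit e (n + n) Y F V 1 p)) {..<n + n})\<^sup>2"
  proof -
    have "(\<Sum>p<n. (norm (?A p))\<^sup>2) = (\<Sum>p<n. (norm (word_orbit e (n + n) Y F V 1 p))\<^sup>2)"
      by (intro sum.cong refl) (simp only: one lessThan_iff)
    then show ?thesis
      unfolding L2_set_sq sum_double by (simp add: sum_nonneg)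
  qed
  also have "\<dots> \<le> (L2_set (\<lambda>p. norm (word_orbit e (n + n) Y F V 0 p)) {..<n + n})\<^sup>2"
    by (intro power_mono word_orbit_contraction_hermitian[OF ser gram Y _ _ F])
      (use \<eta> in \<open>auto simp: Y_def herm_dilation_hermitian det_herm_dilation\<close>)
  also have "\<dots> = (L2_set (\<lambda>p. norm (?C p)) {..<n})\<^sup>2"
    unfolding L2_set_sq sum_double by (simp add: zero)
  finally show ?thesis
    by (rule power2_le_imp_le) simp
qed


section \<open>Extension of densely defined operators\<close>

text \<open>The densely defined operator is given by its graph \<open>P\<close>; the bound makes it single-valued.\<close>

lemma bounded_graph_extends:
  fixes P :: "'h::complex_hilbert \<Rightarrow> 'b::complex_hilbert \<Rightarrow> bool"
  assumes add: "\<And>x y x' y'. P x y \<Longrightarrow> P x' y' \<Longrightarrow> P (x + x') (y + y')"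
    and scale: "\<And>a x y. P x y \<Longrightarrow> P (scaleC a x) (scaleC a y)"
    and bound: "\<And>x y. P x y \<Longrightarrow> norm y \<le> K * norm x" and K: "0 \<le> K"
    and dense: "closure {x. \<exists>y. P x y} = UNIV"
  obtains B where "B \<in> clinear_ops" "norm B \<le> K" "\<And>x y. P x y \<Longrightarrow> blinfun_apply B x = y"
proof -
  let ?D = "{x. \<exists>y. P x y}"
  have diff: "norm (y - y') \<le> K * norm (x - x')" if "P x y" "P x' y'" for x y x' y'
    using bound[OF add[OF that(1) scale[OF that(2), of "-1"]]] by (simp add: scaleC_minus1)
  obtain g where g: "\<And>x. x \<in> ?D \<Longrightarrow> P x (g x)" by atomize_elim (rule choice, auto)
  have uniq: "y = g x" if "P x y" for x y
    using diff[OF that, of x "g x"] g that by fastforce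
  have "lipschitz_on K ?D g"
    using g K diff by (intro lipschitz_onI) (auto simp: dist_norm)
  then have "uniformly_continuous_on ?D g"
    by (rule lipschitz_on_uniformly_continuous)
  from uniformly_continuous_on_extension_on_closure[OF this]
  obtain h where h: "uniformly_continuous_on UNIV h" "\<And>x. x \<in> ?D \<Longrightarrow> g x = h x"
    unfolding dense by metis
  have hP: "h x = y" if "P x y" for x y
    using that uniq[OF that] h(2)[of x] by (metis mem_Collect_eq)
  have cont: "continuous_on UNIV h"
    using h(1) by (rule uniformly_continuous_imp_continuous)
  have scont: "continuous_on UNIV (\<lambda>x :: 'x::complex_hilbert. scaleC a x)" for a
    by (rule linear_continuous_on[OF bounded_linear_scaleC])
  have all: "x \<in> S" if "closed S" "?D \<subseteq> S" for S x
    using closure_minimal[OF that(2,1)] dense by auto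
  have hD: "P x (h x)" if "x \<in> ?D" for x
    using g[OF that] h(2)[OF that] by simp
  have add1: "h (x + y) = h x + h y" if "y \<in> ?D" for x y
  proof -
    have "x \<in> {x. h (x + y) = h x + h y}"
    proof (rule all)
      show "closed {x. h (x + y) = h x + h y}"
        by (intro closed_Collect_eq continuous_intros continuous_on_compose2[OF cont]) auto
      show "?D \<subseteq> {x. h (x + y) = h x + h y}"
        using add[OF hD hD[OF that]] hP by auto
    qed
    then show ?thesis by simp
  qed
  have hadd: "h (x + y) = h x + h y" for x y
  proof -
    have "y \<in> {y. h (x + y) = h x + h y}"
    proof (rule all)
      show "closed {y. h (x + y) = h x + h y}"
        by (intro closed_Collect_eq continuous_intros continuous_on_compose2[OF cont]) auto
      show "?D \<subseteq> {y. h (x + y) = h x + h y}"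
        using add1 by auto
    qed
    then show ?thesis by simp
  qed
  have hscale: "h (scaleC a x) = scaleC a (h x)" for a x
  proof -
    have "x \<in> {x. h (scaleC a x) = scaleC a (h x)}"
    proof (rule all)
      show "closed {x. h (scaleC a x) = scaleC a (h x)}"
        by (intro closed_Collect_eq continuous_on_compose2[OF cont] continuous_on_compose2[OF scont] scont cont) auto
      show "?D \<subseteq> {x. h (scaleC a x) = scaleC a (h x)}"
        using scale[OF hD] hP by auto
    qed
    then show ?thesis by simp
  qed
  have hbound: "norm (h x) \<le> K * norm x" for x
  proof -
    have "x \<in> {x. norm (h x) \<le> K * norm x}"
    proof (rule all)
      show "closed {x. norm (h x) \<le> K * norm x}"
        by (intro closed_Collect_le continuous_intros cont)
      show "?D \<subseteq> {x. norm (h x) \<le> K * norm x}"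
        using bound[OF hD] by auto
    qed
    then show ?thesis by simp
  qed
  have "bounded_linear h"
    using hadd hscale[of "complex_of_real _"] hbound
    by (intro bounded_linear_intro[where K = K]) (auto simp: scaleC_of_real mult.commute)
  then have app: "blinfun_apply (Blinfun h) = h"
    by (rule bounded_linear_Blinfun_apply)
  show ?thesis
  proof
    show "Blinfun h \<in> clinear_ops" by (simp add: clinear_ops_def app hscale)
    show "norm (Blinfun h) \<le> K" by (rule norm_blinfun_bound[OF K]) (simp add: app hbound)
    show "\<And>x y. P x y \<Longrightarrow> blinfun_apply (Blinfun h) x = y" by (simp add: app hP)
  qed
qed

definition dense_sums :: "'i set \<Rightarrow> ('i \<Rightarrow> 'k \<Rightarrow> 'h::real_normed_vector) \<Rightarrow> bool" where
  "dense_sums I e \<longleftrightarrow> closure {\<Sum>i\<in>F. e i (v i) | F v. finite F \<and> F \<subseteq> I} = UNIV"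

definition clinear_fun :: "('a::complex_hilbert \<Rightarrow> 'b::complex_hilbert) \<Rightarrow> bool" where
  "clinear_fun g \<longleftrightarrow> (\<forall>x y. g (x + y) = g x + g y) \<and> (\<forall>a x. g (scaleC a x) = scaleC a (g x))"

lemma clinear_fun_zero: "clinear_fun g \<Longrightarrow> g 0 = 0"
  unfolding clinear_fun_def by (metis add_cancel_left_left add_0)

lemma sum_clinear_union:
  assumes "finite F" "finite G" "F \<subseteq> I" "G \<subseteq> I" "\<And>i. i \<in> I \<Longrightarrow> clinear_fun (g i)"
  shows "(\<Sum>i\<in>F. g i (v i)) + (\<Sum>i\<in>G. g i (w i))
    = (\<Sum>i\<in>F \<union> G. g i ((if i \<in> F then v i else 0) + (if i \<in> G then w i else 0)))"
proof -
  have "(\<Sum>i\<in>H. g i (u i)) = (\<Sum>i\<in>F \<union> G. g i (if i \<in> H then u i else 0))"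
    if "H \<subseteq> F \<union> G" for H u
    by (rule sum.mono_neutral_cong_left[OF finite_UnI[OF assms(1,2)] that])
      (use assms(3,4) that in \<open>auto intro!: clinear_fun_zero[OF assms(5)]\<close>)
  from this[of F v] this[of G w]
  have "(\<Sum>i\<in>F. g i (v i)) + (\<Sum>i\<in>G. g i (w i))
      = (\<Sum>i\<in>F \<union> G. g i (if i \<in> F then v i else 0) + g i (if i \<in> G then w i else 0))"
    by (simp add: sum.distrib)
  also have "\<dots> = (\<Sum>i\<in>F \<union> G. g i ((if i \<in> F then v i else 0) + (if i \<in> G then w i else 0)))"
  proof (rule sum.cong[OF refl])
    fix i assume "i \<in> F \<union> G"
    then have "clinear_fun (g i)" using assms by blast
    then show "g i (if i \<in> F then v i else 0) + g i (if i \<in> G then w i else 0)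
        = g i ((if i \<in> F then v i else 0) + (if i \<in> G then w i else 0))"
      unfolding clinear_fun_def by metis
  qed
  finally show ?thesis .
qed

lemma bounded_family_extends:
  fixes e :: "'i \<Rightarrow> 'k::complex_hilbert \<Rightarrow> 'h::complex_hilbert"
    and E :: "'i \<Rightarrow> 'k \<Rightarrow> 'b::complex_hilbert"
  assumes e: "\<And>i. i \<in> I \<Longrightarrow> clinear_fun (e i)" and E: "\<And>i. i \<in> I \<Longrightarrow> clinear_fun (E i)"
    and dense: "dense_sums I e" and K: "0 \<le> K"
    and bound: "\<And>F v. finite F \<Longrightarrow> F \<subseteq> I \<Longrightarrow> norm (\<Sum>i\<in>F. E i (v i)) \<le> K * norm (\<Sum>i\<in>F. e i (v i))"
  obtains B where "B \<in> clinear_ops" "norm B \<le> K" "\<And>i x. i \<in> I \<Longrightarrow> blinfun_apply B (e i x) = E i x"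
proof -
  define P where "P = (\<lambda>x y. \<exists>F v. finite F \<and> F \<subseteq> I \<and> x = (\<Sum>i\<in>F. e i (v i)) \<and> y = (\<Sum>i\<in>F. E i (v i)))"
  have "{x. \<exists>y. P x y} = {\<Sum>i\<in>F. e i (v i) | F v. finite F \<and> F \<subseteq> I}"
    by (auto simp: P_def)
  then have dom: "closure {x. \<exists>y. P x y} = UNIV"
    using dense by (simp add: dense_sums_def)
  have add: "P (x + x') (y + y')" if xy: "P x y" and xy': "P x' y'" for x y x' y'
  proof -
    obtain F v where F: "finite F" "F \<subseteq> I" "x = (\<Sum>i\<in>F. e i (v i))" "y = (\<Sum>i\<in>F. E i (v i))"
      using xy unfolding P_def by blast
    obtain G w where G: "finite G" "G \<subseteq> I" "x' = (\<Sum>i\<in>G. e i (w i))" "y' = (\<Sum>i\<in>G. E i (w i))"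
      using xy' unfolding P_def by blast
    let ?u = "\<lambda>i. (if i \<in> F then v i else 0) + (if i \<in> G then w i else 0)"
    have "x + x' = (\<Sum>i\<in>F \<union> G. e i (?u i))"
      unfolding F(3) G(3) by (rule sum_clinear_union[OF F(1) G(1) F(2) G(2) e])
    moreover have "y + y' = (\<Sum>i\<in>F \<union> G. E i (?u i))"
      unfolding F(4) G(4) by (rule sum_clinear_union[OF F(1) G(1) F(2) G(2) E])
    ultimately show ?thesis
      unfolding P_def using F(1,2) G(1,2) by (intro exI[of _ "F \<union> G"] exI[of _ ?u]) auto
  qed
  have scale: "P (scaleC a x) (scaleC a y)" if xy: "P x y" for a x y
  proof -
    obtain F v where F: "finite F" "F \<subseteq> I" "x = (\<Sum>i\<in>F. e i (v i))" "y = (\<Sum>i\<in>F. E i (v i))"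
      using xy unfolding P_def by blast
    have "scaleC a x = (\<Sum>i\<in>F. e i (scaleC a (v i)))" "scaleC a y = (\<Sum>i\<in>F. E i (scaleC a (v i)))"
      unfolding F scaleC_sum_right using F(2) e E by (auto simp: clinear_fun_def intro!: sum.cong)
    then show ?thesis
      unfolding P_def using F(1,2) by (intro exI[of _ F] exI[of _ "\<lambda>i. scaleC a (v i)"]) auto
  qed
  have bd: "norm y \<le> K * norm x" if "P x y" for x y
    using that bound unfolding P_def by blast
  obtain B where B: "B \<in> clinear_ops" "norm B \<le> K" "\<And>x y. P x y \<Longrightarrow> blinfun_apply B x = y"
    using bounded_graph_extends[of P K, OF add scale bd K dom] by blast
  have "P (e i x) (E i x)" if "i \<in> I" for i x
    unfolding P_def using that by (intro exI[of _ "{i}"] exI[of _ "\<lambda>_. x"]) auto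
  with B show ?thesis by (intro that[of B]) auto
qed


section \<open>Inverses by Neumann series\<close>

text \<open>Neumann series of operators converge because these Hilbert spaces are complete.\<close>

instance complex_hilbert \<subseteq> banach ..

fun kernel_power :: "nat \<Rightarrow> (nat \<Rightarrow> nat \<Rightarrow> ('h::real_normed_vector \<Rightarrow>\<^sub>L 'h)) \<Rightarrow> nat \<Rightarrow> nat \<Rightarrow> nat \<Rightarrow> ('h \<Rightarrow>\<^sub>L 'h)" where
  "kernel_power n S 0 p q = (if p = q then id_blinfun else 0)"
| "kernel_power n S (Suc k) p q = (\<Sum>r<n. S p r o\<^sub>L kernel_power n S k r q)"

lemma compose_sum_left: "sum f A o\<^sub>L B = (\<Sum>i\<in>A. f i o\<^sub>L B)"
  by (rule bounded_bilinear.sum_left[OF bounded_bilinear_blinfun_compose])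

lemma compose_sum_right: "B o\<^sub>L sum f A = (\<Sum>i\<in>A. B o\<^sub>L f i)"
  by (rule bounded_bilinear.sum_right[OF bounded_bilinear_blinfun_compose])

lemma compose_id [simp]: "id_blinfun o\<^sub>L A = A" "A o\<^sub>L id_blinfun = A"
  by (auto intro: blinfun_eqI)

lemma compose_assoc: "(A o\<^sub>L B) o\<^sub>L C = A o\<^sub>L (B o\<^sub>L C)"
  by (auto intro: blinfun_eqI)

lemma kernel_power_Suc_right:
  assumes "p < n" "q < n"
  shows "kernel_power n S (Suc k) p q = (\<Sum>r<n. kernel_power n S k p r o\<^sub>L S r q)"
  using assms(1)
proof (induction k arbitrary: p)
  case 0
  have "(\<Sum>r<n. S p r o\<^sub>L (if r = q then id_blinfun else 0)) = (\<Sum>r<n. if r = q then S p r else 0)"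
    by (intro sum.cong) auto
  moreover have "(\<Sum>r<n. (if p = r then id_blinfun else 0) o\<^sub>L S r q) = (\<Sum>r<n. if r = p then S r q else 0)"
    by (intro sum.cong) auto
  ultimately show ?case using 0 assms(2) by simp
next
  case (Suc k)
  have "kernel_power n S (Suc (Suc k)) p q = (\<Sum>r<n. S p r o\<^sub>L (\<Sum>s<n. kernel_power n S k r s o\<^sub>L S s q))"
    using Suc.IH by (subst kernel_power.simps(2)) (intro sum.cong, auto)
  also have "\<dots> = (\<Sum>s<n. \<Sum>r<n. S p r o\<^sub>L (kernel_power n S k r s o\<^sub>L S s q))"
    unfolding compose_sum_right by (rule sum.swap)
  also have "\<dots> = (\<Sum>s<n. kernel_power n S (Suc k) p s o\<^sub>L S s q)"
    by (simp add: compose_sum_left compose_assoc)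
  finally show ?case .
qed

text \<open>The entry is read off from the orbit of a vector supported in the coordinate \<open>q\<close>.\<close>

lemma norm_kernel_power_le:
  fixes S :: "nat \<Rightarrow> nat \<Rightarrow> ('h::real_normed_vector \<Rightarrow>\<^sub>L 'h)"
  assumes \<rho>: "0 \<le> \<rho>"
    and S: "\<And>u. L2_set (\<lambda>p. norm (\<Sum>q<n. blinfun_apply (S p q) (u q))) {..<n} \<le> \<rho> * L2_set (\<lambda>p. norm (u p)) {..<n}"
    and pq: "p < n" "q < n"
  shows "norm (kernel_power n S k p q) \<le> \<rho> ^ k"
proof (rule norm_blinfun_bound)
  fix x
  define u where "u = (\<lambda>k p. blinfun_apply (kernel_power n S k p q) x)"
  have rec: "u (Suc k) p = (\<Sum>r<n. blinfun_apply (S p r) (u k r))" for k p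
    by (simp add: u_def blinfun.sum_left)
  have "L2_set (\<lambda>p. norm (u k p)) {..<n} \<le> \<rho> ^ k * L2_set (\<lambda>p. norm (u 0 p)) {..<n}"
  proof (induction k)
    case (Suc k)
    have "L2_set (\<lambda>p. norm (u (Suc k) p)) {..<n} \<le> \<rho> * L2_set (\<lambda>p. norm (u k p)) {..<n}"
      unfolding rec by (rule S)
    also have "\<dots> \<le> \<rho> * (\<rho> ^ k * L2_set (\<lambda>p. norm (u 0 p)) {..<n})"
      using Suc \<rho> by (rule mult_left_mono)
    finally show ?case by simp
  qed simp
  also have "L2_set (\<lambda>p. norm (u 0 p)) {..<n} = norm x"
  proof -
    have "(\<Sum>p<n. (norm (u 0 p))\<^sup>2) = (\<Sum>p<n. if p = q then (norm x)\<^sup>2 else 0)"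
      by (intro sum.cong) (auto simp: u_def)
    then show ?thesis using pq by (simp add: L2_set_def)
  qed
  finally have "L2_set (\<lambda>p. norm (u k p)) {..<n} \<le> \<rho> ^ k * norm x" .
  moreover have "norm (u k p) \<le> L2_set (\<lambda>p. norm (u k p)) {..<n}"
    using pq by (intro member_le_L2_set) auto
  ultimately show "norm (blinfun_apply (kernel_power n S k p q) x) \<le> \<rho> ^ k * norm x"
    by (simp add: u_def)
qed (use \<rho> in simp)

lemma neumann_inverse:
  fixes S :: "nat \<Rightarrow> nat \<Rightarrow> ('h::complex_hilbert \<Rightarrow>\<^sub>L 'h)"
  assumes \<rho>: "0 \<le> \<rho>" "\<rho> < 1"
    and S: "\<And>u. L2_set (\<lambda>p. norm (\<Sum>q<n. blinfun_apply (S p q) (u q))) {..<n} \<le> \<rho> * L2_set (\<lambda>p. norm (u p)) {..<n}"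
  obtains R where "op_mat_inverse n (op_mat_one n - mat n n (\<lambda>(p, q). S p q)) R"
    "\<And>p q. p < n \<Longrightarrow> q < n \<Longrightarrow> (\<lambda>k. kernel_power n S k p q) sums (R $$ (p, q))"
proof -
  let ?K = "kernel_power n S"
  define R where "R = mat n n (\<lambda>(p, q). suminf (\<lambda>k. ?K k p q))"
  have sums: "(\<lambda>k. ?K k p q) sums (R $$ (p, q))" if "p < n" "q < n" for p q
  proof -
    have "summable (\<lambda>k. ?K k p q)"
      by (rule summable_comparison_test'[OF summable_geometric[of \<rho>]])
        (use \<rho> norm_kernel_power_le[OF \<rho>(1) S that] in auto)
    then show ?thesis using that by (simp add: R_def summable_sums)
  qed
  have shift: "(\<lambda>k. ?K (Suc k) p q) sums (R $$ (p, q) - ?K 0 p q)" if "p < n" "q < n" for p q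
    using sums_split_initial_segment[OF sums[OF that], of 1] by simp
  have left: "(\<Sum>r<n. S p r o\<^sub>L R $$ (r, q)) = R $$ (p, q) - ?K 0 p q" if "p < n" "q < n" for p q
  proof (rule sums_unique2[OF _ shift[OF that]])
    have "(\<lambda>k. \<Sum>r<n. S p r o\<^sub>L ?K k r q) sums (\<Sum>r<n. S p r o\<^sub>L R $$ (r, q))"
      using that by (intro sums_sum bounded_linear.sums[OF bounded_bilinear.bounded_linear_right[OF
              bounded_bilinear_blinfun_compose]] sums) auto
    then show "(\<lambda>k. ?K (Suc k) p q) sums (\<Sum>r<n. S p r o\<^sub>L R $$ (r, q))" by simp
  qed
  have right: "(\<Sum>r<n. R $$ (p, r) o\<^sub>L S r q) = R $$ (p, q) - ?K 0 p q" if "p < n" "q < n" for p q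
  proof (rule sums_unique2[OF _ shift[OF that]])
    have "(\<lambda>k. \<Sum>r<n. ?K k p r o\<^sub>L S r q) sums (\<Sum>r<n. R $$ (p, r) o\<^sub>L S r q)"
      using that by (intro sums_sum bounded_linear.sums[OF bounded_bilinear.bounded_linear_left[OF
              bounded_bilinear_blinfun_compose]] sums) auto
    then show "(\<lambda>k. ?K (Suc k) p q) sums (\<Sum>r<n. R $$ (p, r) o\<^sub>L S r q)"
      by (simp only: kernel_power_Suc_right[OF that])
  qed
  let ?M = "op_mat_one n - mat n n (\<lambda>(p, q). S p q)"
  have M: "?M $$ (p, q) = ?K 0 p q - S p q" if "p < n" "q < n" for p q
    using that by (simp add: op_mat_one_def)
  have dims: "dim_row ?M = n" "dim_col ?M = n" "dim_row R = n" "dim_col R = n"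
    by (simp_all add: op_mat_one_def R_def)
  have id_left: "(\<Sum>r<n. ?K 0 p r o\<^sub>L R $$ (r, q)) = R $$ (p, q)" if "p < n" "q < n" for p q
  proof -
    have "(\<Sum>r<n. ?K 0 p r o\<^sub>L R $$ (r, q)) = (\<Sum>r<n. if r = p then R $$ (r, q) else 0)"
      by (intro sum.cong) auto
    then show ?thesis using that by simp
  qed
  have id_right: "(\<Sum>r<n. R $$ (p, r) o\<^sub>L ?K 0 r q) = R $$ (p, q)" if "p < n" "q < n" for p q
  proof -
    have "(\<Sum>r<n. R $$ (p, r) o\<^sub>L ?K 0 r q) = (\<Sum>r<n. if r = q then R $$ (p, r) else 0)"
      by (intro sum.cong) auto
    then show ?thesis using that by simp
  qed
  have "op_mat_mult ?M R = op_mat_one n"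
  proof (rule eq_matI)
    fix p q assume "p < dim_row (op_mat_one n :: ('h \<Rightarrow>\<^sub>L 'h) mat)" "q < dim_col (op_mat_one n :: ('h \<Rightarrow>\<^sub>L 'h) mat)"
    then have pq: "p < n" "q < n" by (simp_all add: op_mat_one_def)
    have "op_mat_mult ?M R $$ (p, q) = (\<Sum>r<n. ?M $$ (p, r) o\<^sub>L R $$ (r, q))"
      unfolding op_mat_mult_def dims using pq by simp
    also have "\<dots> = (\<Sum>r<n. (?K 0 p r o\<^sub>L R $$ (r, q)) - (S p r o\<^sub>L R $$ (r, q)))"
      by (rule sum.cong[OF refl]) (use pq in \<open>simp only: M lessThan_iff
          bounded_bilinear.diff_left[OF bounded_bilinear_blinfun_compose]\<close>)
    also have "\<dots> = ?K 0 p q"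
      unfolding sum_subtractf id_left[OF pq] left[OF pq] by simp
    finally show "op_mat_mult ?M R $$ (p, q) = op_mat_one n $$ (p, q)"
      using pq by (simp add: op_mat_one_def)
  qed (simp_all add: op_mat_mult_def op_mat_one_def R_def)
  moreover have "op_mat_mult R ?M = op_mat_one n"
  proof (rule eq_matI)
    fix p q assume "p < dim_row (op_mat_one n :: ('h \<Rightarrow>\<^sub>L 'h) mat)" "q < dim_col (op_mat_one n :: ('h \<Rightarrow>\<^sub>L 'h) mat)"
    then have pq: "p < n" "q < n" by (simp_all add: op_mat_one_def)
    have "op_mat_mult R ?M $$ (p, q) = (\<Sum>r<n. R $$ (p, r) o\<^sub>L ?M $$ (r, q))"
      unfolding op_mat_mult_def dims using pq by simp
    also have "\<dots> = (\<Sum>r<n. (R $$ (p, r) o\<^sub>L ?K 0 r q) - (R $$ (p, r) o\<^sub>L S r q))"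
      by (rule sum.cong[OF refl]) (use pq in \<open>simp only: M lessThan_iff
          bounded_bilinear.diff_right[OF bounded_bilinear_blinfun_compose]\<close>)
    also have "\<dots> = ?K 0 p q"
      unfolding sum_subtractf id_right[OF pq] right[OF pq] by simp
    finally show "op_mat_mult R ?M $$ (p, q) = op_mat_one n $$ (p, q)"
      using pq by (simp add: op_mat_one_def)
  qed (simp_all add: op_mat_mult_def op_mat_one_def R_def)
  ultimately have "op_mat_inverse n ?M R"
    by (simp add: op_mat_inverse_def R_def)
  then show ?thesis using sums by (rule that)
qed


section \<open>The operators of the realization\<close>

lemma bounded_linear_eq_on_dense_sums:
  fixes g h :: "'h::real_normed_vector \<Rightarrow> 'b::real_normed_vector"
  assumes dense: "dense_sums I e" and g: "bounded_linear g" and h: "bounded_linear h"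
    and eq: "\<And>i v. i \<in> I \<Longrightarrow> g (e i v) = h (e i v)"
  shows "g = h"
proof
  fix x
  have "closed {x. g x = h x}"
    by (intro closed_Collect_eq linear_continuous_on g h)
  moreover have "{\<Sum>i\<in>F. e i (v i) | F v. finite F \<and> F \<subseteq> I} \<subseteq> {x. g x = h x}"
  proof
    fix y assume "y \<in> {\<Sum>i\<in>F. e i (v i) | F v. finite F \<and> F \<subseteq> I}"
    then obtain F v where F: "F \<subseteq> I" and y: "y = (\<Sum>i\<in>F. e i (v i))" by blast
    have "(\<Sum>i\<in>F. g (e i (v i))) = (\<Sum>i\<in>F. h (e i (v i)))"
      using F eq by (intro sum.cong) auto
    then show "y \<in> {x. g x = h x}"
      by (simp add: y linear_sum[OF bounded_linear.linear[OF g]] linear_sum[OF bounded_linear.linear[OF h]])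
  qed
  ultimately have "x \<in> {x. g x = h x}"
    using closure_minimal dense unfolding dense_sums_def by blast
  then show "g x = h x" by simp
qed

text \<open>The data available once the symbols \<open>\<alpha> \<otimes> v\<close> have been represented by vectors \<open>e \<alpha> v\<close> of a
  Hilbert space.\<close>

locale realized_series =
  fixes r :: real
    and c :: "'d::finite list \<Rightarrow> ('k::complex_hilbert \<Rightarrow>\<^sub>L 'k)"
    and f :: "('d \<Rightarrow> complex mat) \<Rightarrow> ('k \<Rightarrow>\<^sub>L 'k) mat"
    and e :: "'d list \<Rightarrow> 'k \<Rightarrow> 'h::complex_hilbert"
  assumes series: "nc_power_series_on r c f" and radius: "1 < r"
    and gram: "\<And>\<alpha> \<beta> v w. \<alpha> \<noteq> [] \<Longrightarrow> \<beta> \<noteq> [] \<Longrightarrow>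
      cinner (e \<alpha> v) (e \<beta> w) = cinner (blinfun_apply (c (rev \<beta> @ \<alpha>)) v) w"
    and clin: "\<And>\<alpha>. \<alpha> \<noteq> [] \<Longrightarrow> clinear_fun (e \<alpha>)"
    and dense: "dense_sums {\<alpha>. \<alpha> \<noteq> []} e"
begin

lemma coefficient_scaleC: "blinfun_apply (c w) (scaleC a x) = scaleC a (blinfun_apply (c w) x)"
  using series by (auto simp: nc_power_series_on_def intro!: clinear_opsD)

lemma e_zero: "\<alpha> \<noteq> [] \<Longrightarrow> e \<alpha> 0 = 0"
  by (intro clinear_fun_zero clin)

lemma contraction:
  assumes "Z \<in> complex_nc_ball n r" "[] \<notin> F"
  shows "L2_set (\<lambda>p. norm (\<Sum>i\<in>UNIV. \<Sum>q<n. \<Sum>\<alpha>\<in>F. scaleC (Z i $$ (p, q)) (e (i # \<alpha>) (v q \<alpha>)))) {..<n}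
    \<le> L2_set (\<lambda>p. norm (\<Sum>\<alpha>\<in>F. e \<alpha> (v p \<alpha>))) {..<n}"
  by (rule word_orbit_contraction[OF series]) (use assms in \<open>auto simp: gram e_zero\<close>)

text \<open>For a single letter the contraction estimate is used with the tuple of \<open>1 \<times> 1\<close> matrices that
  is \<open>1\<close> at this letter.\<close>

lemma shift_exists:
  "\<exists>T. T \<in> clinear_ops \<and> norm T \<le> 1 \<and> (\<forall>\<alpha> v. \<alpha> \<noteq> [] \<longrightarrow> blinfun_apply T (e \<alpha> v) = e (i # \<alpha>) v)"
proof -
  define Z where "Z = (\<lambda>j. if j = i then 1\<^sub>m 1 else 0\<^sub>m 1 1 :: complex mat)"
  have "mat_norm (Z j) \<le> 1" for j
  proof -
    have "Z j \<in> carrier_mat 1 1" by (simp add: Z_def)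
    from mat_norm_le_sum[OF this] have "mat_norm (Z j) \<le> cmod (Z j $$ (0, 0))" by simp
    also have "\<dots> \<le> 1" by (simp add: Z_def)
    finally show ?thesis .
  qed
  then have "mat_norm (Z j) < r" for j
    using radius by (rule le_less_trans)
  moreover have "Z j \<in> carrier_mat 1 1" for j by (simp add: Z_def)
  ultimately have Z: "Z \<in> complex_nc_ball 1 r"
    unfolding complex_nc_ball_iff by blast
  have bound: "norm (\<Sum>\<alpha>\<in>F. e (i # \<alpha>) (v \<alpha>)) \<le> 1 * norm (\<Sum>\<alpha>\<in>F. e \<alpha> (v \<alpha>))"
    if "F \<subseteq> {\<alpha>. \<alpha> \<noteq> []}" for F v
  proof -
    have "(\<Sum>j\<in>UNIV. \<Sum>q<1::nat. \<Sum>\<alpha>\<in>F. scaleC (Z j $$ (0, q)) (e (j # \<alpha>) (v \<alpha>)))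
        = (\<Sum>j\<in>UNIV. if j = i then \<Sum>\<alpha>\<in>F. e (j # \<alpha>) (v \<alpha>) else 0)"
      by (intro sum.cong) (auto simp: Z_def)
    also have "\<dots> = (\<Sum>\<alpha>\<in>F. e (i # \<alpha>) (v \<alpha>))" by simp
    finally show ?thesis
      using contraction[OF Z, of F "\<lambda>_. v"] that by (auto simp: L2_set_def)
  qed
  obtain T where "T \<in> clinear_ops" "norm T \<le> 1"
    "\<And>\<alpha> v. \<alpha> \<in> {\<alpha>. \<alpha> \<noteq> []} \<Longrightarrow> blinfun_apply T (e \<alpha> v) = e (i # \<alpha>) v"
    by (rule bounded_family_extends[of "{\<alpha>. \<alpha> \<noteq> []}" e "\<lambda>\<alpha>. e (i # \<alpha>)" 1])
      (use clin dense bound in auto)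
  then show ?thesis by auto
qed

text \<open>The operators \<open>T\<^sub>i\<close>; the maps \<open>Q\<^sub>i\<close> and their adjoints are \<open>insertion\<close> and
  \<open>readout\<close> below.\<close>

definition shift :: "'d \<Rightarrow> ('h \<Rightarrow>\<^sub>L 'h)" where
  "shift i = (SOME T. T \<in> clinear_ops \<and> norm T \<le> 1 \<and>
     (\<forall>\<alpha> v. \<alpha> \<noteq> [] \<longrightarrow> blinfun_apply T (e \<alpha> v) = e (i # \<alpha>) v))"

lemma shift: "shift i \<in> clinear_ops" "norm (shift i) \<le> 1"
  "\<alpha> \<noteq> [] \<Longrightarrow> blinfun_apply (shift i) (e \<alpha> v) = e (i # \<alpha>) v"
  using someI_ex[OF shift_exists[of i]] unfolding shift_def[symmetric] by auto

lemma shift_selfadjoint: "selfadjoint_op (shift i)"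
proof -
  have gen: "cinner (blinfun_apply (shift i) (e \<alpha> v)) (e \<beta> w) = cinner (e \<alpha> v) (blinfun_apply (shift i) (e \<beta> w))"
    if "\<alpha> \<noteq> []" "\<beta> \<noteq> []" for \<alpha> \<beta> v w
    using that by (simp add: shift(3) gram)
  have half: "(\<lambda>x. cinner (blinfun_apply (shift i) x) (e \<beta> w)) = (\<lambda>x. cinner x (blinfun_apply (shift i) (e \<beta> w)))"
    if "\<beta> \<noteq> []" for \<beta> w
    by (rule bounded_linear_eq_on_dense_sums[OF dense])
      (use gen that in \<open>auto intro: bounded_linear_cinner_left
        bounded_linear_compose[OF bounded_linear_cinner_left blinfun.bounded_linear_right]\<close>)
  have "(\<lambda>y. cinner (blinfun_apply (shift i) x) y) = (\<lambda>y. cinner x (blinfun_apply (shift i) y))" for x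
    by (rule bounded_linear_eq_on_dense_sums[OF dense])
      (use fun_cong[OF half] in \<open>auto intro: bounded_linear_cinner_right
        bounded_linear_compose[OF bounded_linear_cinner_right blinfun.bounded_linear_right]\<close>)
  then show ?thesis
    unfolding selfadjoint_op_def by (auto dest: fun_cong)
qed

definition insertion :: "'d \<Rightarrow> ('k \<Rightarrow>\<^sub>L 'h)" where
  "insertion i = Blinfun (e [i])"

lemma insertion_apply: "blinfun_apply (insertion i) v = e [i] v"
proof -
  have "norm (e [i] x) \<le> norm x * sqrt (norm (c [i, i]))" for x
  proof (rule power2_le_imp_le)
    have "(norm (e [i] x))\<^sup>2 = cmod (cinner (e [i] x) (e [i] x))"
      unfolding cinner_self norm_of_real by simp
    also have "\<dots> \<le> norm (blinfun_apply (c [i, i]) x) * norm x"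
      by (simp add: gram cmod_cinner_le)
    also have "\<dots> \<le> norm (c [i, i]) * norm x * norm x"
      by (intro mult_right_mono norm_blinfun) auto
    finally show "(norm (e [i] x))\<^sup>2 \<le> (norm x * sqrt (norm (c [i, i])))\<^sup>2"
      by (simp add: power_mult_distrib) (simp add: power2_eq_square mult_ac)
  qed simp
  then have "bounded_linear (e [i])"
    using clin[of "[i]"] unfolding clinear_fun_def
    by (intro bounded_linear_intro) (auto simp flip: scaleC_of_real)
  then show ?thesis
    by (simp add: insertion_def bounded_linear_Blinfun_apply)
qed

lemma insertion_clinear: "insertion i \<in> clinear_ops"
  using clin[of "[i]"] by (simp add: clinear_ops_def insertion_apply clinear_fun_def)

text \<open>The adjoint of \<open>insertion i\<close> prepends \<open>i\<close> to a word and then reads off its coefficient.\<close>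

lemma readout_exists:
  "\<exists>B. B \<in> clinear_ops \<and> (\<forall>\<alpha> v. \<alpha> \<noteq> [] \<longrightarrow> blinfun_apply B (e \<alpha> v) = blinfun_apply (c (i # \<alpha>)) v)"
proof -
  let ?K = "norm (insertion i)"
  have bound: "norm (\<Sum>\<alpha>\<in>F. blinfun_apply (c (i # \<alpha>)) (v \<alpha>)) \<le> ?K * norm (\<Sum>\<alpha>\<in>F. e \<alpha> (v \<alpha>))"
    if F: "F \<subseteq> {\<alpha>. \<alpha> \<noteq> []}" for F v
  proof -
    define y where "y = (\<Sum>\<alpha>\<in>F. blinfun_apply (c (i # \<alpha>)) (v \<alpha>))"
    define x where "x = (\<Sum>\<alpha>\<in>F. e \<alpha> (v \<alpha>))"
    have "cinner (blinfun_apply (c (i # \<alpha>)) (v \<alpha>)) y = cinner (e \<alpha> (v \<alpha>)) (e [i] y)" if "\<alpha> \<in> F" for \<alpha>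
      using F that gram[of \<alpha> "[i]" "v \<alpha>" y] by auto
    then have "(\<Sum>\<alpha>\<in>F. cinner (blinfun_apply (c (i # \<alpha>)) (v \<alpha>)) y) = (\<Sum>\<alpha>\<in>F. cinner (e \<alpha> (v \<alpha>)) (e [i] y))"
      by (rule sum.cong[OF refl])
    then have "cinner y y = cinner x (blinfun_apply (insertion i) y)"
      by (simp add: cinner_sum_left[symmetric] insertion_apply flip: x_def y_def)
    then have "complex_of_real ((norm y)\<^sup>2) = cinner x (blinfun_apply (insertion i) y)"
      by (simp only: cinner_self)
    from arg_cong[OF this, of cmod]
    have "(norm y)\<^sup>2 = cmod (cinner x (blinfun_apply (insertion i) y))"
      unfolding norm_of_real by simp
    also have "\<dots> \<le> norm x * norm (blinfun_apply (insertion i) y)"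
      by (rule cmod_cinner_le)
    also have "\<dots> \<le> norm x * (?K * norm y)"
      by (intro mult_left_mono norm_blinfun) auto
    finally have "norm y * norm y \<le> (?K * norm x) * norm y"
      by (simp add: power2_eq_square mult_ac)
    then have "norm y \<le> ?K * norm x"
      by (cases "norm y = 0") (auto simp: mult_le_cancel_right)
    then show ?thesis by (simp only: x_def y_def)
  qed
  have lin: "clinear_fun (blinfun_apply (c w))" for w
    by (simp add: clinear_fun_def blinfun.add_right coefficient_scaleC)
  obtain B where "B \<in> clinear_ops"
    "\<And>\<alpha> v. \<alpha> \<in> {\<alpha>. \<alpha> \<noteq> []} \<Longrightarrow> blinfun_apply B (e \<alpha> v) = blinfun_apply (c (i # \<alpha>)) v"
    by (rule bounded_family_extends[of "{\<alpha>. \<alpha> \<noteq> []}" e "\<lambda>\<alpha>. blinfun_apply (c (i # \<alpha>))" ?K])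
      (use clin dense bound lin in auto)
  then show ?thesis by auto
qed

definition readout :: "'d \<Rightarrow> ('h \<Rightarrow>\<^sub>L 'k)" where
  "readout i = (SOME B. B \<in> clinear_ops \<and>
     (\<forall>\<alpha> v. \<alpha> \<noteq> [] \<longrightarrow> blinfun_apply B (e \<alpha> v) = blinfun_apply (c (i # \<alpha>)) v))"

lemma readout: "readout i \<in> clinear_ops"
  "\<alpha> \<noteq> [] \<Longrightarrow> blinfun_apply (readout i) (e \<alpha> v) = blinfun_apply (c (i # \<alpha>)) v"
  using someI_ex[OF readout_exists[of i]] unfolding readout_def[symmetric] by auto

lemma readout_adjoint: "cinner (blinfun_apply (insertion i) x) y = cinner x (blinfun_apply (readout i) y)"
proof -
  have gen: "cinner (blinfun_apply (insertion i) x) (e \<alpha> v) = cinner x (blinfun_apply (readout i) (e \<alpha> v))"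
    if "\<alpha> \<noteq> []" for \<alpha> v
    using that gram[of \<alpha> "[i]" v x] cinner_commute[of "e [i] x" "e \<alpha> v"]
      cinner_commute[of x "blinfun_apply (c (i # \<alpha>)) v"]
    by (simp add: readout(2) insertion_apply)
  have "(\<lambda>y. cinner (blinfun_apply (insertion i) x) y) = (\<lambda>y. cinner x (blinfun_apply (readout i) y))"
    by (rule bounded_linear_eq_on_dense_sums[OF dense])
      (use gen in \<open>auto intro: bounded_linear_cinner_right
        bounded_linear_compose[OF bounded_linear_cinner_right blinfun.bounded_linear_right]\<close>)
  then show ?thesis by (rule fun_cong)
qed

text \<open>The entries of the operator matrix \<open>\<Sum>\<^sub>i T\<^sub>i \<otimes> Z\<^sub>i\<close>.\<close>

definition pencil :: "('d \<Rightarrow> complex mat) \<Rightarrow> nat \<Rightarrow> nat \<Rightarrow> ('h \<Rightarrow>\<^sub>L 'h)" where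
  "pencil Z p q = (\<Sum>i\<in>UNIV. scaleC_op (Z i $$ (p, q)) (shift i))"

text \<open>On tuples of finite sums of word vectors this is the contraction estimate for words; both sides
  are continuous, and such tuples are dense.\<close>

lemma pencil_contraction:
  assumes Z: "Z \<in> complex_nc_ball n r"
  shows "L2_set (\<lambda>p. norm (\<Sum>q<n. blinfun_apply (pencil Z p q) (u q))) {..<n} \<le> L2_set (\<lambda>p. norm (u p)) {..<n}"
proof -
  define D where "D = {\<Sum>\<alpha>\<in>F. e \<alpha> (v \<alpha>) | F v. finite F \<and> F \<subseteq> {\<alpha>. \<alpha> \<noteq> []}}"
  have on_D: "L2_set (\<lambda>p. norm (\<Sum>q<n. blinfun_apply (pencil Z p q) (y q))) {..<n} \<le> L2_set (\<lambda>p. norm (y p)) {..<n}"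
    if y: "\<And>p. y p \<in> D" for y
  proof -
    have "\<exists>F v. finite F \<and> F \<subseteq> {\<alpha>. \<alpha> \<noteq> []} \<and> y p = (\<Sum>\<alpha>\<in>F. e \<alpha> (v \<alpha>))" for p
      using y[of p] unfolding D_def by blast
    then obtain G v where G: "\<And>p. finite (G p)" "\<And>p. G p \<subseteq> {\<alpha>. \<alpha> \<noteq> []}"
      "\<And>p. y p = (\<Sum>\<alpha>\<in>G p. e \<alpha> (v p \<alpha>))"
      by metis
    define F where "F = (\<Union>p<n. G p)"
    define w where "w = (\<lambda>p \<alpha>. if \<alpha> \<in> G p then v p \<alpha> else 0)"
    have F: "finite F" "[] \<notin> F" using G(1,2) by (auto simp: F_def)
    have y_eq: "y p = (\<Sum>\<alpha>\<in>F. e \<alpha> (w p \<alpha>))" if "p < n" for p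
      unfolding G(3)
    proof (rule sum.mono_neutral_cong_left[OF F(1)])
      show "G p \<subseteq> F" using that by (auto simp: F_def)
      show "\<forall>\<alpha>\<in>F - G p. e \<alpha> (w p \<alpha>) = 0"
        using F(2) e_zero by (auto simp: w_def) metis
    qed (auto simp: w_def)
    have "(\<Sum>q<n. blinfun_apply (pencil Z p q) (y q))
        = (\<Sum>i\<in>UNIV. \<Sum>q<n. \<Sum>\<alpha>\<in>F. scaleC (Z i $$ (p, q)) (e (i # \<alpha>) (w q \<alpha>)))" for p
    proof -
      have "(\<Sum>q<n. blinfun_apply (pencil Z p q) (y q))
          = (\<Sum>q<n. \<Sum>i\<in>UNIV. \<Sum>\<alpha>\<in>F. scaleC (Z i $$ (p, q)) (e (i # \<alpha>) (w q \<alpha>)))"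
      proof (rule sum.cong[OF refl])
        fix q assume "q \<in> {..<n}"
        then have q: "y q = (\<Sum>\<alpha>\<in>F. e \<alpha> (w q \<alpha>))" by (simp add: y_eq)
        have "blinfun_apply (shift i) (y q) = (\<Sum>\<alpha>\<in>F. e (i # \<alpha>) (w q \<alpha>))" for i
          unfolding q blinfun.sum_right using F(2) by (intro sum.cong refl shift(3)) metis
        then show "blinfun_apply (pencil Z p q) (y q)
            = (\<Sum>i\<in>UNIV. \<Sum>\<alpha>\<in>F. scaleC (Z i $$ (p, q)) (e (i # \<alpha>) (w q \<alpha>)))"
          by (simp add: pencil_def blinfun.sum_left scaleC_sum_right)
      qed
      also have "\<dots> = (\<Sum>i\<in>UNIV. \<Sum>q<n. \<Sum>\<alpha>\<in>F. scaleC (Z i $$ (p, q)) (e (i # \<alpha>) (w q \<alpha>)))"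
        by (rule sum.swap)
      finally show ?thesis .
    qed
    moreover have "L2_set (\<lambda>p. norm (y p)) {..<n} = L2_set (\<lambda>p. norm (\<Sum>\<alpha>\<in>F. e \<alpha> (w p \<alpha>))) {..<n}"
      by (intro L2_set_cong) (auto simp: y_eq)
    ultimately show ?thesis
      using contraction[OF Z F(2), of w] by simp
  qed
  have "\<exists>X. (\<forall>k::nat. X k \<in> D) \<and> X \<longlonglongrightarrow> u p" for p
    using closure_sequential[of "u p" D] dense unfolding dense_sums_def D_def[symmetric] by auto
  then obtain X where X: "\<And>p k. X p k \<in> D" "\<And>p. X p \<longlonglongrightarrow> u p"
    by metis
  show ?thesis
  proof (rule LIMSEQ_le)
    show "(\<lambda>k. L2_set (\<lambda>p. norm (\<Sum>q<n. blinfun_apply (pencil Z p q) (X q k))) {..<n})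
        \<longlonglongrightarrow> L2_set (\<lambda>p. norm (\<Sum>q<n. blinfun_apply (pencil Z p q) (u q))) {..<n}"
      unfolding L2_set_def by (intro tendsto_intros X)
    show "(\<lambda>k. L2_set (\<lambda>p. norm (X p k)) {..<n}) \<longlonglongrightarrow> L2_set (\<lambda>p. norm (u p)) {..<n}"
      unfolding L2_set_def by (intro tendsto_intros X)
    show "\<exists>N. \<forall>k\<ge>N. L2_set (\<lambda>p. norm (\<Sum>q<n. blinfun_apply (pencil Z p q) (X q k))) {..<n}
        \<le> L2_set (\<lambda>p. norm (X p k)) {..<n}"
      using on_D[of "\<lambda>p. X p _"] X(1) by blast
  qed
qed

text \<open>The ball is open, so a contraction on the whole ball is a strict contraction at each of its
  points.\<close>

lemma pencil_strict_contraction: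
  assumes Z: "Z \<in> complex_nc_ball n r"
  obtains \<rho> where "0 \<le> \<rho>" "\<rho> < 1"
    "\<And>u. L2_set (\<lambda>p. norm (\<Sum>q<n. blinfun_apply (pencil Z p q) (u q))) {..<n} \<le> \<rho> * L2_set (\<lambda>p. norm (u p)) {..<n}"
proof -
  have Zc: "\<And>i. Z i \<in> carrier_mat n n" and n: "0 < n"
    using Z by (simp_all add: complex_nc_ball_iff)
  define s where "s = tuple_norm Z"
  have s: "s < r" using Z by (simp add: complex_nc_ball_def s_def)
  have le_s: "mat_norm (Z i) \<le> s" for i
    unfolding s_def tuple_norm_def by (rule Max_ge) auto
  then have s0: "0 \<le> s" using mat_norm_nonneg[OF Zc] order_trans by blast
  \<comment> \<open>A factor \<open>t > 1\<close> with \<open>t * s < r\<close>; the summand \<open>1\<close> in the denominator allows \<open>s = 0\<close>.\<close>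
  define t where "t = 1 + (r - s) / (2 * (s + 1))"
  have t: "1 < t" using s s0 by (simp add: t_def)
  have "t * s = s + (r - s) * (s / (2 * (s + 1)))" by (simp add: t_def algebra_simps)
  moreover have "(r - s) * (s / (2 * (s + 1))) < (r - s) * 1"
    using s s0 by (intro mult_strict_left_mono) (auto simp: field_simps)
  ultimately have ts: "t * s < r" by simp
  define Y where "Y = (\<lambda>i. complex_of_real t \<cdot>\<^sub>m Z i)"
  have "mat_norm (Y i) < r" for i
  proof -
    have "mat_norm (Y i) \<le> t * mat_norm (Z i)"
    proof (rule mat_norm_leI)
      fix x :: "nat \<Rightarrow> complex"
      have "L2_set (\<lambda>p. cmod (\<Sum>q<n. Y i $$ (p, q) * x q)) {..<n}
          = L2_set (\<lambda>p. t * cmod (\<Sum>q<n. Z i $$ (p, q) * x q)) {..<n}"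
      proof (rule L2_set_cong[OF refl])
        fix p assume "p \<in> {..<n}"
        then have "(\<Sum>q<n. Y i $$ (p, q) * x q) = complex_of_real t * (\<Sum>q<n. Z i $$ (p, q) * x q)"
          unfolding sum_distrib_left using Zc[of i] by (intro sum.cong) (auto simp: Y_def)
        then show "cmod (\<Sum>q<n. Y i $$ (p, q) * x q) = t * cmod (\<Sum>q<n. Z i $$ (p, q) * x q)"
          using t by (simp add: norm_mult)
      qed
      also have "\<dots> = t * L2_set (\<lambda>p. cmod (\<Sum>q<n. Z i $$ (p, q) * x q)) {..<n}"
        using t by (simp add: L2_set_right_distrib)
      also have "\<dots> \<le> t * (mat_norm (Z i) * L2_set (\<lambda>q. cmod (x q)) {..<n})"
        using t by (intro mult_left_mono L2_set_mult_le_mat_norm Zc) auto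
      finally show "L2_set (\<lambda>p. cmod (\<Sum>q<n. Y i $$ (p, q) * x q)) {..<n}
          \<le> t * mat_norm (Z i) * L2_set (\<lambda>q. cmod (x q)) {..<n}" by (simp add: mult.assoc)
    qed (use t mat_norm_nonneg[OF Zc] Zc in \<open>auto simp: Y_def\<close>)
    also have "\<dots> \<le> t * s" using t le_s by (intro mult_left_mono) auto
    finally show ?thesis using ts by simp
  qed
  then have Y: "Y \<in> complex_nc_ball n r"
    using n Zc by (simp add: complex_nc_ball_iff Y_def)
  show ?thesis
  proof
    show "0 \<le> 1 / t" "1 / t < 1" using t by auto
    fix u :: "nat \<Rightarrow> 'h"
    have "L2_set (\<lambda>p. norm (\<Sum>q<n. blinfun_apply (pencil Y p q) (u q))) {..<n}
        = L2_set (\<lambda>p. t * norm (\<Sum>q<n. blinfun_apply (pencil Z p q) (u q))) {..<n}"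
    proof (rule L2_set_cong[OF refl])
      fix p assume p: "p \<in> {..<n}"
      have "blinfun_apply (pencil Y p q) x = scaleC t (blinfun_apply (pencil Z p q) x)" if "q < n" for q x
      proof -
        have "Y i $$ (p, q) = t * Z i $$ (p, q)" for i
          using p that Zc[of i] by (simp add: Y_def)
        then show ?thesis
          by (simp add: pencil_def blinfun.sum_left scaleC_sum_right scaleC_scaleC)
      qed
      then have "(\<Sum>q<n. blinfun_apply (pencil Y p q) (u q)) = scaleC t (\<Sum>q<n. blinfun_apply (pencil Z p q) (u q))"
        by (simp add: scaleC_sum_right)
      then show "norm (\<Sum>q<n. blinfun_apply (pencil Y p q) (u q)) = t * norm (\<Sum>q<n. blinfun_apply (pencil Z p q) (u q))"
        using t by (simp add: norm_scaleC)
    qed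
    also have "\<dots> = t * L2_set (\<lambda>p. norm (\<Sum>q<n. blinfun_apply (pencil Z p q) (u q))) {..<n}"
      using t by (simp add: L2_set_right_distrib)
    finally show "L2_set (\<lambda>p. norm (\<Sum>q<n. blinfun_apply (pencil Z p q) (u q))) {..<n}
        \<le> 1 / t * L2_set (\<lambda>p. norm (u p)) {..<n}"
      using pencil_contraction[OF Y, of u] t by (simp add: field_simps)
  qed
qed

fun word_shift :: "'d list \<Rightarrow> ('h \<Rightarrow>\<^sub>L 'h)" where
  "word_shift [] = id_blinfun"
| "word_shift (i # w) = shift i o\<^sub>L word_shift w"

lemma word_shift_apply: "\<alpha> \<noteq> [] \<Longrightarrow> blinfun_apply (word_shift w) (e \<alpha> v) = e (w @ \<alpha>) v"
  by (induction w) (auto simp: shift(3))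

lemma word_shift_scaleC: "blinfun_apply (word_shift w) (scaleC a x) = scaleC a (blinfun_apply (word_shift w) x)"
  by (induction w) (auto simp: clinear_opsD[OF shift(1)])

lemma pencil_power:
  assumes Z: "\<And>i. Z i \<in> carrier_mat n n" and "p < n" "q < n"
  shows "kernel_power n (pencil Z) k p q
    = (\<Sum>w\<in>words_of_length k. scaleC_op (word_power n Z w $$ (p, q)) (word_shift w))"
  using assms(2)
proof (induction k arbitrary: p)
  case 0
  then show ?case using assms(3) by simp
next
  case (Suc k)
  note W = word_power_carrier[of Z n, OF Z]
  show ?case
  proof (rule blinfun_eqI)
    fix x
    have "blinfun_apply (kernel_power n (pencil Z) (Suc k) p q) x
        = (\<Sum>s<n. \<Sum>i\<in>UNIV. \<Sum>w\<in>words_of_length k. scaleC (Z i $$ (p, s) * word_power n Z w $$ (s, q))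
            (blinfun_apply (word_shift (i # w)) x))"
    proof -
      have "blinfun_apply (pencil Z p s) (blinfun_apply (kernel_power n (pencil Z) k s q) x)
          = (\<Sum>i\<in>UNIV. \<Sum>w\<in>words_of_length k. scaleC (Z i $$ (p, s) * word_power n Z w $$ (s, q))
              (blinfun_apply (word_shift (i # w)) x))" if "s < n" for s
        unfolding Suc.IH[OF that]
        by (simp add: pencil_def blinfun.sum_left blinfun.sum_right scaleC_sum_right scaleC_scaleC
            clinear_opsD[OF shift(1)]) (rule sum.swap)
      then show ?thesis by (simp add: blinfun.sum_left)
    qed
    also have "\<dots> = (\<Sum>i\<in>UNIV. \<Sum>w\<in>words_of_length k. \<Sum>s<n.
        scaleC (Z i $$ (p, s) * word_power n Z w $$ (s, q)) (blinfun_apply (word_shift (i # w)) x))"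
      by ((rule trans[OF sum.swap], rule sum.cong[OF refl]), rule sum.swap)
    also have "\<dots> = (\<Sum>i\<in>UNIV. \<Sum>w\<in>words_of_length k.
        scaleC (word_power n Z (i # w) $$ (p, q)) (blinfun_apply (word_shift (i # w)) x))"
      using index_mult_mat_sum[OF Z W Suc.prems assms(3)]
      by (simp add: word_power_Cons scaleC_sum_left)
    also have "\<dots> = blinfun_apply (\<Sum>w\<in>words_of_length (Suc k). scaleC_op (word_power n Z w $$ (p, q)) (word_shift w)) x"
      using sum_words_add[of "\<lambda>w. scaleC (word_power n Z w $$ (p, q)) (blinfun_apply (word_shift w) x)" 1 k]
        sum_words_1[of "\<lambda>u. \<Sum>w\<in>words_of_length k. scaleC (word_power n Z (u @ w) $$ (p, q)) (blinfun_apply (word_shift (u @ w)) x)"]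
      by (simp add: blinfun.sum_left)
    finally show "blinfun_apply (kernel_power n (pencil Z) (Suc k) p q) x
      = blinfun_apply (\<Sum>w\<in>words_of_length (Suc k). scaleC_op (word_power n Z w $$ (p, q)) (word_shift w)) x" .
  qed
qed

end


section \<open>The transfer function formula\<close>

text \<open>The sum over all words may be grouped by degree, which turns it into the series that the
  Neumann series is compared with.\<close>

lemma sums_by_word_length:
  fixes h :: "'d::finite list \<Rightarrow> 'b::banach"
  assumes "(h has_sum s) UNIV"
  shows "(\<lambda>k. \<Sum>w\<in>words_of_length k. h w) sums s"
proof -
  have "((\<lambda>(k, w). h w) has_sum s) (Sigma (UNIV :: nat set) words_of_length)"
    using assms
    by (subst has_sum_reindex_bij_witness[where j = snd and i = "\<lambda>w. (length w, w)" and T = UNIV and h = h])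
      (auto simp: words_of_length_def)
  then have "((\<lambda>k. \<Sum>w\<in>words_of_length k. h w) has_sum s) UNIV"
    by (rule has_sum_SigmaD) (auto intro: has_sum_finite)
  then show ?thesis by (rule has_sum_imp_sums)
qed

context realized_series
begin

lemma adj_insertion_entry:
  assumes Z: "\<And>i. Z i \<in> carrier_mat n n" and "p < n" "q < n"
  shows "op_mat_adj (op_tensor_sum n UNIV insertion (\<lambda>i. mat_adjoint (Z i))) $$ (p, q)
    = (\<Sum>i\<in>UNIV. scaleC_op (Z i $$ (p, q)) (readout i))"
proof -
  have "mat_adjoint (Z i) $$ (q, p) = cnj (Z i $$ (p, q))" for i
    using mat_adjoint_index(2)[OF Z assms(3,2)] .
  then have "op_mat_adj (op_tensor_sum n UNIV insertion (\<lambda>i. mat_adjoint (Z i))) $$ (p, q)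
      = adj_op (\<Sum>i\<in>UNIV. scaleC_op (cnj (Z i $$ (p, q))) (insertion i))"
    using assms(2,3) by (simp add: op_mat_adj_def op_tensor_sum_def)
  also have "\<dots> = (\<Sum>i\<in>UNIV. scaleC_op (Z i $$ (p, q)) (readout i))"
    by (rule adj_op_eqI)
      (simp add: blinfun.sum_left cinner_sum_left cinner_sum_right cinner_scaleC_left cinner_scaleC_right
        readout_adjoint)
  finally show ?thesis .
qed

text \<open>A word of length \<open>k + 2\<close> is \<open>i # w @ [j]\<close>, and \<open>readout i\<close>, \<open>word_shift w\<close> and \<open>insertion j\<close>
  compose to its coefficient.\<close>

lemma sandwich_pencil_power:
  assumes Z: "\<And>i. Z i \<in> carrier_mat n n" and pq: "p < n" "q < n"
  shows "(\<Sum>s<n. (\<Sum>i\<in>UNIV. scaleC_op (Z i $$ (p, s)) (readout i)) o\<^sub>L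
      (\<Sum>t<n. kernel_power n (pencil Z) k s t o\<^sub>L (\<Sum>j\<in>UNIV. scaleC_op (Z j $$ (t, q)) (insertion j))))
    = (\<Sum>w\<in>words_of_length (k + 2). scaleC_op (word_power n Z w $$ (p, q)) (c w))"
proof (rule blinfun_eqI)
  fix x
  let ?W = "word_power n Z"
  note W = word_power_carrier[of Z n, OF Z]
  have Z1: "?W [i] = Z i" for i
    using Z[of i] by (simp add: word_power_Cons)
  have cwx: "blinfun_apply (readout i) (blinfun_apply (word_shift w) (blinfun_apply (insertion j) x))
      = blinfun_apply (c (i # w @ [j])) x" for i j w
    by (simp add: insertion_apply word_shift_apply readout(2))
  have inner: "blinfun_apply (kernel_power n (pencil Z) k s t o\<^sub>L (\<Sum>j\<in>UNIV. scaleC_op (Z j $$ (t, q)) (insertion j))) x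
      = (\<Sum>w\<in>words_of_length k. \<Sum>j\<in>UNIV. scaleC (?W w $$ (s, t) * Z j $$ (t, q))
          (blinfun_apply (word_shift w) (blinfun_apply (insertion j) x)))"
    if "s < n" "t < n" for s t
    unfolding pencil_power[OF Z that]
    by (simp add: blinfun.sum_left blinfun.sum_right word_shift_scaleC scaleC_sum_right scaleC_scaleC)
      (rule sum.swap)
  have "blinfun_apply (\<Sum>s<n. (\<Sum>i\<in>UNIV. scaleC_op (Z i $$ (p, s)) (readout i)) o\<^sub>L
      (\<Sum>t<n. kernel_power n (pencil Z) k s t o\<^sub>L (\<Sum>j\<in>UNIV. scaleC_op (Z j $$ (t, q)) (insertion j)))) x
    = (\<Sum>s<n. \<Sum>t<n. \<Sum>w\<in>words_of_length k. \<Sum>j\<in>UNIV. \<Sum>i\<in>UNIV.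
        scaleC (Z i $$ (p, s) * (?W w $$ (s, t) * Z j $$ (t, q))) (blinfun_apply (c (i # w @ [j])) x))"
  proof -
    have "blinfun_apply ((\<Sum>i\<in>UNIV. scaleC_op (Z i $$ (p, s)) (readout i)) o\<^sub>L
        (\<Sum>t<n. kernel_power n (pencil Z) k s t o\<^sub>L (\<Sum>j\<in>UNIV. scaleC_op (Z j $$ (t, q)) (insertion j)))) x
      = (\<Sum>t<n. \<Sum>w\<in>words_of_length k. \<Sum>j\<in>UNIV. \<Sum>i\<in>UNIV.
        scaleC (Z i $$ (p, s) * (?W w $$ (s, t) * Z j $$ (t, q))) (blinfun_apply (c (i # w @ [j])) x))"
      if s: "s < n" for s
    proof -
      have "blinfun_apply (\<Sum>t<n. kernel_power n (pencil Z) k s t o\<^sub>L (\<Sum>j\<in>UNIV. scaleC_op (Z j $$ (t, q)) (insertion j))) x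
        = (\<Sum>t<n. \<Sum>w\<in>words_of_length k. \<Sum>j\<in>UNIV. scaleC (?W w $$ (s, t) * Z j $$ (t, q))
          (blinfun_apply (word_shift w) (blinfun_apply (insertion j) x)))"
        unfolding blinfun.sum_left by (intro sum.cong refl inner s) simp
      moreover have "blinfun_apply (\<Sum>i\<in>UNIV. scaleC_op (Z i $$ (p, s)) (readout i))
          (scaleC a (blinfun_apply (word_shift w) (blinfun_apply (insertion j) x)))
        = (\<Sum>i\<in>UNIV. scaleC (Z i $$ (p, s) * a) (blinfun_apply (c (i # w @ [j])) x))" for a w j
        by (simp add: blinfun.sum_left clinear_opsD[OF readout(1)] cwx scaleC_scaleC)
      ultimately show ?thesis
        by (simp add: blinfun.sum_right)
    qed
    then show ?thesis by (simp add: blinfun.sum_left)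
  qed
  also have "\<dots> = (\<Sum>i\<in>UNIV. \<Sum>w\<in>words_of_length k. \<Sum>j\<in>UNIV. \<Sum>s<n. \<Sum>t<n.
        scaleC (Z i $$ (p, s) * (?W w $$ (s, t) * Z j $$ (t, q))) (blinfun_apply (c (i # w @ [j])) x))"
    (is "?lhs = ?rhs")
  proof -
    let ?g = "\<lambda>s t w j i. scaleC (Z i $$ (p, s) * (?W w $$ (s, t) * Z j $$ (t, q))) (blinfun_apply (c (i # w @ [j])) x)"
    have "?lhs = (\<Sum>s<n. \<Sum>w\<in>words_of_length k. \<Sum>j\<in>UNIV. \<Sum>i\<in>UNIV. \<Sum>t<n. ?g s t w j i)"
      by (rule sum.cong[OF refl], (rule trans[OF sum.swap], rule sum.cong[OF refl])+, rule refl)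
    also have "\<dots> = (\<Sum>w\<in>words_of_length k. \<Sum>j\<in>UNIV. \<Sum>i\<in>UNIV. \<Sum>s<n. \<Sum>t<n. ?g s t w j i)"
      by ((rule trans[OF sum.swap], rule sum.cong[OF refl]), (rule trans[OF sum.swap], rule sum.cong[OF refl]),
          rule sum.swap)
    also have "\<dots> = (\<Sum>w\<in>words_of_length k. \<Sum>i\<in>UNIV. \<Sum>j\<in>UNIV. \<Sum>s<n. \<Sum>t<n. ?g s t w j i)"
      by (rule sum.cong[OF refl], rule sum.swap)
    also have "\<dots> = ?rhs"
      by (rule sum.swap)
    finally show ?thesis .
  qed
  also have "\<dots> = (\<Sum>i\<in>UNIV. \<Sum>w\<in>words_of_length k. \<Sum>j\<in>UNIV.
        scaleC (?W (i # w @ [j]) $$ (p, q)) (blinfun_apply (c (i # w @ [j])) x))"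
  proof (intro sum.cong refl)
    fix i w j
    have "?W (i # w @ [j]) $$ (p, q) = (\<Sum>s<n. Z i $$ (p, s) * ?W (w @ [j]) $$ (s, q))"
      unfolding word_power_Cons by (rule index_mult_mat_sum[OF Z W pq])
    also have "\<dots> = (\<Sum>s<n. Z i $$ (p, s) * (\<Sum>t<n. ?W w $$ (s, t) * Z j $$ (t, q)))"
      using index_mult_mat_sum[OF W Z _ pq(2), of _ w j]
      by (intro sum.cong) (simp_all add: word_power_append[of Z n, OF Z] Z1)
    finally show "(\<Sum>s<n. \<Sum>t<n. scaleC (Z i $$ (p, s) * (?W w $$ (s, t) * Z j $$ (t, q))) (blinfun_apply (c (i # w @ [j])) x))
        = scaleC (?W (i # w @ [j]) $$ (p, q)) (blinfun_apply (c (i # w @ [j])) x)"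
      by (simp add: scaleC_sum_left sum_distrib_left)
  qed
  also have "\<dots> = (\<Sum>w\<in>words_of_length (1 + (k + 1)). scaleC (?W w $$ (p, q)) (blinfun_apply (c w) x))"
    unfolding sum_words_add sum_words_1 by simp
  also have "\<dots> = blinfun_apply (\<Sum>w\<in>words_of_length (k + 2). scaleC_op (?W w $$ (p, q)) (c w)) x"
    by (simp add: blinfun.sum_left)
  finally show "blinfun_apply (\<Sum>s<n. (\<Sum>i\<in>UNIV. scaleC_op (Z i $$ (p, s)) (readout i)) o\<^sub>L
      (\<Sum>t<n. kernel_power n (pencil Z) k s t o\<^sub>L (\<Sum>j\<in>UNIV. scaleC_op (Z j $$ (t, q)) (insertion j)))) x
    = blinfun_apply (\<Sum>w\<in>words_of_length (k + 2). scaleC_op (?W w $$ (p, q)) (c w)) x" .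
qed

theorem transfer_function:
  assumes ball: "Z \<in> complex_nc_ball n r"
  obtains R where "op_mat_inverse n (op_mat_one n - op_tensor_sum n UNIV shift Z) R"
    "f Z = op_tensor (c []) (1\<^sub>m n) + op_tensor_sum n UNIV (\<lambda>i. c [i]) Z +
      op_mat_mult (op_mat_adj (op_tensor_sum n UNIV insertion (\<lambda>i. mat_adjoint (Z i))))
        (op_mat_mult R (op_tensor_sum n UNIV insertion Z))"
proof -
  have Z: "\<And>i. Z i \<in> carrier_mat n n" using ball by (simp add: complex_nc_ball_iff)
  let ?W = "word_power n Z"
  have S: "op_tensor_sum n UNIV shift Z = mat n n (\<lambda>(p, q). pencil Z p q)"
    by (simp add: op_tensor_sum_def pencil_def)
  obtain \<rho> where \<rho>: "0 \<le> \<rho>" "\<rho> < 1"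
    "\<And>u. L2_set (\<lambda>p. norm (\<Sum>q<n. blinfun_apply (pencil Z p q) (u q))) {..<n} \<le> \<rho> * L2_set (\<lambda>p. norm (u p)) {..<n}"
    using pencil_strict_contraction[OF ball] by blast
  obtain R where inv: "op_mat_inverse n (op_mat_one n - mat n n (\<lambda>(p, q). pencil Z p q)) R"
    and R: "\<And>p q. p < n \<Longrightarrow> q < n \<Longrightarrow> (\<lambda>k. kernel_power n (pencil Z) k p q) sums (R $$ (p, q))"
    using neumann_inverse[OF \<rho>] by blast
  have Rc: "R \<in> carrier_mat n n" using inv by (simp add: op_mat_inverse_def)
  let ?A = "op_mat_adj (op_tensor_sum n UNIV insertion (\<lambda>i. mat_adjoint (Z i)))"
  let ?B = "op_tensor_sum n UNIV insertion Z"
  have dims: "dim_row ?A = n" "dim_col ?A = n" "dim_row ?B = n" "dim_col ?B = n" "dim_row R = n" "dim_col R = n"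
    using Rc by (simp_all add: op_mat_adj_def op_tensor_sum_def)
  have entry: "f Z $$ (p, q) = scaleC_op (1\<^sub>m n $$ (p, q)) (c []) + (\<Sum>i\<in>UNIV. scaleC_op (Z i $$ (p, q)) (c [i]))
      + op_mat_mult ?A (op_mat_mult R ?B) $$ (p, q)" if pq: "p < n" "q < n" for p q
  proof -
    define g where "g = (\<lambda>k. \<Sum>w\<in>words_of_length k. scaleC_op (?W w $$ (p, q)) (c w))"
    have "g sums (f Z $$ (p, q))"
      unfolding g_def by (rule sums_by_word_length[OF entry_has_sum[OF series ball pq]])
    then have tail: "(\<lambda>k. g (k + 2)) sums (f Z $$ (p, q) - (\<Sum>k<2. g k))"
      by (rule sums_split_initial_segment)
    have B: "?B $$ (t, q) = (\<Sum>j\<in>UNIV. scaleC_op (Z j $$ (t, q)) (insertion j))" if "t < n" for t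
      using that pq by (simp add: op_tensor_sum_def)
    have A: "?A $$ (p, s) = (\<Sum>i\<in>UNIV. scaleC_op (Z i $$ (p, s)) (readout i))" if "s < n" for s
      by (rule adj_insertion_entry[OF Z pq(1) that])
    note right = bounded_linear.sums[OF bounded_bilinear.bounded_linear_right[OF bounded_bilinear_blinfun_compose]]
    note left = bounded_linear.sums[OF bounded_bilinear.bounded_linear_left[OF bounded_bilinear_blinfun_compose]]
    have "(\<lambda>k. \<Sum>s<n. ?A $$ (p, s) o\<^sub>L (\<Sum>t<n. kernel_power n (pencil Z) k s t o\<^sub>L ?B $$ (t, q)))
        sums (\<Sum>s<n. ?A $$ (p, s) o\<^sub>L (\<Sum>t<n. R $$ (s, t) o\<^sub>L ?B $$ (t, q)))"
      by (intro sums_sum right left R) auto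
    moreover have "(\<Sum>s<n. ?A $$ (p, s) o\<^sub>L (\<Sum>t<n. kernel_power n (pencil Z) k s t o\<^sub>L ?B $$ (t, q))) = g (k + 2)" for k
      using sandwich_pencil_power[where k = k, OF Z pq] by (simp add: g_def A B)
    ultimately have "(\<lambda>k. g (k + 2)) sums (\<Sum>s<n. ?A $$ (p, s) o\<^sub>L (\<Sum>t<n. R $$ (s, t) o\<^sub>L ?B $$ (t, q)))"
      by simp
    then have "f Z $$ (p, q) - (\<Sum>k<2. g k) = (\<Sum>s<n. ?A $$ (p, s) o\<^sub>L (\<Sum>t<n. R $$ (s, t) o\<^sub>L ?B $$ (t, q)))"
      by (rule sums_unique2[OF tail])
    also have "\<dots> = op_mat_mult ?A (op_mat_mult R ?B) $$ (p, q)"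
      using pq by (simp add: op_mat_mult_def dims)
    finally have "f Z $$ (p, q) - (\<Sum>k<2. g k) = op_mat_mult ?A (op_mat_mult R ?B) $$ (p, q)" .
    moreover have "(\<Sum>k<2. g k) = g 0 + g 1"
      by (simp add: numeral_2_eq_2)
    moreover have "g 0 = scaleC_op (1\<^sub>m n $$ (p, q)) (c [])"
      by (simp add: g_def)
    moreover have "g 1 = (\<Sum>i\<in>UNIV. scaleC_op (Z i $$ (p, q)) (c [i]))"
    proof -
      have "?W [i] = Z i" for i
        using Z[of i] by (simp add: word_power_Cons)
      then show ?thesis unfolding g_def sum_words_1 by simp
    qed
    ultimately show ?thesis by (simp add: algebra_simps)
  qed
  have fc: "f Z \<in> carrier_mat n n"
    using series ball unfolding nc_power_series_on_def by blast
  define C where "C = op_mat_mult ?A (op_mat_mult R ?B)"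
  have C: "dim_row C = n" "dim_col C = n"
    by (simp_all add: C_def op_mat_mult_def dims)
  have "f Z = op_tensor (c []) (1\<^sub>m n) + op_tensor_sum n UNIV (\<lambda>i. c [i]) Z + C"
  proof (rule eq_matI)
    fix p q
    assume "p < dim_row (op_tensor (c []) (1\<^sub>m n) + op_tensor_sum n UNIV (\<lambda>i. c [i]) Z + C)"
      "q < dim_col (op_tensor (c []) (1\<^sub>m n) + op_tensor_sum n UNIV (\<lambda>i. c [i]) Z + C)"
    then have pq: "p < n" "q < n" by (simp_all add: C)
    show "f Z $$ (p, q)
      = (op_tensor (c []) (1\<^sub>m n) + op_tensor_sum n UNIV (\<lambda>i. c [i]) Z + C) $$ (p, q)"
      unfolding entry[OF pq] C_def[symmetric] using pq by (simp add: C op_tensor_def op_tensor_sum_def)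
  qed (use fc C in simp_all)
  with inv show ?thesis unfolding S[symmetric] C_def by (rule that)
qed

end

text \<open>Every element of the span is a finite sum of symbols, one for each of its words, so the density of
  the image of \<open>\<iota>\<close> is density of sums of the vectors \<open>\<iota> (\<alpha> \<otimes> v)\<close>.\<close>

lemma realized_series_of_completion:
  fixes c :: "'d::finite list \<Rightarrow> ('k::complex_hilbert \<Rightarrow>\<^sub>L 'k)"
    and \<iota> :: "('d list \<Rightarrow>\<^sub>0 'k) \<Rightarrow> 'h::complex_hilbert"
  assumes ser: "nc_power_series_on r c f" and r: "1 < r" and compl: "word_completion c \<iota>"
  shows "realized_series r c f (\<lambda>\<alpha> v. \<iota> (Poly_Mapping.single \<alpha> v))"
proof -
  let ?e = "\<lambda>\<alpha> v. \<iota> (Poly_Mapping.single \<alpha> v)"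
  have add: "\<And>p q. p \<in> word_span \<Longrightarrow> q \<in> word_span \<Longrightarrow> \<iota> (p + q) = \<iota> p + \<iota> q"
    and scale: "\<And>a p. p \<in> word_span \<Longrightarrow> \<iota> (Poly_Mapping.map (scaleC a) p) = scaleC a (\<iota> p)"
    and inner: "\<And>p q. p \<in> word_span \<Longrightarrow> q \<in> word_span \<Longrightarrow> cinner (\<iota> p) (\<iota> q) = word_form c p q"
    and dense: "closure (\<iota> ` word_span) = UNIV"
    using compl unfolding word_completion_def by auto
  have mem: "Poly_Mapping.single \<alpha> v \<in> word_span" if "\<alpha> \<noteq> []" for \<alpha> :: "'d list" and v :: 'k
    using that by (auto simp: word_span_def)
  have sum_mem: "(\<Sum>\<alpha>\<in>F. Poly_Mapping.single \<alpha> (v \<alpha>)) \<in> word_span \<and>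
      \<iota> (\<Sum>\<alpha>\<in>F. Poly_Mapping.single \<alpha> (v \<alpha>)) = (\<Sum>\<alpha>\<in>F. ?e \<alpha> (v \<alpha>))"
    if "finite F" "[] \<notin> F" for F and v :: "'d list \<Rightarrow> 'k"
    using that
  proof (induction F rule: finite_induct)
    case empty
    have "(0 :: 'd list \<Rightarrow>\<^sub>0 'k) \<in> word_span" by (simp add: word_span_def)
    then show ?case using add[of 0 0] by simp
  next
    case (insert \<alpha> F)
    then have \<alpha>: "\<alpha> \<noteq> []" and IH: "(\<Sum>\<alpha>\<in>F. Poly_Mapping.single \<alpha> (v \<alpha>)) \<in> word_span"
      "\<iota> (\<Sum>\<alpha>\<in>F. Poly_Mapping.single \<alpha> (v \<alpha>)) = (\<Sum>\<alpha>\<in>F. ?e \<alpha> (v \<alpha>))"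
      by auto
    have "p + q \<in> word_span" if "p \<in> word_span" "q \<in> word_span" for p q :: "'d list \<Rightarrow>\<^sub>0 'k"
      using that by (simp add: word_span_def in_keys_iff lookup_add)
    then show ?case
      using insert.hyps add[OF mem[OF \<alpha>] IH(1), of "v \<alpha>"] mem[OF \<alpha>, of "v \<alpha>"] IH by simp
  qed
  have expand: "p = (\<Sum>\<alpha>\<in>Poly_Mapping.keys p. Poly_Mapping.single \<alpha> (Poly_Mapping.lookup p \<alpha>))"
    for p :: "'d list \<Rightarrow>\<^sub>0 'k"
  proof (rule poly_mapping_eqI)
    fix \<beta>
    have "Poly_Mapping.lookup (\<Sum>\<alpha>\<in>Poly_Mapping.keys p. Poly_Mapping.single \<alpha> (Poly_Mapping.lookup p \<alpha>)) \<beta>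
        = (\<Sum>\<alpha>\<in>Poly_Mapping.keys p. if \<alpha> = \<beta> then Poly_Mapping.lookup p \<alpha> else 0)"
      unfolding lookup_sum by (intro sum.cong) (auto simp: lookup_single when_def)
    then show "Poly_Mapping.lookup p \<beta>
        = Poly_Mapping.lookup (\<Sum>\<alpha>\<in>Poly_Mapping.keys p. Poly_Mapping.single \<alpha> (Poly_Mapping.lookup p \<alpha>)) \<beta>"
      by (auto simp: in_keys_iff)
  qed
  show ?thesis
  proof
    show "nc_power_series_on r c f" "1 < r" by fact+
  next
    fix \<alpha> \<beta> :: "'d list" and v w assume "\<alpha> \<noteq> []" "\<beta> \<noteq> []"
    then have "cinner (?e \<alpha> v) (?e \<beta> w) = word_form c (Poly_Mapping.single \<alpha> v) (Poly_Mapping.single \<beta> w)"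
      by (intro inner mem)
    also have "\<dots> = cinner (blinfun_apply (c (rev \<beta> @ \<alpha>)) v) w"
      by (subst word_form_superset[where F = "{\<alpha>}" and G = "{\<beta>}"]) auto
    finally show "cinner (?e \<alpha> v) (?e \<beta> w) = cinner (blinfun_apply (c (rev \<beta> @ \<alpha>)) v) w" .
  next
    fix \<alpha> :: "'d list" assume \<alpha>: "\<alpha> \<noteq> []"
    have "?e \<alpha> (scaleC a x) = scaleC a (?e \<alpha> x)" for a x
      using scale[OF mem[OF \<alpha>], of a x] by simp
    moreover have "?e \<alpha> (x + y) = ?e \<alpha> x + ?e \<alpha> y" for x y
      using add[OF mem[OF \<alpha>] mem[OF \<alpha>], of x y] by (simp add: single_add)
    ultimately show "clinear_fun (?e \<alpha>)" by (simp add: clinear_fun_def)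
  next
    have "\<iota> ` word_span \<subseteq> {\<Sum>\<alpha>\<in>F. ?e \<alpha> (v \<alpha>) | F v. finite F \<and> F \<subseteq> {\<alpha>. \<alpha> \<noteq> []}}"
    proof
      fix y assume "y \<in> \<iota> ` word_span"
      then obtain p where p: "p \<in> word_span" "y = \<iota> p" by blast
      then have "[] \<notin> Poly_Mapping.keys p" by (simp add: word_span_def)
      then have "y = (\<Sum>\<alpha>\<in>Poly_Mapping.keys p. ?e \<alpha> (Poly_Mapping.lookup p \<alpha>))"
        using sum_mem[of "Poly_Mapping.keys p" "Poly_Mapping.lookup p"] expand[of p] p(2) by simp
      then show "y \<in> {\<Sum>\<alpha>\<in>F. ?e \<alpha> (v \<alpha>) | F v. finite F \<and> F \<subseteq> {\<alpha>. \<alpha> \<noteq> []}}"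
        using \<open>[] \<notin> Poly_Mapping.keys p\<close> by (intro CollectI exI[of _ "Poly_Mapping.keys p"]) auto
    qed
    then show "dense_sums {\<alpha>. \<alpha> \<noteq> []} ?e"
      unfolding dense_sums_def using closure_mono dense by blast
  qed
qed

theorem theorem4p4:
  fixes \<epsilon> :: real
    and c :: "'d::finite list \<Rightarrow> ('k::complex_hilbert \<Rightarrow>\<^sub>L 'k)"
    and f :: "('d \<Rightarrow> complex mat) \<Rightarrow> ('k \<Rightarrow>\<^sub>L 'k) mat"
    and R\<^sub>2 :: "('k \<Rightarrow>\<^sub>L 'k) set"
  assumes "\<epsilon> > 0"
    and "real_operator_system R\<^sub>2"
    and "nc_power_series_on (1 + \<epsilon>) c f"
    and "\<And>n Z. Z \<in> real_nc_ball n (1 + \<epsilon>) \<Longrightarrow> f Z \<in> herm_mats_over n R\<^sub>2"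
    and "matrix_convex_on (1 + \<epsilon>) f"
  shows "word_form_semi_inner c \<and>
    (\<forall>\<iota> :: ('d list \<Rightarrow>\<^sub>0 'k) \<Rightarrow> 'h::complex_hilbert. word_completion c \<iota> \<longrightarrow>
      (\<exists>(T :: 'd \<Rightarrow> ('h \<Rightarrow>\<^sub>L 'h)) (Q :: 'd \<Rightarrow> ('k \<Rightarrow>\<^sub>L 'h)).
        range T \<subseteq> clinear_ops \<and>
        (\<forall>i \<alpha> v. \<alpha> \<noteq> [] \<longrightarrow>
           blinfun_apply (T i) (\<iota> (Poly_Mapping.single \<alpha> v)) =
             \<iota> (Poly_Mapping.single (i # \<alpha>) v)) \<and>
        (\<forall>i. selfadjoint_op (T i)) \<and>
        range Q \<subseteq> clinear_ops \<and>
        (\<forall>i v. blinfun_apply (Q i) v = \<iota> (Poly_Mapping.single [i] v)) \<and>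
        (\<forall>i. norm (T i) \<le> 1) \<and>
        (\<exists>a\<^sub>0 \<in> clinear_ops. \<exists>L :: 'd \<Rightarrow> ('k \<Rightarrow>\<^sub>L 'k). range L \<subseteq> clinear_ops \<and>
          (\<forall>n. \<forall>Z\<in>complex_nc_ball n (1 + \<epsilon>).
            \<exists>R. op_mat_inverse n (op_mat_one n - op_tensor_sum n UNIV T Z) R \<and>
              f Z = op_tensor a\<^sub>0 (1\<^sub>m n) + op_tensor_sum n UNIV L Z +
                op_mat_mult
                  (op_mat_adj (op_tensor_sum n UNIV Q (\<lambda>i. mat_adjoint (Z i))))
                  (op_mat_mult R (op_tensor_sum n UNIV Q Z))))))"
proof (intro conjI allI impI)
  have r: "1 < 1 + \<epsilon>" using assms(1) by simp
  show "word_form_semi_inner c"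
    by (rule word_form_semi_inner_of_matrix_convex[OF assms(3) r assms(5)])
  fix \<iota> :: "('d list \<Rightarrow>\<^sub>0 'k) \<Rightarrow> 'h"
  assume "word_completion c \<iota>"
  then interpret realized_series "1 + \<epsilon>" c f "\<lambda>\<alpha> v. \<iota> (Poly_Mapping.single \<alpha> v)"
    by (rule realized_series_of_completion[OF assms(3) r])
  have c: "range c \<subseteq> clinear_ops"
    using assms(3) by (simp add: nc_power_series_on_def)
  show "\<exists>(T :: 'd \<Rightarrow> ('h \<Rightarrow>\<^sub>L 'h)) (Q :: 'd \<Rightarrow> ('k \<Rightarrow>\<^sub>L 'h)).
        range T \<subseteq> clinear_ops \<and>
        (\<forall>i \<alpha> v. \<alpha> \<noteq> [] \<longrightarrow>
           blinfun_apply (T i) (\<iota> (Poly_Mapping.single \<alpha> v)) =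
             \<iota> (Poly_Mapping.single (i # \<alpha>) v)) \<and>
        (\<forall>i. selfadjoint_op (T i)) \<and>
        range Q \<subseteq> clinear_ops \<and>
        (\<forall>i v. blinfun_apply (Q i) v = \<iota> (Poly_Mapping.single [i] v)) \<and>
        (\<forall>i. norm (T i) \<le> 1) \<and>
        (\<exists>a\<^sub>0 \<in> clinear_ops. \<exists>L :: 'd \<Rightarrow> ('k \<Rightarrow>\<^sub>L 'k). range L \<subseteq> clinear_ops \<and>
          (\<forall>n. \<forall>Z\<in>complex_nc_ball n (1 + \<epsilon>).
            \<exists>R. op_mat_inverse n (op_mat_one n - op_tensor_sum n UNIV T Z) R \<and>
              f Z = op_tensor a\<^sub>0 (1\<^sub>m n) + op_tensor_sum n UNIV L Z +
                op_mat_mult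
                  (op_mat_adj (op_tensor_sum n UNIV Q (\<lambda>i. mat_adjoint (Z i))))
                  (op_mat_mult R (op_tensor_sum n UNIV Q Z))))"
  proof (intro exI[of _ shift] exI[of _ insertion] conjI allI impI bexI[of _ "c []"] exI[of _ "\<lambda>i. c [i]"] ballI)
    show "range shift \<subseteq> clinear_ops" "range insertion \<subseteq> clinear_ops"
      using shift(1) insertion_clinear by auto
    show "range (\<lambda>i. c [i]) \<subseteq> clinear_ops" "c [] \<in> clinear_ops"
      using c by auto
    fix n and Z :: "'d \<Rightarrow> complex mat" assume Z: "Z \<in> complex_nc_ball n (1 + \<epsilon>)"
    show "\<exists>R. op_mat_inverse n (op_mat_one n - op_tensor_sum n UNIV shift Z) R \<and>
        f Z = op_tensor (c []) (1\<^sub>m n) + op_tensor_sum n UNIV (\<lambda>i. c [i]) Z +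
          op_mat_mult (op_mat_adj (op_tensor_sum n UNIV insertion (\<lambda>i. mat_adjoint (Z i))))
            (op_mat_mult R (op_tensor_sum n UNIV insertion Z))"
      using transfer_function[OF Z] by blast
  qed (simp_all add: shift insertion_apply shift_selfadjoint)
qed

end
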